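(* Suppose that $\{S^{\tau(n)}_n:\mathcal{P}_n\to\mathcal{P}_n\}_{n=1}^\infty$ is a sequence of discrete maps that periodically approximates the flow $S^t:X\to X$ (in the sense defined in the context). Then for every smooth test function $\varphi\in\mathcal{D}(\mathbb{R})$ and every observable $g\in L^2(X,\mathcal{M},\mu)$, $$\lim_{n\to\infty}\left\|\mathcal{S}_{\varphi}g-\mathcal{S}^{\tau(n)}_{n,\varphi}g_n\right\|=0,$$ where $g_n=\mathcal{W}_ng$ and $$\mathcal{S}_\varphi g=\int_{\mathbb{R}}\varphi(\omega)\,\mathrm{d}\mathcal{S}_\omega g,\qquad \mathcal{S}^{\tau(n)}_{n,\varphi}g_n=\sum_{k=1}^{q(n)}\varphi(\omega_{n,k})\,\mathcal{S}^{\tau(n)}_{n,\omega_{n,k}}g_n .$$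
   Context: Setting. $X\subseteq\mathbb{R}^N$ is compact, with metric $d$ induced by a norm on $\mathbb{R}^N$. $S^t:X\to X$, $t\in\mathbb{R}$, is a flow: $S^t\circ S^s=S^{t+s}$ and $S^0=\mathrm{id}$. It is Lipschitz continuous: for every $T>0$ the map $(t,x)\mapsto S^t(x)$ is Lipschitz on $[-T,T]\times X$. $\mathcal{M}$ is the Borel sigma-algebra of $X$, and $\mu$ is a finite nonzero Borel measure on $X$, absolutely continuous with respect to Lebesgue measure, with $\operatorname{supp}\mu=X$, and invariant: $\mu(S^t(B))=\mu(B)$ for all $B\in\mathcal{M}$ and $t\in\mathbb{R}$. On $L^2(X,\mathcal{M},\mu)$ (complex-valued functions), $\langle g,h\rangle=\int_X g^*h\,\mathrm{d}\mu$, with norm $\|\cdot\|$. The Koopman unitary group is $\mathcal{U}^tg=g\circ S^t$. By the spectral theorem there is a unique projection-valued measure $\mathcal{S}$ on the Borel sets of $\mathbb{R}$ with $\mathcal{U}^tg=\int_{\mathbb{R}}e^{i\omega t}\,\mathrm{d}\mathcal{S}_\omega g$ for all $t\in\mathbb{R}$. $\mathcal{D}(\mathbb{R})$ denotes the space of smooth test functions on $\mathbb{R}$, i.e. the Schwartz space. Time steps. $\{\tau(n)\}_{n\ge1}$ is a monotonically decreasing sequence of positive reals converging to $0$, and $\xi_n(s)=\operatorname{sign}(s)\lceil |s|/\tau(n)\rceil\tau(n)$ for $s\in\mathbb{R}$. Partitions. $\mathcal{P}_n=\{p_{n,1},\dots,p_{n,q(n)}\}$, $n\ge1$, are measurable partitions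 of $X$ (the elements cover $X$ and distinct elements overlap only in $\mu$-null sets) such that: (i) each $p_{n,j}$ is compact and connected, and $\mu(p_{n,j})=\mu(X)/q(n)$, where $q:\mathbb{N}\to\mathbb{N}$ is strictly increasing; (ii) $\operatorname{diam}(p_{n,j})\le l(n)$, where $l$ is positive, monotone, and tends to $0$; (iii) for $n>m$, each $p_{m,j}$ is a union of elements of $\mathcal{P}_n$. Discrete maps. $S_n^{\tau(n)}:\mathcal{P}_n\to\mathcal{P}_n$ is a bijection of the finite set $\mathcal{P}_n$. For $k\in\mathbb{Z}$, $S_n^{k\tau(n)}$ is its $k$-th iterate, acting elementwise on unions of elements of $\mathcal{P}_n$ (viewed as subsets of $X$). For $A\subseteq X$, $A_n:=\bigcup\{p\in\mathcal{P}_n:p\cap A\ne\emptyset\}$. The sequence $\{S_n^{\tau(n)}\}$ periodically approximates $S^t$ if $$\lim_{n\to\infty}\int_{-t}^{t}d_H\left(S^s(A),S_n^{\xi_n(s)}(A_n)\right)\mathrm{d}s=0$$ for every $t\in\mathbb{R}$ and every nonempty compact $A\subseteq X$, where $d_H$ is the Hausdorff distance. Discrete Koopman operators and spectra. $L^2_n(X,\mathcal{M},\mu)$ is the span of the indicator functions $\chi_{p_{n,j}}$, $j=1,\dots,q(n)$. The averaging operator is $\mathcal{W}_ng=g_n=\sum_{j=1}^{q(n)}g_{n,j}\chi_{p_{n,j}}$ with $g_{n,j}=\frac{q(n)}{\mu(X)}\int_X g\,\chi_{p_{n,j}}\,\mathrm{d}\mu$. For $k\in\mathbb{Z}$, $\mathcal{U}_n^{k\tau(n)}g_n=\sum_{j}g_{n,j}\,\chi_{S_n^{-k\tau(n)}(p_{n,j})}$,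 a unitary (permutation) operator on $L^2_n(X,\mathcal{M},\mu)$. Let $v_{n,1},\dots,v_{n,q(n)}$ be an orthonormal basis of $L_n^2(X,\mathcal{M},\mu)$ of eigenfunctions, $\mathcal{U}_n^{\tau(n)}v_{n,k}=e^{i\theta_{n,k}}v_{n,k}$ with $\theta_{n,k}\in[-\pi,\pi)$, and put $\omega_{n,k}=\theta_{n,k}/\tau(n)$. $\mathcal{S}^{\tau(n)}_{n,\omega_{n,k}}g_n=v_{n,k}\langle v_{n,k},g_n\rangle$ is the rank-one projector attached to index $k$ (sums over eigenvalues are sums over $k=1,\dots,q(n)$). *)

theory Defs
  imports "HOL-Analysis.Analysis"
begin

definition is_norm :: "('a::real_vector \<Rightarrow> real) \<Rightarrow> bool" where
  "is_norm \<nu> \<longleftrightarrow>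
     (\<forall>x. 0 \<le> \<nu> x) \<and> (\<forall>x. \<nu> x = 0 \<longleftrightarrow> x = 0) \<and>
     (\<forall>c x. \<nu> (c *\<^sub>R x) = \<bar>c\<bar> * \<nu> x) \<and>
     (\<forall>x y. \<nu> (x + y) \<le> \<nu> x + \<nu> y)"

definition norm_diam :: "('a::real_vector \<Rightarrow> real) \<Rightarrow> 'a set \<Rightarrow> real" where
  "norm_diam \<nu> A = (SUP z\<in>A \<times> A. \<nu> (fst z - snd z))"

text \<open>Only meaningful for nonempty bounded sets, since \<open>SUP\<close> and \<open>INF\<close> are taken in the reals.\<close>

definition hausdorff_dist :: "('a::real_vector \<Rightarrow> real) \<Rightarrow> 'a set \<Rightarrow> 'a set \<Rightarrow> real" where
  "hausdorff_dist \<nu> A B =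
     max (SUP a\<in>A. INF b\<in>B. \<nu> (a - b)) (SUP b\<in>B. INF a\<in>A. \<nu> (a - b))"

definition lipschitz_flow_on ::
    "('a::real_vector \<Rightarrow> real) \<Rightarrow> 'a set \<Rightarrow> (real \<Rightarrow> 'a \<Rightarrow> 'a) \<Rightarrow> bool" where
  "lipschitz_flow_on \<nu> X S \<longleftrightarrow>
     (\<forall>t. S t ` X \<subseteq> X) \<and>
     (\<forall>x\<in>X. S 0 x = x) \<and>
     (\<forall>t s. \<forall>x\<in>X. S t (S s x) = S (t + s) x) \<and>
     (\<forall>T>0. \<exists>L. \<forall>t\<in>{-T..T}. \<forall>s\<in>{-T..T}. \<forall>x\<in>X. \<forall>y\<in>X.
        \<nu> (S t x - S s y) \<le> L * (\<bar>t - s\<bar> + \<nu> (x - y)))"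

definition measure_support :: "'a::topological_space measure \<Rightarrow> 'a set" where
  "measure_support M =
     {x \<in> space M. \<forall>U. open U \<and> x \<in> U \<longrightarrow> emeasure M (U \<inter> space M) > 0}"

definition flow_invariant :: "'a measure \<Rightarrow> (real \<Rightarrow> 'a \<Rightarrow> 'a) \<Rightarrow> bool" where
  "flow_invariant M S \<longleftrightarrow> (\<forall>B\<in>sets M. \<forall>t. emeasure M (S t ` B) = emeasure M B)"

text \<open>
  Elements of \<open>L\<^sup>2\<close> are represented by square-integrable functions; equality in \<open>L\<^sup>2\<close> is
  equality almost everywhere. The inner product is conjugate-linear in its first argument.
\<close>

definition L2 :: "'a measure \<Rightarrow> ('a \<Rightarrow> complex) set" where
  "L2 M = {g \<in> borel_measurable M. integrable M (\<lambda>x. (cmod (g x))\<^sup>2)}"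

definition L2_inner :: "'a measure \<Rightarrow> ('a \<Rightarrow> complex) \<Rightarrow> ('a \<Rightarrow> complex) \<Rightarrow> complex" where
  "L2_inner M g h = (LINT x|M. cnj (g x) * h x)"

definition L2_norm :: "'a measure \<Rightarrow> ('a \<Rightarrow> complex) \<Rightarrow> real" where
  "L2_norm M g = sqrt (LINT x|M. (cmod (g x))\<^sup>2)"

definition koopman :: "(real \<Rightarrow> 'a \<Rightarrow> 'a) \<Rightarrow> real \<Rightarrow> ('a \<Rightarrow> complex) \<Rightarrow> ('a \<Rightarrow> complex)" where
  "koopman S t g = (\<lambda>x. g (S t x))"

definition orth_projection_L2 ::
    "'a measure \<Rightarrow> (('a \<Rightarrow> complex) \<Rightarrow> ('a \<Rightarrow> complex)) \<Rightarrow> bool" where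
  "orth_projection_L2 M T \<longleftrightarrow>
     (\<forall>f\<in>L2 M. T f \<in> L2 M) \<and>
     (\<forall>f\<in>L2 M. \<forall>g\<in>L2 M. (AE x in M. f x = g x) \<longrightarrow> (AE x in M. T f x = T g x)) \<and>
     (\<forall>f\<in>L2 M. \<forall>g\<in>L2 M. \<forall>a b.
        AE x in M. T (\<lambda>y. a * f y + b * g y) x = a * T f x + b * T g x) \<and>
     (\<forall>f\<in>L2 M. AE x in M. T (T f) x = T f x) \<and>
     (\<forall>f\<in>L2 M. \<forall>g\<in>L2 M. L2_inner M (T f) g = L2_inner M f (T g))"

definition projection_valued_measure ::
    "'a measure \<Rightarrow> (real set \<Rightarrow> ('a \<Rightarrow> complex) \<Rightarrow> ('a \<Rightarrow> complex)) \<Rightarrow> bool" where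
  "projection_valued_measure M E \<longleftrightarrow>
     (\<forall>B\<in>sets borel. orth_projection_L2 M (E B)) \<and>
     (\<forall>g\<in>L2 M. AE x in M. E {} g x = 0) \<and>
     (\<forall>g\<in>L2 M. AE x in M. E UNIV g x = g x) \<and>
     (\<forall>A\<in>sets borel. \<forall>B\<in>sets borel. \<forall>g\<in>L2 M. AE x in M. E (A \<inter> B) g x = E A (E B g) x) \<and>
     (\<forall>B::nat \<Rightarrow> real set. range B \<subseteq> sets borel \<and> disjoint_family B \<longrightarrow>
        (\<forall>g\<in>L2 M. (\<lambda>m. L2_norm M (\<lambda>x. E (\<Union>i. B i) g x - (\<Sum>i<m. E (B i) g x)))
           \<longlonglongrightarrow> 0))"

definition pvm_simple_integral ::
    "(real set \<Rightarrow> ('a \<Rightarrow> complex) \<Rightarrow> ('a \<Rightarrow> complex)) \<Rightarrow> (real \<Rightarrow> complex) \<Rightarrow>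
     ('a \<Rightarrow> complex) \<Rightarrow> ('a \<Rightarrow> complex)" where
  "pvm_simple_integral E s g = (\<lambda>x. \<Sum>c\<in>range s. c * E (s -` {c}) g x)"

text \<open>
  The integral of a bounded Borel function against a projection-valued measure, applied to a
  vector \<open>g\<close>: the \<open>L\<^sup>2\<close> limit of integrals of simple functions converging uniformly to it.
  It is determined up to a null set, and \<open>pvm_integral\<close> picks a representative.
\<close>

definition has_pvm_integral ::
    "'a measure \<Rightarrow> (real set \<Rightarrow> ('a \<Rightarrow> complex) \<Rightarrow> ('a \<Rightarrow> complex)) \<Rightarrow> (real \<Rightarrow> complex) \<Rightarrow>
     ('a \<Rightarrow> complex) \<Rightarrow> ('a \<Rightarrow> complex) \<Rightarrow> bool" where
  "has_pvm_integral M E \<phi> g h \<longleftrightarrow>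
     h \<in> L2 M \<and>
     (\<exists>s::nat \<Rightarrow> real \<Rightarrow> complex.
        (\<forall>k. simple_function borel (s k)) \<and>
        uniform_limit UNIV s \<phi> sequentially \<and>
        (\<lambda>k. L2_norm M (\<lambda>x. pvm_simple_integral E (s k) g x - h x)) \<longlonglongrightarrow> 0)"

definition pvm_integral ::
    "'a measure \<Rightarrow> (real set \<Rightarrow> ('a \<Rightarrow> complex) \<Rightarrow> ('a \<Rightarrow> complex)) \<Rightarrow> (real \<Rightarrow> complex) \<Rightarrow>
     ('a \<Rightarrow> complex) \<Rightarrow> ('a \<Rightarrow> complex)" where
  "pvm_integral M E \<phi> g = (SOME h. has_pvm_integral M E \<phi> g h)"

definition koopman_spectral_measure ::
    "'a measure \<Rightarrow> (real \<Rightarrow> 'a \<Rightarrow> 'a) \<Rightarrow>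
     (real set \<Rightarrow> ('a \<Rightarrow> complex) \<Rightarrow> ('a \<Rightarrow> complex)) \<Rightarrow> bool" where
  "koopman_spectral_measure M S E \<longleftrightarrow>
     projection_valued_measure M E \<and>
     (\<forall>t. \<forall>g\<in>L2 M. has_pvm_integral M E (\<lambda>\<omega>. exp (\<i> * of_real (\<omega> * t))) g (koopman S t g))"

text \<open>In the next definition \<open>D k\<close> is the \<open>k\<close>-th derivative.\<close>

definition schwartz :: "(real \<Rightarrow> complex) \<Rightarrow> bool" where
  "schwartz \<phi> \<longleftrightarrow>
     (\<exists>D::nat \<Rightarrow> real \<Rightarrow> complex.
        D 0 = \<phi> \<and>
        (\<forall>k x. (D k has_vector_derivative D (Suc k) x) (at x)) \<and>
        (\<forall>j k. bounded (range (\<lambda>x. x ^ j *\<^sub>R D k x))))"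

definition partition_seq ::
    "('a::real_normed_vector \<Rightarrow> real) \<Rightarrow> 'a measure \<Rightarrow> (nat \<Rightarrow> nat) \<Rightarrow> (nat \<Rightarrow> real) \<Rightarrow>
     (nat \<Rightarrow> 'a set set) \<Rightarrow> bool" where
  "partition_seq \<nu> M q l P \<longleftrightarrow>
     (\<forall>n\<ge>1. finite (P n) \<and> card (P n) = q n \<and> \<Union>(P n) = space M \<and>
        (\<forall>p\<in>P n. \<forall>p'\<in>P n. p \<noteq> p' \<longrightarrow> emeasure M (p \<inter> p') = 0)) \<and>
     (\<forall>n\<ge>1. \<forall>p\<in>P n. compact p \<and> connected p \<and>
        measure M p = measure M (space M) / real (q n)) \<and>
     strict_mono_on {1..} q \<and>
     (\<forall>n\<ge>1. \<forall>p\<in>P n. norm_diam \<nu> p \<le> l n) \<and>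
     (\<forall>n\<ge>1. 0 < l n) \<and> antimono_on {1..} l \<and> l \<longlonglongrightarrow> 0 \<and>
     (\<forall>m\<ge>1. \<forall>n>m. \<forall>p\<in>P m. \<exists>Q\<subseteq>P n. p = \<Union>Q)"

text \<open>Integer iterates of a bijection \<open>F\<close> of the set \<open>P\<close>.\<close>

definition int_iterate :: "'b set \<Rightarrow> ('b \<Rightarrow> 'b) \<Rightarrow> int \<Rightarrow> 'b \<Rightarrow> 'b" where
  "int_iterate P F k = (if 0 \<le> k then F ^^ nat k else inv_into P F ^^ nat (- k))"

text \<open>
  The \<open>k\<close>-th iterate on a union \<open>U\<close> of partition elements, viewed as a subset of the phase
  space. Elements have positive measure and null overlaps, so the elements contained
  in \<open>U\<close> are exactly those of which \<open>U\<close> is the union.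
\<close>

definition iterate_on_union ::
    "'a set set \<Rightarrow> ('a set \<Rightarrow> 'a set) \<Rightarrow> int \<Rightarrow> 'a set \<Rightarrow> 'a set" where
  "iterate_on_union P F k U = \<Union>(int_iterate P F k ` {p \<in> P. p \<subseteq> U})"

definition outer_approx :: "'a set set \<Rightarrow> 'a set \<Rightarrow> 'a set" where
  "outer_approx P A = \<Union>{p \<in> P. p \<inter> A \<noteq> {}}"

text \<open>
  \<open>time_steps h s\<close> is the integer \<open>k\<close> with \<open>sign(s) \<lceil>\<bar>s\<bar> / h\<rceil> h = k h\<close>, so that the discrete map
  at time \<open>sign(s) \<lceil>\<bar>s\<bar> / h\<rceil> h\<close> is the \<open>k\<close>-th iterate of the map at time \<open>h\<close>.
\<close>

definition time_steps :: "real \<Rightarrow> real \<Rightarrow> int" where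
  "time_steps h s = (if s < 0 then - \<lceil>\<bar>s\<bar> / h\<rceil> else \<lceil>\<bar>s\<bar> / h\<rceil>)"

definition periodically_approximates ::
    "('a::real_normed_vector \<Rightarrow> real) \<Rightarrow> 'a set \<Rightarrow> (real \<Rightarrow> 'a \<Rightarrow> 'a) \<Rightarrow> (nat \<Rightarrow> real) \<Rightarrow>
     (nat \<Rightarrow> 'a set set) \<Rightarrow> (nat \<Rightarrow> 'a set \<Rightarrow> 'a set) \<Rightarrow> bool" where
  "periodically_approximates \<nu> X S \<tau> P F \<longleftrightarrow>
     (\<forall>t::real. \<forall>A. compact A \<and> A \<noteq> {} \<and> A \<subseteq> X \<longrightarrow>
        (\<lambda>n. LBINT s=-t..t. hausdorff_dist \<nu> (S s ` A)
             (iterate_on_union (P n) (F n) (time_steps (\<tau> n) s) (outer_approx (P n) A)))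
          \<longlonglongrightarrow> 0)"

definition cell_avg :: "'a measure \<Rightarrow> 'a set set \<Rightarrow> ('a \<Rightarrow> complex) \<Rightarrow> 'a set \<Rightarrow> complex" where
  "cell_avg M P g p =
     of_real (real (card P) / measure M (space M)) * (LINT x|M. g x * indicator p x)"

definition averaging :: "'a measure \<Rightarrow> 'a set set \<Rightarrow> ('a \<Rightarrow> complex) \<Rightarrow> ('a \<Rightarrow> complex)" where
  "averaging M P g = (\<lambda>x. \<Sum>p\<in>P. cell_avg M P g p * indicator p x)"

definition L2_cells :: "'a measure \<Rightarrow> 'a set set \<Rightarrow> ('a \<Rightarrow> complex) set" where
  "L2_cells M P = {f \<in> L2 M. \<exists>c. AE x in M. f x = (\<Sum>p\<in>P. c p * indicator p x)}"

definition discrete_koopman ::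
    "'a measure \<Rightarrow> 'a set set \<Rightarrow> ('a set \<Rightarrow> 'a set) \<Rightarrow> int \<Rightarrow> ('a \<Rightarrow> complex) \<Rightarrow> ('a \<Rightarrow> complex)" where
  "discrete_koopman M P F k g =
     (\<lambda>x. \<Sum>p\<in>P. cell_avg M P g p * indicator (int_iterate P F (- k) p) x)"

definition koopman_eigenbasis ::
    "'a measure \<Rightarrow> 'a set set \<Rightarrow> ('a set \<Rightarrow> 'a set) \<Rightarrow> nat \<Rightarrow>
     (nat \<Rightarrow> 'a \<Rightarrow> complex) \<Rightarrow> (nat \<Rightarrow> real) \<Rightarrow> bool" where
  "koopman_eigenbasis M P F q v \<theta> \<longleftrightarrow>
     (\<forall>k\<in>{1..q}. v k \<in> L2_cells M P) \<and>
     (\<forall>j\<in>{1..q}. \<forall>k\<in>{1..q}. L2_inner M (v j) (v k) = (if j = k then 1 else 0)) \<and>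
     (\<forall>f\<in>L2_cells M P. \<exists>c. AE x in M. f x = (\<Sum>k=1..q. c k * v k x)) \<and>
     (\<forall>k\<in>{1..q}. - pi \<le> \<theta> k \<and> \<theta> k < pi \<and>
        (AE x in M. discrete_koopman M P F 1 (v k) x = exp (\<i> * of_real (\<theta> k)) * v k x))"

definition discrete_spectral_op ::
    "'a measure \<Rightarrow> nat \<Rightarrow> (nat \<Rightarrow> 'a \<Rightarrow> complex) \<Rightarrow> (nat \<Rightarrow> real) \<Rightarrow> (real \<Rightarrow> complex) \<Rightarrow>
     ('a \<Rightarrow> complex) \<Rightarrow> ('a \<Rightarrow> complex)" where
  "discrete_spectral_op M q v \<omega> \<phi> g =
     (\<lambda>x. \<Sum>k=1..q. \<phi> (\<omega> k) * (v k x * L2_inner M (v k) g))"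

end

theory Submission
  imports Defs
begin

text \<open>
  Periodic approximation gives, first for indicators of compact sets and then by density for all of
  \<open>L\<^sup>2\<close>, that the discrete evolution of \<open>g\<close> converges to the Koopman evolution of \<open>g\<close> in \<open>L\<^sup>2\<close> in the mean
  over bounded time intervals. Integrating against \<open>exp (- t)\<close> turns this into weak convergence of
  the resolvents \<open>1 / (1 - \<i> \<omega>)\<close>. On the discrete side the Laplace transform only involves the times
  \<open>h \<lceil>t / h\<rceil>\<close>, but on the band \<open>\<bar>\<omega> h\<bar> \<le> \<pi>\<close>, which contains every discrete frequency, it differs from the
  resolvent by \<open>O(h)\<close>; this controls the high frequencies. The Cayley transform \<open>2 / (1 - \<i> \<omega>) - 1\<close> is
  unimodular, so for it weak convergence improves to strong convergence, which is stable under
  sums, products and uniform limits. By Stone--Weierstrass on the unit circle it holds for all continuous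
  functions vanishing at infinity, in particular for Schwartz functions.
\<close>

section \<open>Square-integrable functions\<close>

text \<open>The hypothesis controls the Hausdorff distance only after integration over time, so no
  single time yields convergence; only averages against an integrable weight are accessible. The
  weight \<open>exp (- t)\<close> is chosen because the resulting discrete kernel satisfies a
  one-step recursion and so has a closed form. This is what handles frequencies of order
  \<open>1 / \<tau> n\<close>, where rounding the time to a multiple of the step changes the phase
  by an amount that does not tend to zero, so that comparing exponentials time by time would fail.
  Weak convergence is not stable under products, so the passage to strong convergence must happen
  before polynomials are formed. The spectral integral is given through simple functions only; a
  bounded functional calculus is therefore built before any operator identity is used. Koopman
  operators pull sets back, so the evolution of functions at time \<open>t\<close> is compared with
  the evolution of sets at time \<open>- t\<close>.\<close>

lemma borel_measurable_cnj [measurable]: "cnj \<in> borel_measurable borel"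
  by (intro borel_measurable_continuous_onI continuous_intros)

lemma L2_measurable [measurable_dest]: "f \<in> L2 M \<Longrightarrow> f \<in> borel_measurable M"
  by (simp add: L2_def)

lemma L2_square_integrable: "f \<in> L2 M \<Longrightarrow> integrable M (\<lambda>x. (cmod (f x))\<^sup>2)"
  by (simp add: L2_def)

lemma integrable_L2_product:
  assumes "f \<in> L2 M" "g \<in> L2 M"
  shows "integrable M (\<lambda>x. cnj (f x) * g x)" "integrable M (\<lambda>x. cmod (f x) * cmod (g x))"
proof -
  note [measurable] = L2_measurable[OF assms(1)] L2_measurable[OF assms(2)]
  have *: "cmod (f x) * cmod (g x) \<le> (cmod (f x))\<^sup>2 + (cmod (g x))\<^sup>2" for x
    using sum_squares_bound[of "cmod (f x)" "cmod (g x)"] zero_le_power2[of "cmod (f x)"]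
      zero_le_power2[of "cmod (g x)"] by linarith
  have i: "integrable M (\<lambda>x. (cmod (f x))\<^sup>2 + (cmod (g x))\<^sup>2)"
    using assms by (simp add: L2_square_integrable)
  show "integrable M (\<lambda>x. cnj (f x) * g x)"
    by (rule Bochner_Integration.integrable_bound[OF i]) (auto simp: norm_mult intro!: order_trans[OF *])
  show "integrable M (\<lambda>x. cmod (f x) * cmod (g x))"
    by (rule Bochner_Integration.integrable_bound[OF i]) (auto simp: norm_mult intro!: order_trans[OF *])
qed

lemma L2_scale:
  assumes "f \<in> L2 M" shows "(\<lambda>x. c * f x) \<in> L2 M"
  using assms by (auto simp: L2_def norm_mult power_mult_distrib)

lemma L2_add:
  assumes "f \<in> L2 M" "g \<in> L2 M"
  shows "(\<lambda>x. f x + g x) \<in> L2 M"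
proof -
  note [measurable] = L2_measurable[OF assms(1)] L2_measurable[OF assms(2)]
  have *: "(cmod (f x + g x))\<^sup>2 \<le> 2 * (cmod (f x))\<^sup>2 + 2 * (cmod (g x))\<^sup>2" for x
  proof -
    have "(cmod (f x + g x))\<^sup>2 \<le> (cmod (f x) + cmod (g x))\<^sup>2"
      by (intro power_mono norm_triangle_ineq) auto
    then show ?thesis using sum_squares_bound[of "cmod (f x)" "cmod (g x)"]
      by (simp add: power2_sum)
  qed
  have i: "integrable M (\<lambda>x. 2 * (cmod (f x))\<^sup>2 + 2 * (cmod (g x))\<^sup>2)"
    using assms by (simp add: L2_square_integrable)
  have "integrable M (\<lambda>x. (cmod (f x + g x))\<^sup>2)"
    by (rule Bochner_Integration.integrable_bound[OF i]) (auto intro!: order_trans[OF *])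
  then show ?thesis by (simp add: L2_def)
qed

lemma L2_zero: "(\<lambda>x. 0) \<in> L2 M"
  by (simp add: L2_def)

lemma L2_diff:
  assumes "f \<in> L2 M" "g \<in> L2 M"
  shows "(\<lambda>x. f x - g x) \<in> L2 M"
  using L2_add[OF assms(1) L2_scale[OF assms(2), of "-1"]] by simp

lemma L2_sum:
  assumes "\<And>i. i \<in> I \<Longrightarrow> f i \<in> L2 M"
  shows "(\<lambda>x. \<Sum>i\<in>I. f i x) \<in> L2 M"
  using assms by (induction I rule: infinite_finite_induct) (auto simp: L2_zero L2_add)

lemma L2_norm_nonneg [simp]: "0 \<le> L2_norm M f"
  by (simp add: L2_norm_def)

lemma L2_norm_square: "(L2_norm M f)\<^sup>2 = (LINT x|M. (cmod (f x))\<^sup>2)"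
  by (simp add: L2_norm_def)

lemma L2_norm_cong_AE:
  assumes "f \<in> borel_measurable M" "g \<in> borel_measurable M" "AE x in M. f x = g x"
  shows "L2_norm M f = L2_norm M g"
proof -
  have "(LINT x|M. (cmod (f x))\<^sup>2) = (LINT x|M. (cmod (g x))\<^sup>2)"
    using assms by (intro integral_cong_AE) auto
  then show ?thesis by (simp add: L2_norm_def)
qed

lemma L2_inner_cong_AE:
  assumes "f \<in> borel_measurable M" "g \<in> borel_measurable M" "AE x in M. f x = f' x"
    "f' \<in> borel_measurable M" "g' \<in> borel_measurable M" "AE x in M. g x = g' x"
  shows "L2_inner M f g = L2_inner M f' g'"
proof -
  note [measurable] = assms(1,2,4,5)
  show ?thesis unfolding L2_inner_def
    by (rule integral_cong_AE) (use assms(3,6) in auto)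
qed

lemma L2_inner_self: "L2_inner M f f = of_real ((L2_norm M f)\<^sup>2)"
proof -
  have "cnj (f x) * f x = of_real ((cmod (f x))\<^sup>2)" for x
    by (metis complex_norm_square mult.commute)
  then show ?thesis unfolding L2_norm_square L2_inner_def
    by (simp flip: integral_complex_of_real of_real_power)
qed

lemma L2_inner_cnj: "L2_inner M g f = cnj (L2_inner M f g)"
proof -
  have "cnj (L2_inner M f g) = (LINT x|M. cnj (cnj (f x) * g x))"
    unfolding L2_inner_def by (rule Bochner_Integration.integral_cnj[symmetric])
  then show ?thesis by (simp add: L2_inner_def mult.commute)
qed

lemma L2_inner_add_right:
  assumes "f \<in> L2 M" "g \<in> L2 M" "h \<in> L2 M"
  shows "L2_inner M f (\<lambda>x. g x + h x) = L2_inner M f g + L2_inner M f h"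
  unfolding L2_inner_def distrib_left
  by (intro Bochner_Integration.integral_add integrable_L2_product assms)

lemma L2_inner_diff_right:
  assumes "f \<in> L2 M" "g \<in> L2 M" "h \<in> L2 M"
  shows "L2_inner M f (\<lambda>x. g x - h x) = L2_inner M f g - L2_inner M f h"
  unfolding L2_inner_def right_diff_distrib
  by (intro Bochner_Integration.integral_diff integrable_L2_product assms)

lemma L2_inner_scale_right: "L2_inner M f (\<lambda>x. c * g x) = c * L2_inner M f g"
  unfolding L2_inner_def by (simp add: mult.left_commute)

lemma L2_inner_add_left:
  assumes "f \<in> L2 M" "g \<in> L2 M" "h \<in> L2 M"
  shows "L2_inner M (\<lambda>x. f x + g x) h = L2_inner M f h + L2_inner M g h"
  by (subst (1 2 3) L2_inner_cnj) (simp add: L2_inner_add_right assms)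

lemma L2_inner_diff_left:
  assumes "f \<in> L2 M" "g \<in> L2 M" "h \<in> L2 M"
  shows "L2_inner M (\<lambda>x. f x - g x) h = L2_inner M f h - L2_inner M g h"
  by (subst (1 2 3) L2_inner_cnj) (simp add: L2_inner_diff_right assms)

lemma L2_inner_scale_left: "L2_inner M (\<lambda>x. c * f x) g = cnj c * L2_inner M f g"
  by (subst (1 2) L2_inner_cnj) (simp add: L2_inner_scale_right)

lemma L2_inner_sum_right:
  assumes "f \<in> L2 M" "\<And>i. i \<in> I \<Longrightarrow> g i \<in> L2 M"
  shows "L2_inner M f (\<lambda>x. \<Sum>i\<in>I. g i x) = (\<Sum>i\<in>I. L2_inner M f (g i))"
  unfolding L2_inner_def sum_distrib_left
  by (intro Bochner_Integration.integral_sum integrable_L2_product assms)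

lemma L2_inner_sum_left:
  assumes "f \<in> L2 M" "\<And>i. i \<in> I \<Longrightarrow> g i \<in> L2 M"
  shows "L2_inner M (\<lambda>x. \<Sum>i\<in>I. g i x) f = (\<Sum>i\<in>I. L2_inner M (g i) f)"
  by (subst (1 2) L2_inner_cnj) (simp add: L2_inner_sum_right assms)

lemma L2_norm_zero [simp]: "L2_norm M (\<lambda>x. 0) = 0"
  by (simp add: L2_norm_def)

lemma L2_norm_scale: "L2_norm M (\<lambda>x. c * f x) = cmod c * L2_norm M f"
  by (simp add: L2_norm_def norm_mult power_mult_distrib real_sqrt_mult)

lemma L2_norm_minus_commute: "L2_norm M (\<lambda>x. f x - g x) = L2_norm M (\<lambda>x. g x - f x)"
  by (simp add: L2_norm_def norm_minus_commute)

lemma L2_norm_eq_0_iff: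
  assumes "f \<in> L2 M"
  shows "L2_norm M f = 0 \<longleftrightarrow> (AE x in M. f x = 0)"
  using integral_nonneg_eq_0_iff_AE[OF L2_square_integrable[OF assms]] by (simp add: L2_norm_def)

text \<open>The squared norm of \<open>f - z g\<close> is nonnegative; taking \<open>z\<close> a
  real multiple of the conjugate of the inner product removes the phase and leaves a quadratic in
  the real parameter \<open>t\<close>.\<close>

lemma L2_Cauchy_Schwarz:
  assumes "f \<in> L2 M" "g \<in> L2 M"
  shows "cmod (L2_inner M f g) \<le> L2_norm M f * L2_norm M g"
proof -
  let ?c = "L2_inner M f g" and ?a = "(L2_norm M f)\<^sup>2" and ?b = "(L2_norm M g)\<^sup>2"
  have ineq: "0 \<le> t\<^sup>2 * ?b * (cmod ?c)\<^sup>2 - 2 * t * (cmod ?c)\<^sup>2 + ?a" for t :: real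
  proof -
    define z where "z = complex_of_real t * cnj ?c"
    have "L2_inner M (\<lambda>x. f x - z * g x) (\<lambda>x. f x - z * g x) =
       L2_inner M f f - z * ?c - (cnj z * cnj ?c - cnj z * (z * L2_inner M g g))"
      using assms L2_scale[OF assms(2), of z]
      by (simp add: L2_inner_diff_right L2_inner_diff_left L2_diff
          L2_inner_scale_right L2_inner_scale_left L2_inner_cnj[of M g f] algebra_simps)
    then have "of_real ((L2_norm M (\<lambda>x. f x - z * g x))\<^sup>2) =
       of_real ?a - z * ?c - (cnj z * cnj ?c - cnj z * (z * of_real ?b))"
      unfolding L2_inner_self .
    also have "\<dots> = of_real ?a - 2 * t * (?c * cnj ?c) + t * t * ?b * (?c * cnj ?c)"
      by (simp add: z_def algebra_simps)
    also have "\<dots> = of_real (?a - 2 * t * (cmod ?c)\<^sup>2 + t * t * ?b * (cmod ?c)\<^sup>2)"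
      unfolding complex_norm_square[symmetric] by simp
    finally have "(L2_norm M (\<lambda>x. f x - z * g x))\<^sup>2 = ?a - 2 * t * (cmod ?c)\<^sup>2 + t * t * ?b * (cmod ?c)\<^sup>2"
      by (simp only: of_real_eq_iff)
    then show ?thesis using zero_le_power2[of "L2_norm M (\<lambda>x. f x - z * g x)"]
      unfolding power2_eq_square[of t] by (simp only: algebra_simps)
  qed
  have "(cmod ?c)\<^sup>2 \<le> ?a * ?b"
  proof (cases "?b = 0")
    case False
    define B where "B = ?b"
    have "0 < B" using False by (simp add: B_def)
    \<comment> \<open>The quadratic attains its minimum at \<open>1 / B\<close>.\<close>
    then show ?thesis using ineq[of "1/B"] unfolding B_def[symmetric]
      by (simp add: field_simps power2_eq_square[of B])
  next
    case True
    have "(cmod ?c)\<^sup>2 \<le> 0"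
    proof (rule ccontr)
      assume "\<not> ?thesis"
      then have p: "0 < (cmod ?c)\<^sup>2" by simp
      \<comment> \<open>Here the quadratic degenerates to an affine function of negative slope; this
        argument pushes it below zero.\<close>
      then show False using ineq[of "(?a + 1) / (cmod ?c)\<^sup>2"] True zero_le_power2[of "L2_norm M f"] by simp
    qed
    then show ?thesis by simp
  qed
  then show ?thesis
    by (metis L2_norm_nonneg mult_nonneg_nonneg power2_le_imp_le power_mult_distrib)
qed

lemma L2_norm_add_square:
  assumes "f \<in> L2 M" "g \<in> L2 M"
  shows "(L2_norm M (\<lambda>x. f x + g x))\<^sup>2 = (L2_norm M f)\<^sup>2 + (L2_norm M g)\<^sup>2 + 2 * Re (L2_inner M f g)"
proof -
  have "of_real ((L2_norm M (\<lambda>x. f x + g x))\<^sup>2) = of_real ((L2_norm M f)\<^sup>2) + of_real ((L2_norm M g)\<^sup>2)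
     + (L2_inner M f g + cnj (L2_inner M f g))"
    unfolding L2_inner_self[symmetric] using assms
    by (simp add: L2_inner_add_left L2_inner_add_right L2_add L2_inner_cnj[of M g f])
  also have "\<dots> = of_real ((L2_norm M f)\<^sup>2 + (L2_norm M g)\<^sup>2 + 2 * Re (L2_inner M f g))"
    by (simp add: complex_add_cnj)
  finally show ?thesis by (simp only: of_real_eq_iff)
qed

lemma L2_norm_triangle:
  assumes "f \<in> L2 M" "g \<in> L2 M"
  shows "L2_norm M (\<lambda>x. f x + g x) \<le> L2_norm M f + L2_norm M g"
proof (rule power2_le_imp_le)
  have "Re (L2_inner M f g) \<le> L2_norm M f * L2_norm M g"
    using complex_Re_le_cmod L2_Cauchy_Schwarz[OF assms] by (rule order_trans)
  then show "(L2_norm M (\<lambda>x. f x + g x))\<^sup>2 \<le> (L2_norm M f + L2_norm M g)\<^sup>2"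
    unfolding L2_norm_add_square[OF assms] by (simp add: power2_sum)
qed simp

lemma L2_norm_diff_square:
  assumes "f \<in> L2 M" "g \<in> L2 M"
  shows "(L2_norm M (\<lambda>x. f x - g x))\<^sup>2 = (L2_norm M f)\<^sup>2 + (L2_norm M g)\<^sup>2 - 2 * Re (L2_inner M f g)"
  using L2_norm_add_square[OF assms(1) L2_scale[OF assms(2), of "-1"]]
    L2_norm_scale[of M "-1" g] L2_inner_scale_right[of M f "-1" g] by simp

lemma L2_norm_triangle_sub:
  assumes "f \<in> L2 M" "g \<in> L2 M"
  shows "L2_norm M (\<lambda>x. f x - g x) \<le> L2_norm M f + L2_norm M g"
  using L2_norm_triangle[OF assms(1) L2_scale[OF assms(2), of "-1"]] L2_norm_scale[of M "-1" g] by simp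

lemma L2_norm_dist_triangle:
  assumes "f \<in> L2 M" "g \<in> L2 M" "h \<in> L2 M"
  shows "L2_norm M (\<lambda>x. f x - h x) \<le> L2_norm M (\<lambda>x. f x - g x) + L2_norm M (\<lambda>x. g x - h x)"
  using L2_norm_triangle[OF L2_diff[OF assms(1,2)] L2_diff[OF assms(2,3)]] by simp

lemma L2_norm_sum_le:
  assumes "\<And>i. i \<in> I \<Longrightarrow> f i \<in> L2 M"
  shows "L2_norm M (\<lambda>x. \<Sum>i\<in>I. f i x) \<le> (\<Sum>i\<in>I. L2_norm M (f i))"
  using assms
proof (induction I rule: infinite_finite_induct)
  case (insert i I)
  then show ?case using L2_norm_triangle[of "f i" M "\<lambda>x. \<Sum>i\<in>I. f i x"] by (simp add: L2_sum)
qed auto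

lemma L2_norm_sum_orthogonal:
  assumes "finite I" "\<And>i. i \<in> I \<Longrightarrow> f i \<in> L2 M"
    "\<And>i j. i \<in> I \<Longrightarrow> j \<in> I \<Longrightarrow> i \<noteq> j \<Longrightarrow> L2_inner M (f i) (f j) = 0"
  shows "(L2_norm M (\<lambda>x. \<Sum>i\<in>I. f i x))\<^sup>2 = (\<Sum>i\<in>I. (L2_norm M (f i))\<^sup>2)"
  using assms
proof (induction I rule: finite_induct)
  case (insert i I)
  have "L2_inner M (f i) (\<lambda>x. \<Sum>i\<in>I. f i x) = (\<Sum>j\<in>I. L2_inner M (f i) (f j))"
    using insert.prems by (intro L2_inner_sum_right) auto
  also have "\<dots> = 0" using insert by (intro sum.neutral) (metis insert_iff)
  finally show ?case using insert L2_norm_add_square[of "f i" M "\<lambda>x. \<Sum>i\<in>I. f i x"]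
    by (simp add: L2_sum)
qed auto

text \<open>Absolute convergence in norm already forces convergence almost everywhere, so that the
  pointwise limit serves as the \<open>L\<^sup>2\<close> limit.\<close>

lemma L2_complete:
  fixes f :: "nat \<Rightarrow> 'a \<Rightarrow> complex"
  assumes f: "\<And>k. f k \<in> L2 M"
    and dist: "\<And>k. L2_norm M (\<lambda>x. f (Suc k) x - f k x) \<le> e k" and e: "summable e"
  obtains h where "h \<in> L2 M" "(\<lambda>k. L2_norm M (\<lambda>x. f k x - h x)) \<longlonglongrightarrow> 0"
proof -
  note [measurable] = L2_measurable[OF f]
  define d where "d k x = cmod (f (Suc k) x - f k x)" for k x
  have [measurable]: "d k \<in> borel_measurable M" for k unfolding d_def by measurable
  have dL2: "(\<lambda>x. complex_of_real (d k x)) \<in> L2 M" for k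
    using L2_diff[OF f f, of "Suc k" k] by (simp add: L2_def d_def)
  have dn: "L2_norm M (\<lambda>x. complex_of_real (d k x)) \<le> e k" for k
    using dist[of k] by (simp add: L2_norm_def d_def)
  have e0: "0 \<le> e k" for k using dn[of k] L2_norm_nonneg order_trans by blast
  \<comment> \<open>Minkowski bounds the norm of each partial sum by the tail of \<open>e\<close>,
    and Fatou carries the bound to the full series. Sums are taken in \<open>ennreal\<close>, where
    they exist before pointwise convergence is known.\<close>
  have tail: "(\<integral>\<^sup>+x. (\<Sum>k. ennreal (d (k + m) x))\<^sup>2 \<partial>M) \<le> ennreal ((\<Sum>k. e (k + m))\<^sup>2)" for m
  proof -
    have conv: "(\<lambda>n. (\<Sum>k<n. ennreal (d (k + m) x))\<^sup>2) \<longlonglongrightarrow> (\<Sum>k. ennreal (d (k + m) x))\<^sup>2" for x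
      unfolding power2_eq_square by (intro tendsto_mult_ennreal summable_LIMSEQ) auto
    have "(\<integral>\<^sup>+x. (\<Sum>k. ennreal (d (k + m) x))\<^sup>2 \<partial>M) =
       (\<integral>\<^sup>+x. liminf (\<lambda>n. (\<Sum>k<n. ennreal (d (k + m) x))\<^sup>2) \<partial>M)"
      by (intro nn_integral_cong lim_imp_Liminf[symmetric] conv) simp
    also have "\<dots> \<le> liminf (\<lambda>n. \<integral>\<^sup>+x. (\<Sum>k<n. ennreal (d (k + m) x))\<^sup>2 \<partial>M)"
      by (intro nn_integral_liminf) measurable
    also have "\<dots> \<le> ennreal ((\<Sum>k. e (k + m))\<^sup>2)"
    proof (intro Liminf_le always_eventually allI)
      fix n
      let ?g = "\<lambda>x. \<Sum>k<n. complex_of_real (d (k + m) x)"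
      have g: "?g \<in> L2 M" by (intro L2_sum dL2)
      have "(\<integral>\<^sup>+x. (\<Sum>k<n. ennreal (d (k + m) x))\<^sup>2 \<partial>M) = (\<integral>\<^sup>+x. ennreal ((cmod (?g x))\<^sup>2) \<partial>M)"
      proof (intro nn_integral_cong)
        fix x
        have "0 \<le> (\<Sum>k<n. d (k + m) x)" by (intro sum_nonneg) (simp add: d_def)
        then have "cmod (?g x) = (\<Sum>k<n. d (k + m) x)"
          by (simp flip: of_real_sum)
        moreover have "(\<Sum>k<n. ennreal (d (k + m) x)) = ennreal (\<Sum>k<n. d (k + m) x)"
          by (simp add: d_def)
        ultimately show "(\<Sum>k<n. ennreal (d (k + m) x))\<^sup>2 = ennreal ((cmod (?g x))\<^sup>2)"
          using \<open>0 \<le> (\<Sum>k<n. d (k + m) x)\<close> by (simp add: ennreal_power)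
      qed
      also have "\<dots> = ennreal ((L2_norm M ?g)\<^sup>2)"
        unfolding L2_norm_square by (intro nn_integral_eq_integral L2_square_integrable[OF g]) auto
      also have "\<dots> \<le> ennreal ((\<Sum>k. e (k + m))\<^sup>2)"
      proof (intro ennreal_leI power_mono)
        have "L2_norm M ?g \<le> (\<Sum>k<n. L2_norm M (\<lambda>x. complex_of_real (d (k + m) x)))"
          by (intro L2_norm_sum_le dL2)
        also have "\<dots> \<le> (\<Sum>k<n. e (k + m))" by (intro sum_mono dn)
        also have "\<dots> \<le> (\<Sum>k. e (k + m))"
          using e e0 by (intro sum_le_suminf summable_ignore_initial_segment) auto
        finally show "L2_norm M ?g \<le> (\<Sum>k. e (k + m))" .
      qed simp
      finally show "(\<integral>\<^sup>+x. (\<Sum>k<n. ennreal (d (k + m) x))\<^sup>2 \<partial>M) \<le> ennreal ((\<Sum>k. e (k + m))\<^sup>2)" .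
    qed simp
    finally show ?thesis .
  qed
  have "AE x in M. (\<Sum>k. ennreal (d (k + 0) x))\<^sup>2 \<noteq> \<infinity>"
    using tail[of 0] by (intro nn_integral_PInf_AE) (auto simp: top_unique)
  then have fin: "AE x in M. (\<Sum>k. ennreal (d k x)) \<noteq> \<infinity>"
    by eventually_elim (auto simp: power2_eq_square ennreal_mult_eq_top_iff)
  define h where "h x = lim (\<lambda>k. f k x)" for x
  have [measurable]: "h \<in> borel_measurable M" unfolding h_def by measurable
  have lim: "(\<lambda>k. f k x) \<longlonglongrightarrow> h x" and le: "\<And>m. ennreal (cmod (f m x - h x)) \<le> (\<Sum>k. ennreal (d (k + m) x))"
    if "(\<Sum>k. ennreal (d k x)) \<noteq> \<infinity>" for x
  proof -
    have s: "summable (\<lambda>k. d k x)"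
      using that by (intro summable_suminf_not_top) (auto simp: d_def)
    then have "summable (\<lambda>k. f (Suc k) x - f k x)"
      unfolding d_def by (rule summable_norm_cancel)
    then have "(\<lambda>n. \<Sum>k<n. f (Suc k) x - f k x) \<longlonglongrightarrow> (\<Sum>k. f (Suc k) x - f k x)"
      by (rule summable_LIMSEQ)
    then have "(\<lambda>n. f n x - f 0 x) \<longlonglongrightarrow> (\<Sum>k. f (Suc k) x - f k x)"
      unfolding sum_lessThan_telescope[of "\<lambda>k. f k x"] .
    then have "(\<lambda>n. f n x - f 0 x + f 0 x) \<longlonglongrightarrow> (\<Sum>k. f (Suc k) x - f k x) + f 0 x"
      by (intro tendsto_intros)
    then have "convergent (\<lambda>k. f k x)" by (auto simp: convergent_def)
    then show l: "(\<lambda>k. f k x) \<longlonglongrightarrow> h x" unfolding h_def by (simp add: convergent_LIMSEQ_iff)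
    fix m
    have sm: "summable (\<lambda>k. d (k + m) x)" using s by (rule summable_ignore_initial_segment)
    have "cmod (f m x - h x) \<le> (\<Sum>k. d (k + m) x)"
    proof (rule tendsto_upperbound)
      show "(\<lambda>n. cmod (f m x - f (n + m) x)) \<longlonglongrightarrow> cmod (f m x - h x)"
        by (intro tendsto_intros LIMSEQ_ignore_initial_segment l)
      show "\<forall>\<^sub>F n in sequentially. cmod (f m x - f (n + m) x) \<le> (\<Sum>k. d (k + m) x)"
      proof (intro always_eventually allI)
        fix n
        have "(\<Sum>k<n. f (Suc k + m) x - f (k + m) x) = f (n + m) x - f (0 + m) x"
          using sum_lessThan_telescope[of "\<lambda>k. f (k + m) x" n] by simp
        then have "cmod (f m x - f (n + m) x) = cmod (\<Sum>k<n. f (Suc k + m) x - f (k + m) x)"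
          by (simp add: norm_minus_commute)
        also have "\<dots> \<le> (\<Sum>k<n. d (k + m) x)" unfolding d_def by (intro order_trans[OF norm_sum]) simp
        also have "\<dots> \<le> (\<Sum>k. d (k + m) x)" using sm by (intro sum_le_suminf) (auto simp: d_def)
        finally show "cmod (f m x - f (n + m) x) \<le> (\<Sum>k. d (k + m) x)" .
      qed
    qed simp
    then have "ennreal (cmod (f m x - h x)) \<le> ennreal (\<Sum>k. d (k + m) x)" by (rule ennreal_leI)
    also have "\<dots> = (\<Sum>k. ennreal (d (k + m) x))"
      using sm by (intro suminf_ennreal2[symmetric]) (auto simp: d_def)
    finally show "ennreal (cmod (f m x - h x)) \<le> (\<Sum>k. ennreal (d (k + m) x))" .
  qed
  have bnd: "(\<integral>\<^sup>+x. ennreal ((cmod (f m x - h x))\<^sup>2) \<partial>M) \<le> ennreal ((\<Sum>k. e (k + m))\<^sup>2)" for m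
  proof -
    have "(\<integral>\<^sup>+x. ennreal ((cmod (f m x - h x))\<^sup>2) \<partial>M) \<le> (\<integral>\<^sup>+x. (\<Sum>k. ennreal (d (k + m) x))\<^sup>2 \<partial>M)"
    proof (rule nn_integral_mono_AE, use fin in eventually_elim)
      fix x assume "(\<Sum>k. ennreal (d k x)) \<noteq> \<infinity>"
      from power_mono[OF le[OF this, of m], of 2]
      show "ennreal ((cmod (f m x - h x))\<^sup>2) \<le> (\<Sum>k. ennreal (d (k + m) x))\<^sup>2"
        by (simp add: ennreal_power)
    qed
    then show ?thesis using tail[of m] by (rule order_trans)
  qed
  have fh: "(\<lambda>x. f m x - h x) \<in> L2 M" for m
  proof -
    have "integrable M (\<lambda>x. (cmod (f m x - h x))\<^sup>2)"
      using bnd[of m] by (intro integrableI_bounded) (auto simp: less_top[symmetric] top_unique)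
    then show ?thesis by (simp add: L2_def)
  qed
  have "h \<in> L2 M" using L2_diff[OF f fh, of 0 0] by simp
  moreover have "(\<lambda>k. L2_norm M (\<lambda>x. f k x - h x)) \<longlonglongrightarrow> 0"
  proof (rule tendsto_sandwich[of "\<lambda>_. 0"])
    show "(\<lambda>m. \<Sum>k. e (k + m)) \<longlonglongrightarrow> 0" using e by (rule suminf_exist_split2)
    show "\<forall>\<^sub>F m in sequentially. L2_norm M (\<lambda>x. f m x - h x) \<le> (\<Sum>k. e (k + m))"
    proof (intro always_eventually allI)
      fix m
      have s0: "0 \<le> (\<Sum>k. e (k + m))"
        using e e0 by (intro suminf_nonneg summable_ignore_initial_segment) auto
      have "ennreal ((L2_norm M (\<lambda>x. f m x - h x))\<^sup>2) = (\<integral>\<^sup>+x. ennreal ((cmod (f m x - h x))\<^sup>2) \<partial>M)"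
        unfolding L2_norm_square by (intro nn_integral_eq_integral[symmetric] L2_square_integrable[OF fh]) auto
      also have "\<dots> \<le> ennreal ((\<Sum>k. e (k + m))\<^sup>2)" by (rule bnd)
      finally have "(L2_norm M (\<lambda>x. f m x - h x))\<^sup>2 \<le> (\<Sum>k. e (k + m))\<^sup>2"
        by (simp add: ennreal_le_iff)
      then show "L2_norm M (\<lambda>x. f m x - h x) \<le> (\<Sum>k. e (k + m))" using s0 by (rule power2_le_imp_le)
    qed
  qed auto
  ultimately show thesis by (rule that)
qed

section \<open>Integration against a projection-valued measure\<close>

text \<open>Real and imaginary parts are rounded down to a grid of width
  \<open>\<epsilon> / 2\<close>; each contributes at most half of the error, and boundedness of the
  range leaves only finitely many grid points.\<close>

lemma uniform_simple_approximation:
  fixes \<phi> :: "'a \<Rightarrow> complex"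
  assumes [measurable]: "\<phi> \<in> borel_measurable N" and "bounded (range \<phi>)" and "0 < \<epsilon>"
  obtains s where "simple_function N s" "\<And>x. cmod (s x - \<phi> x) \<le> \<epsilon>"
proof -
  define \<delta> where "\<delta> = \<epsilon> / 2"
  have d: "0 < \<delta>" using assms by (simp add: \<delta>_def)
  define r where "r y = \<delta> * of_int \<lfloor>y / \<delta>\<rfloor>" for y :: real
  have r: "\<bar>r y - y\<bar> \<le> \<delta>" for y
  proof -
    have "r y - y = \<delta> * (of_int \<lfloor>y / \<delta>\<rfloor> - y / \<delta>)" using d by (simp add: r_def algebra_simps)
    moreover have "\<bar>of_int \<lfloor>y / \<delta>\<rfloor> - y / \<delta>\<bar> \<le> 1" by linarith
    ultimately show ?thesis using d by (simp add: abs_mult)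
  qed
  define z where "z = (\<lambda>(a, b). complex_of_real a + \<i> * complex_of_real b)"
  define s where "s x = z (r (Re (\<phi> x)), r (Im (\<phi> x)))" for x
  obtain K where K: "\<And>x. cmod (\<phi> x) \<le> K" using assms(2) by (auto simp: bounded_iff)
  define S where "S = (\<lambda>i. \<delta> * real_of_int i) ` {\<lfloor>- K / \<delta>\<rfloor> .. \<lfloor>K / \<delta>\<rfloor>}"
  have rS: "r y \<in> S" if "\<bar>y\<bar> \<le> K" for y
  proof -
    have "- K / \<delta> \<le> y / \<delta>" "y / \<delta> \<le> K / \<delta>"
      using that d by (intro divide_right_mono; linarith)+
    then have "\<lfloor>y / \<delta>\<rfloor> \<in> {\<lfloor>- K / \<delta>\<rfloor> .. \<lfloor>K / \<delta>\<rfloor>}" by (simp only: atLeastAtMost_iff floor_mono)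
    then show ?thesis unfolding r_def S_def by (rule imageI)
  qed
  have "s x \<in> z ` (S \<times> S)" for x
  proof -
    have "r (Re (\<phi> x)) \<in> S" "r (Im (\<phi> x)) \<in> S"
      using K[of x] abs_Re_le_cmod[of "\<phi> x"] abs_Im_le_cmod[of "\<phi> x"] by (intro rS; linarith)+
    then show ?thesis unfolding s_def by (intro imageI SigmaI)
  qed
  then have "s ` space N \<subseteq> z ` (S \<times> S)" by blast
  moreover have "finite (z ` (S \<times> S))"
    unfolding S_def by (intro finite_imageI finite_cartesian_product finite_atLeastAtMost_int)
  ultimately have fin: "finite (s ` space N)" by (rule finite_subset)
  have [measurable]: "s \<in> borel_measurable N"
    unfolding s_def[abs_def] z_def r_def prod.case by measurable
  have "cmod (s x - \<phi> x) \<le> \<epsilon>" for x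
    using cmod_le[of "s x - \<phi> x"] r[of "Re (\<phi> x)"] r[of "Im (\<phi> x)"]
    by (simp add: s_def z_def \<delta>_def)
  with simple_function_borel_measurable[OF \<open>s \<in> borel_measurable N\<close> fin] show thesis by (rule that)
qed

section \<open>Projections and integrals of simple functions\<close>

locale pvm =
  fixes M :: "'a measure" and E :: "real set \<Rightarrow> ('a \<Rightarrow> complex) \<Rightarrow> ('a \<Rightarrow> complex)"
  assumes pvm: "projection_valued_measure M E"
begin

abbreviation T :: "(real \<Rightarrow> complex) \<Rightarrow> ('a \<Rightarrow> complex) \<Rightarrow> 'a \<Rightarrow> complex" where
  "T \<equiv> pvm_simple_integral E"

lemma E_proj: "B \<in> sets borel \<Longrightarrow> orth_projection_L2 M (E B)"
  using pvm unfolding projection_valued_measure_def by blast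

lemma E_L2: "B \<in> sets borel \<Longrightarrow> f \<in> L2 M \<Longrightarrow> E B f \<in> L2 M"
  using E_proj[of B] unfolding orth_projection_L2_def by blast

lemma E_cong:
  "B \<in> sets borel \<Longrightarrow> f \<in> L2 M \<Longrightarrow> g \<in> L2 M \<Longrightarrow> AE x in M. f x = g x \<Longrightarrow> AE x in M. E B f x = E B g x"
  using E_proj[of B] unfolding orth_projection_L2_def by blast

lemma E_linear:
  "B \<in> sets borel \<Longrightarrow> f \<in> L2 M \<Longrightarrow> g \<in> L2 M \<Longrightarrow>
    AE x in M. E B (\<lambda>y. a * f y + b * g y) x = a * E B f x + b * E B g x"
  using E_proj[of B] unfolding orth_projection_L2_def by blast

lemma E_zero: "B \<in> sets borel \<Longrightarrow> AE x in M. E B (\<lambda>x. 0) x = 0"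
  using E_linear[OF _ L2_zero L2_zero, of B 0 0] by simp

lemma E_adjoint:
  "B \<in> sets borel \<Longrightarrow> f \<in> L2 M \<Longrightarrow> g \<in> L2 M \<Longrightarrow> L2_inner M (E B f) g = L2_inner M f (E B g)"
  using E_proj[of B] unfolding orth_projection_L2_def by blast

lemma E_empty: "g \<in> L2 M \<Longrightarrow> AE x in M. E {} g x = 0"
  using pvm unfolding projection_valued_measure_def by blast

lemma E_UNIV: "g \<in> L2 M \<Longrightarrow> AE x in M. E UNIV g x = g x"
  using pvm unfolding projection_valued_measure_def by blast

lemma E_Int: "A \<in> sets borel \<Longrightarrow> B \<in> sets borel \<Longrightarrow> g \<in> L2 M \<Longrightarrow> AE x in M. E (A \<inter> B) g x = E A (E B g) x"
  using pvm unfolding projection_valued_measure_def by blast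

text \<open>Self-adjointness moves \<open>E A\<close> to the other side, where \<open>E A\<close>
  after \<open>E B\<close> is the projection of the empty set.\<close>

lemma E_orthogonal:
  assumes "A \<in> sets borel" "B \<in> sets borel" "A \<inter> B = {}" "f \<in> L2 M" "g \<in> L2 M"
  shows "L2_inner M (E A f) (E B g) = 0"
proof -
  have "AE x in M. E A (E B g) x = 0"
    using E_Int[OF assms(1,2,5)] E_empty[OF assms(5)] assms(3) by auto
  then have "L2_inner M f (E A (E B g)) = L2_inner M f (\<lambda>x. 0)"
    using assms by (intro L2_inner_cong_AE) (auto intro: L2_measurable E_L2)
  then have "L2_inner M f (E A (E B g)) = 0" by (simp add: L2_inner_def)
  then show ?thesis using E_adjoint[OF assms(1,4) E_L2[OF assms(2,5)]] by simp
qed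

lemma E_sums:
  fixes B :: "nat \<Rightarrow> real set"
  assumes "\<And>i. B i \<in> sets borel" "disjoint_family B" "g \<in> L2 M"
  shows "(\<lambda>m. L2_norm M (\<lambda>x. E (\<Union>i. B i) g x - (\<Sum>i<m. E (B i) g x))) \<longlonglongrightarrow> 0"
proof -
  have "range B \<subseteq> sets borel \<and> disjoint_family B" using assms by blast
  moreover from pvm have "\<forall>B::nat \<Rightarrow> real set. range B \<subseteq> sets borel \<and> disjoint_family B \<longrightarrow>
      (\<forall>g\<in>L2 M. (\<lambda>m. L2_norm M (\<lambda>x. E (\<Union>i. B i) g x - (\<Sum>i<m. E (B i) g x))) \<longlonglongrightarrow> 0)"
    unfolding projection_valued_measure_def by (elim conjE)
  ultimately show ?thesis using assms(3) by blast
qed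

text \<open>Finite additivity has to be extracted from the countable axiom: the two sets are padded
  with empty ones, whose projections vanish, so the norms in the axiom are constant from index 2 on,
  and a constant sequence with limit 0 is 0.\<close>

lemma E_Un:
  assumes [measurable]: "A \<in> sets borel" "B \<in> sets borel" and "A \<inter> B = {}" and g: "g \<in> L2 M"
  shows "AE x in M. E (A \<union> B) g x = E A g x + E B g x"
proof -
  define C where "C i = (if i = 0 then A else if i = Suc 0 then B else {})" for i :: nat
  have U: "(\<Union>i. C i) = A \<union> B" by (auto simp: C_def split: if_splits)
  have "disjoint_family C" using assms(3) by (auto simp: disjoint_family_on_def C_def)
  moreover have Cb: "C i \<in> sets borel" for i by (simp add: C_def)
  ultimately have lim: "(\<lambda>m. L2_norm M (\<lambda>x. E (A \<union> B) g x - (\<Sum>i<m. E (C i) g x))) \<longlonglongrightarrow> 0"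
    using E_sums[of C g] g unfolding U by blast
  let ?d = "\<lambda>x. E (A \<union> B) g x - (E A g x + E B g x)"
  have d: "?d \<in> L2 M" using g by (intro L2_diff L2_add E_L2) auto
  have "L2_norm M (\<lambda>x. E (A \<union> B) g x - (\<Sum>i<m+2. E (C i) g x)) = L2_norm M ?d" for m
  proof (rule L2_norm_cong_AE)
    show "AE x in M. E (A \<union> B) g x - (\<Sum>i<m+2. E (C i) g x) = E (A \<union> B) g x - (E A g x + E B g x)"
      using E_empty[OF g]
    proof eventually_elim
      fix x assume e: "E {} g x = 0"
      have "(\<Sum>i<m+2. E (C i) g x) = (\<Sum>i\<in>{0, Suc 0}. E (C i) g x)"
        by (rule sum.mono_neutral_right) (auto simp: C_def e)
      then show "E (A \<union> B) g x - (\<Sum>i<m+2. E (C i) g x) = E (A \<union> B) g x - (E A g x + E B g x)"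
        by (simp add: C_def)
    qed
  qed (use g Cb in \<open>auto intro!: L2_measurable L2_diff L2_add L2_sum E_L2\<close>)
  with LIMSEQ_ignore_initial_segment[OF lim, of 2] have "(\<lambda>m. L2_norm M ?d) \<longlonglongrightarrow> 0" by simp
  then have "L2_norm M ?d = 0" by (simp add: LIMSEQ_const_iff)
  then show ?thesis using L2_norm_eq_0_iff[OF d] by (auto elim!: eventually_mono)
qed

lemma E_finite_UN:
  assumes "finite I" "\<And>i. i \<in> I \<Longrightarrow> B i \<in> sets borel" "disjoint_family_on B I" and g: "g \<in> L2 M"
  shows "AE x in M. E (\<Union>i\<in>I. B i) g x = (\<Sum>i\<in>I. E (B i) g x)"
  using assms(1-3)
proof (induction I rule: finite_induct)
  case empty
  then show ?case using E_empty[OF g] by simp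
next
  case (insert i I)
  have "AE x in M. E (\<Union>i\<in>I. B i) g x = (\<Sum>i\<in>I. E (B i) g x)"
    using insert by (auto intro!: insert.IH disjoint_family_on_mono[OF _ insert.prems(2)])
  moreover have "B i \<inter> (\<Union>i\<in>I. B i) = {}"
    using insert.prems(2) insert.hyps by (auto simp: disjoint_family_on_def)
  then have "AE x in M. E (B i \<union> (\<Union>i\<in>I. B i)) g x = E (B i) g x + E (\<Union>i\<in>I. B i) g x"
    using insert by (intro E_Un g) (auto intro!: sets.finite_UN)
  ultimately show ?case
    by eventually_elim (use insert.hyps in simp)
qed

lemma E_sum:
  assumes "B \<in> sets borel" "finite I" "\<And>i. i \<in> I \<Longrightarrow> f i \<in> L2 M"
  shows "AE x in M. E B (\<lambda>y. \<Sum>i\<in>I. c i * f i y) x = (\<Sum>i\<in>I. c i * E B (f i) x)"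
  using assms(2,3)
proof (induction I rule: finite_induct)
  case empty
  then show ?case using E_zero[OF assms(1)] by simp
next
  case (insert i I)
  have "AE x in M. E B (\<lambda>y. c i * f i y + 1 * (\<Sum>i\<in>I. c i * f i y)) x =
      c i * E B (f i) x + 1 * E B (\<lambda>y. \<Sum>i\<in>I. c i * f i y) x"
    using insert by (intro E_linear assms(1)) (auto intro!: L2_sum L2_scale)
  moreover have "AE x in M. E B (\<lambda>y. \<Sum>i\<in>I. c i * f i y) x = (\<Sum>i\<in>I. c i * E B (f i) x)"
    using insert by auto
  ultimately show ?case by eventually_elim (use insert.hyps in simp)
qed

lemma simple_preimage: "simple_function borel s \<Longrightarrow> s -` {b} \<in> sets borel"
  for s :: "real \<Rightarrow> 'b"
  using simple_functionD(2)[of borel s "{b}"] by simp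

lemma simple_finite_range: "simple_function borel s \<Longrightarrow> finite (range s)" for s :: "real \<Rightarrow> 'b"
  by (simp add: simple_function_def)

lemma T_L2: "simple_function borel s \<Longrightarrow> g \<in> L2 M \<Longrightarrow> T s g \<in> L2 M"
  unfolding pvm_simple_integral_def by (intro L2_sum L2_scale E_L2 simple_preimage)

text \<open>\<open>h\<close> may identify values of \<open>u\<close>, so a level set of the
  composite is a finite disjoint union of level sets of \<open>u\<close>. This allows integrals of
  several simple functions to be written over one common partition, that of their pair.\<close>

lemma T_compose:
  fixes u :: "real \<Rightarrow> 'b"
  assumes u: "simple_function borel u" and g: "g \<in> L2 M"
  shows "AE x in M. T (\<lambda>\<omega>. h (u \<omega>)) g x = (\<Sum>b\<in>range u. h b * E (u -` {b}) g x)"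
proof -
  note fin = simple_finite_range[OF u]
  define s where "s = (\<lambda>\<omega>. h (u \<omega>))"
  have rs: "range s = h ` range u" by (auto simp: s_def)
  have "AE x in M. \<forall>c\<in>range s. E (s -` {c}) g x = (\<Sum>b\<in>{b\<in>range u. h b = c}. E (u -` {b}) g x)"
  proof (intro AE_finite_allI)
    fix c assume "c \<in> range s"
    have eq: "s -` {c} = (\<Union>b\<in>{b\<in>range u. h b = c}. u -` {b})" by (auto simp: s_def)
    show "AE x in M. E (s -` {c}) g x = (\<Sum>b\<in>{b\<in>range u. h b = c}. E (u -` {b}) g x)"
      unfolding eq using fin
      by (intro E_finite_UN g simple_preimage[OF u]) (auto simp: disjoint_family_on_def)
  qed (use fin rs in auto)
  then show ?thesis
  proof eventually_elim
    fix x assume *: "\<forall>c\<in>range s. E (s -` {c}) g x = (\<Sum>b\<in>{b\<in>range u. h b = c}. E (u -` {b}) g x)"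
    have "T s g x = (\<Sum>c\<in>range s. c * (\<Sum>b\<in>{b\<in>range u. h b = c}. E (u -` {b}) g x))"
      unfolding pvm_simple_integral_def using * by (intro sum.cong) auto
    also have "\<dots> = (\<Sum>c\<in>h ` range u. \<Sum>b\<in>{b\<in>range u. h b = c}. h b * E (u -` {b}) g x)"
      unfolding rs by (intro sum.cong) (auto simp: sum_distrib_left)
    also have "\<dots> = (\<Sum>b\<in>range u. h b * E (u -` {b}) g x)"
      by (rule sum.image_gen[OF fin, symmetric])
    finally show "T (\<lambda>\<omega>. h (u \<omega>)) g x = (\<Sum>b\<in>range u. h b * E (u -` {b}) g x)"
      by (simp add: s_def)
  qed
qed

lemma T_linear:
  assumes s: "simple_function borel s" "simple_function borel s'" and g: "g \<in> L2 M"
  shows "AE x in M. T (\<lambda>\<omega>. a * s \<omega> + b * s' \<omega>) g x = a * T s g x + b * T s' g x"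
proof -
  define u where "u = (\<lambda>\<omega>. (s \<omega>, s' \<omega>))"
  have u: "simple_function borel u" unfolding u_def using s by (rule simple_function_Pair)
  have "AE x in M. T (\<lambda>\<omega>. a * fst (u \<omega>) + b * snd (u \<omega>)) g x =
      (\<Sum>c\<in>range u. (a * fst c + b * snd c) * E (u -` {c}) g x)"
    by (rule T_compose[OF u g])
  moreover have "AE x in M. T (\<lambda>\<omega>. fst (u \<omega>)) g x = (\<Sum>c\<in>range u. fst c * E (u -` {c}) g x)"
    by (rule T_compose[OF u g])
  moreover have "AE x in M. T (\<lambda>\<omega>. snd (u \<omega>)) g x = (\<Sum>c\<in>range u. snd c * E (u -` {c}) g x)"
    by (rule T_compose[OF u g])
  ultimately show ?thesis
    by eventually_elim (simp add: u_def sum_distrib_left distrib_right sum.distrib mult.assoc)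
qed

lemma T_diff:
  assumes "simple_function borel s" "simple_function borel s'" "g \<in> L2 M"
  shows "AE x in M. T (\<lambda>\<omega>. s \<omega> - s' \<omega>) g x = T s g x - T s' g x"
  using T_linear[OF assms, of 1 "-1"] by simp

text \<open>Over the partition of the pair, the projection of one part kills all other summands of
  \<open>T s' g\<close>, so on that part \<open>T s' g\<close> reduces to \<open>snd c\<close> times
  the projection of \<open>g\<close>.\<close>

lemma T_mult:
  assumes s: "simple_function borel s" "simple_function borel s'" and g: "g \<in> L2 M"
  shows "AE x in M. T (\<lambda>\<omega>. s \<omega> * s' \<omega>) g x = T s (T s' g) x"
proof -
  define u where "u = (\<lambda>\<omega>. (s \<omega>, s' \<omega>))"
  have u: "simple_function borel u" unfolding u_def using s by (rule simple_function_Pair)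
  note fin = simple_finite_range[OF u]
  let ?B = "\<lambda>c. u -` {c}"
  have Bb: "?B c \<in> sets borel" for c by (rule simple_preimage[OF u])
  have T's: "AE x in M. T (\<lambda>\<omega>. snd (u \<omega>)) g x = (\<Sum>c\<in>range u. snd c * E (?B c) g x)"
    by (rule T_compose[OF u g])
  let ?f = "\<lambda>x. \<Sum>c\<in>range u. snd c * E (?B c) g x"
  have T'L: "T s' g \<in> L2 M" using s g by (simp add: T_L2)
  have fL: "?f \<in> L2 M" by (intro L2_sum L2_scale E_L2 Bb g)
  have "AE x in M. \<forall>c\<in>range u. E (?B c) (T s' g) x = snd c * E (?B c) g x"
  proof (intro AE_finite_allI fin)
    fix c assume c: "c \<in> range u"
    have "AE x in M. E (?B c) (T s' g) x = E (?B c) ?f x"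
      by (rule E_cong[OF Bb T'L fL]) (use T's in \<open>simp add: u_def\<close>)
    moreover have "AE x in M. E (?B c) ?f x = (\<Sum>d\<in>range u. snd d * E (?B c) (E (?B d) g) x)"
      by (intro E_sum Bb fin E_L2 g)
    moreover have "AE x in M. \<forall>d\<in>range u. E (?B c) (E (?B d) g) x = E (?B c \<inter> ?B d) g x"
    proof (intro AE_finite_allI fin)
      fix d show "AE x in M. E (?B c) (E (?B d) g) x = E (?B c \<inter> ?B d) g x"
        using E_Int[OF Bb Bb g, of c d] by eventually_elim (rule sym)
    qed
    ultimately show "AE x in M. E (?B c) (T s' g) x = snd c * E (?B c) g x"
      using E_empty[OF g]
    proof eventually_elim
      fix x
      assume a: "E (?B c) (T s' g) x = E (?B c) ?f x"
        "E (?B c) ?f x = (\<Sum>d\<in>range u. snd d * E (?B c) (E (?B d) g) x)"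
        "\<forall>d\<in>range u. E (?B c) (E (?B d) g) x = E (?B c \<inter> ?B d) g x" "E {} g x = 0"
      have "(\<Sum>d\<in>range u. snd d * E (?B c) (E (?B d) g) x) = (\<Sum>d\<in>range u. snd d * E (?B c \<inter> ?B d) g x)"
      proof (intro sum.cong refl)
        fix d assume "d \<in> range u"
        from bspec[OF a(3) this] show "snd d * E (?B c) (E (?B d) g) x = snd d * E (?B c \<inter> ?B d) g x"
          by (rule arg_cong)
      qed
      also have "\<dots> = (\<Sum>d\<in>range u. if d = c then snd c * E (?B c) g x else 0)"
      proof (intro sum.cong refl)
        fix d
        have "d \<noteq> c \<Longrightarrow> ?B c \<inter> ?B d = {}" by auto
        then show "snd d * E (?B c \<inter> ?B d) g x = (if d = c then snd c * E (?B c) g x else 0)"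
          using a(4) by auto
      qed
      also have "\<dots> = snd c * E (?B c) g x" using c fin by simp
      finally show "E (?B c) (T s' g) x = snd c * E (?B c) g x" using a(1,2) by simp
    qed
  qed
  moreover have "AE x in M. T (\<lambda>\<omega>. fst (u \<omega>)) (T s' g) x = (\<Sum>c\<in>range u. fst c * E (?B c) (T s' g) x)"
    by (rule T_compose[OF u T'L])
  moreover have "AE x in M. T (\<lambda>\<omega>. fst (u \<omega>) * snd (u \<omega>)) g x = (\<Sum>c\<in>range u. (fst c * snd c) * E (?B c) g x)"
    by (rule T_compose[OF u g])
  ultimately show ?thesis
  proof eventually_elim
    fix x
    assume a: "\<forall>c\<in>range u. E (?B c) (T s' g) x = snd c * E (?B c) g x"
      "T (\<lambda>\<omega>. fst (u \<omega>)) (T s' g) x = (\<Sum>c\<in>range u. fst c * E (?B c) (T s' g) x)"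
      "T (\<lambda>\<omega>. fst (u \<omega>) * snd (u \<omega>)) g x = (\<Sum>c\<in>range u. (fst c * snd c) * E (?B c) g x)"
    have "(\<Sum>c\<in>range u. fst c * E (?B c) (T s' g) x) = (\<Sum>c\<in>range u. (fst c * snd c) * E (?B c) g x)"
    proof (intro sum.cong refl)
      fix c assume "c \<in> range u"
      from bspec[OF a(1) this] show "fst c * E (?B c) (T s' g) x = fst c * snd c * E (?B c) g x"
        by (simp only: mult.assoc)
    qed
    then show "T (\<lambda>\<omega>. s \<omega> * s' \<omega>) g x = T s (T s' g) x"
      using a(2,3) by (simp add: u_def)
  qed
qed

text \<open>Pythagoras twice: level sets are disjoint and cover the line, so the projections of
  \<open>g\<close> are orthogonal and sum to \<open>g\<close>, and the integral only rescales each
  of them by a value of modulus at most \<open>K\<close>.\<close>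

lemma T_norm_le:
  assumes s: "simple_function borel s" and g: "g \<in> L2 M" and K: "\<And>\<omega>. cmod (s \<omega>) \<le> K"
  shows "L2_norm M (T s g) \<le> K * L2_norm M g"
proof (rule power2_le_imp_le)
  note fin = simple_finite_range[OF s]
  let ?E = "\<lambda>c. E (s -` {c}) g"
  have L: "?E c \<in> L2 M" for c by (intro E_L2 simple_preimage s g)
  have orth: "L2_inner M (?E c) (?E d) = 0" if "c \<noteq> d" for c d
    using that by (intro E_orthogonal simple_preimage s g) auto
  have K0: "0 \<le> K" using K[of 0] norm_ge_zero order_trans by blast
  have "AE x in M. E (\<Union>c\<in>range s. s -` {c}) g x = (\<Sum>c\<in>range s. ?E c x)"
    by (intro E_finite_UN fin simple_preimage s g) (auto simp: disjoint_family_on_def)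
  moreover have "(\<Union>c\<in>range s. s -` {c}) = UNIV" by auto
  ultimately have "AE x in M. g x = (\<Sum>c\<in>range s. ?E c x)"
    using E_UNIV[OF g] by auto
  then have "L2_norm M g = L2_norm M (\<lambda>x. \<Sum>c\<in>range s. ?E c x)"
    by (intro L2_norm_cong_AE L2_measurable L2_sum L g)
  then have gn: "(L2_norm M g)\<^sup>2 = (\<Sum>c\<in>range s. (L2_norm M (?E c))\<^sup>2)"
    using L2_norm_sum_orthogonal[OF fin, of ?E M] L orth by simp
  have "(L2_norm M (T s g))\<^sup>2 = (\<Sum>c\<in>range s. (L2_norm M (\<lambda>x. c * ?E c x))\<^sup>2)"
    unfolding pvm_simple_integral_def
    by (intro L2_norm_sum_orthogonal fin L2_scale L)
      (simp add: L2_inner_scale_left L2_inner_scale_right orth)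
  also have "\<dots> = (\<Sum>c\<in>range s. (cmod c)\<^sup>2 * (L2_norm M (?E c))\<^sup>2)"
    by (simp add: L2_norm_scale power_mult_distrib)
  also have "\<dots> \<le> (\<Sum>c\<in>range s. K\<^sup>2 * (L2_norm M (?E c))\<^sup>2)"
    using K by (intro sum_mono mult_right_mono power_mono) auto
  also have "\<dots> = (K * L2_norm M g)\<^sup>2"
    by (simp add: gn sum_distrib_left power_mult_distrib)
  finally show "(L2_norm M (T s g))\<^sup>2 \<le> (K * L2_norm M g)\<^sup>2" .
  show "0 \<le> K * L2_norm M g" using K0 by simp
qed

lemma T_linear_right:
  assumes s: "simple_function borel s" and "f \<in> L2 M" "g \<in> L2 M"
  shows "AE x in M. T s (\<lambda>x. f x - g x) x = T s f x - T s g x"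
proof -
  have "AE x in M. \<forall>c\<in>range s. E (s -` {c}) (\<lambda>x. 1 * f x + (-1) * g x) x = 1 * E (s -` {c}) f x + (-1) * E (s -` {c}) g x"
    using simple_finite_range[OF s] by (intro AE_finite_allI E_linear simple_preimage s assms)
  then show ?thesis
  proof eventually_elim
    fix x assume a: "\<forall>c\<in>range s. E (s -` {c}) (\<lambda>x. 1 * f x + (-1) * g x) x = 1 * E (s -` {c}) f x + (-1) * E (s -` {c}) g x"
    have "T s (\<lambda>x. f x - g x) x = (\<Sum>c\<in>range s. c * E (s -` {c}) f x - c * E (s -` {c}) g x)"
      unfolding pvm_simple_integral_def
    proof (intro sum.cong refl)
      fix c assume "c \<in> range s"
      from bspec[OF a this] show "c * E (s -` {c}) (\<lambda>x. f x - g x) x = c * E (s -` {c}) f x - c * E (s -` {c}) g x"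
        by (simp add: right_diff_distrib)
    qed
    then show "T s (\<lambda>x. f x - g x) x = T s f x - T s g x"
      by (simp add: pvm_simple_integral_def sum_subtractf)
  qed
qed

lemma T_dist_le:
  assumes "simple_function borel s" "simple_function borel s'" "g \<in> L2 M" "\<And>\<omega>. cmod (s \<omega> - s' \<omega>) \<le> K"
  shows "L2_norm M (\<lambda>x. T s g x - T s' g x) \<le> K * L2_norm M g"
proof -
  have d: "simple_function borel (\<lambda>\<omega>. s \<omega> - s' \<omega>)" using assms by (intro simple_function_diff)
  have "L2_norm M (\<lambda>x. T s g x - T s' g x) = L2_norm M (T (\<lambda>\<omega>. s \<omega> - s' \<omega>) g)"
    using T_diff[OF assms(1-3)] assms(1-3) d
    by (intro L2_norm_cong_AE L2_measurable L2_diff T_L2) (auto elim: eventually_mono)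
  also have "\<dots> \<le> K * L2_norm M g" by (rule T_norm_le[OF d assms(3,4)])
  finally show ?thesis .
qed

end

section \<open>Functional calculus for bounded Borel functions\<close>

context pvm
begin

abbreviation has :: "(real \<Rightarrow> complex) \<Rightarrow> ('a \<Rightarrow> complex) \<Rightarrow> ('a \<Rightarrow> complex) \<Rightarrow> bool" where
  "has \<equiv> has_pvm_integral M E"

abbreviation \<Phi> :: "(real \<Rightarrow> complex) \<Rightarrow> ('a \<Rightarrow> complex) \<Rightarrow> 'a \<Rightarrow> complex" where
  "\<Phi> \<equiv> pvm_integral M E"

lemma has_L2: "has \<phi> g h \<Longrightarrow> h \<in> L2 M"
  by (simp add: has_pvm_integral_def)

lemma simple_bounded_measurable:
  fixes s :: "real \<Rightarrow> complex"
  assumes "simple_function borel s"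
  shows "s \<in> borel_measurable borel" "bounded (range s)"
  using assms by (auto intro: borel_measurable_simple_function finite_imp_bounded simp: simple_function_def)

text \<open>The definition only speaks of the particular approximants that witness the integral.
  Comparison with a late witness transfers the estimate to every simple function uniformly close to
  \<open>\<phi>\<close>, so approximants may be chosen freely afterwards.\<close>

lemma has_dist_le:
  assumes h: "has \<phi> g h" and s: "simple_function borel s" and g: "g \<in> L2 M"
    and e: "\<And>\<omega>. cmod (s \<omega> - \<phi> \<omega>) \<le> \<epsilon>"
  shows "L2_norm M (\<lambda>x. T s g x - h x) \<le> \<epsilon> * L2_norm M g"
proof (rule field_le_epsilon)
  fix \<delta> :: real assume d: "0 < \<delta>"
  \<comment> \<open>The summand 1 keeps the quotient meaningful when \<open>g\<close> has norm
    zero.\<close>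
  define \<eta> where "\<eta> = \<delta> / (L2_norm M g + 1)"
  have p: "0 < L2_norm M g + 1" using L2_norm_nonneg[of M g] by linarith
  have eta: "0 < \<eta>" using d p by (simp add: \<eta>_def)
  from h obtain u where u: "\<And>k. simple_function borel (u k)" "uniform_limit UNIV u \<phi> sequentially"
    and lim: "(\<lambda>k. L2_norm M (\<lambda>x. T (u k) g x - h x)) \<longlonglongrightarrow> 0"
    unfolding has_pvm_integral_def by blast
  note hL = has_L2[OF h]
  have ev: "\<forall>\<^sub>F k in sequentially. L2_norm M (\<lambda>x. T s g x - h x)
      \<le> (\<epsilon> + \<eta>) * L2_norm M g + L2_norm M (\<lambda>x. T (u k) g x - h x)"
    using uniform_limitD[OF u(2) eta]
  proof eventually_elim
    fix k assume k: "\<forall>\<omega>\<in>UNIV. dist (u k \<omega>) (\<phi> \<omega>) < \<eta>"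
    have "cmod (s \<omega> - u k \<omega>) \<le> \<epsilon> + \<eta>" for \<omega>
    proof -
      have "dist (s \<omega>) (u k \<omega>) \<le> dist (s \<omega>) (\<phi> \<omega>) + dist (u k \<omega>) (\<phi> \<omega>)" by (rule dist_triangle2)
      also have "\<dots> \<le> \<epsilon> + \<eta>" using e[of \<omega>] k by (intro add_mono) (auto simp: dist_norm less_imp_le)
      finally show ?thesis by (simp add: dist_norm)
    qed
    then have "L2_norm M (\<lambda>x. T s g x - T (u k) g x) \<le> (\<epsilon> + \<eta>) * L2_norm M g"
      by (rule T_dist_le[OF s u(1) g])
    then show "L2_norm M (\<lambda>x. T s g x - h x) \<le> (\<epsilon> + \<eta>) * L2_norm M g + L2_norm M (\<lambda>x. T (u k) g x - h x)"
      using L2_norm_dist_triangle[OF T_L2[OF s g] T_L2[OF u(1) g] hL, of k] by linarith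
  qed
  have "L2_norm M (\<lambda>x. T s g x - h x) \<le> (\<epsilon> + \<eta>) * L2_norm M g + 0"
    by (rule tendsto_le[OF _ tendsto_add[OF tendsto_const lim] tendsto_const ev]) simp
  also have "\<eta> * L2_norm M g \<le> \<eta> * (L2_norm M g + 1)" using eta by (intro mult_left_mono) auto
  then have "(\<epsilon> + \<eta>) * L2_norm M g + 0 \<le> \<epsilon> * L2_norm M g + \<delta>"
    using p by (simp add: \<eta>_def distrib_right)
  finally show "L2_norm M (\<lambda>x. T s g x - h x) \<le> \<epsilon> * L2_norm M g + \<delta>" .
qed

lemma hasI:
  assumes h: "h \<in> L2 M"
    and ex: "\<And>\<epsilon>. 0 < \<epsilon> \<Longrightarrow> \<exists>s. simple_function borel s \<and> (\<forall>\<omega>. cmod (s \<omega> - \<phi> \<omega>) \<le> \<epsilon>) \<and>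
              L2_norm M (\<lambda>x. T s g x - h x) \<le> \<epsilon>"
  shows "has \<phi> g h"
proof -
  define e where "e k = inverse (real (Suc k))" for k
  have e: "0 < e k" for k by (simp add: e_def)
  have "\<forall>k. \<exists>s. simple_function borel s \<and> (\<forall>\<omega>. cmod (s \<omega> - \<phi> \<omega>) \<le> e k) \<and>
              L2_norm M (\<lambda>x. T s g x - h x) \<le> e k"
    using ex[OF e] by blast
  then obtain s where s: "\<And>k. simple_function borel (s k)" "\<And>k \<omega>. cmod (s k \<omega> - \<phi> \<omega>) \<le> e k"
    and n: "\<And>k. L2_norm M (\<lambda>x. T (s k) g x - h x) \<le> e k"
    by metis
  have e0: "e \<longlonglongrightarrow> 0" unfolding e_def by (rule LIMSEQ_inverse_real_of_nat)
  have "uniform_limit UNIV s \<phi> sequentially"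
  proof (rule uniform_limitI)
    fix d :: real assume "0 < d"
    with e0 have "\<forall>\<^sub>F k in sequentially. e k < d" by (rule order_tendstoD)
    then show "\<forall>\<^sub>F k in sequentially. \<forall>\<omega>\<in>UNIV. dist (s k \<omega>) (\<phi> \<omega>) < d"
      by eventually_elim (auto simp: dist_norm intro: le_less_trans[OF s(2)])
  qed
  moreover have "(\<lambda>k. L2_norm M (\<lambda>x. T (s k) g x - h x)) \<longlonglongrightarrow> 0"
    by (rule tendsto_sandwich[OF _ _ tendsto_const e0]) (use n in auto)
  ultimately show ?thesis unfolding has_pvm_integral_def using h s(1) by blast
qed

lemma has_simple:
  assumes "simple_function borel s" "g \<in> L2 M"
  shows "has s g (T s g)"
  by (rule hasI[OF T_L2[OF assms]]) (use assms in \<open>auto intro!: exI[of _ s]\<close>)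

lemma has_exists:
  assumes "\<phi> \<in> borel_measurable borel" "bounded (range \<phi>)" and g: "g \<in> L2 M"
  shows "\<exists>h. has \<phi> g h"
proof -
  \<comment> \<open>A geometric tolerance makes the norms of the increments summable, as
    \<open>L2_complete\<close> requires.\<close>
  define e where "e k = (1/2::real) ^ k" for k
  have e: "0 < e k" for k by (simp add: e_def)
  have "\<forall>k. \<exists>s. simple_function borel s \<and> (\<forall>\<omega>. cmod (s \<omega> - \<phi> \<omega>) \<le> e k)"
    using uniform_simple_approximation[OF assms(1,2) e] by metis
  then obtain s where s: "\<And>k. simple_function borel (s k)" "\<And>k \<omega>. cmod (s k \<omega> - \<phi> \<omega>) \<le> e k"
    by metis
  have d: "L2_norm M (\<lambda>x. T (s (Suc k)) g x - T (s k) g x) \<le> (2 * L2_norm M g) * e k" for k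
  proof -
    have "cmod (s (Suc k) \<omega> - s k \<omega>) \<le> 2 * e k" for \<omega>
    proof -
      have "dist (s (Suc k) \<omega>) (s k \<omega>) \<le> dist (s (Suc k) \<omega>) (\<phi> \<omega>) + dist (s k \<omega>) (\<phi> \<omega>)" by (rule dist_triangle2)
      also have "\<dots> \<le> e (Suc k) + e k" using s(2) by (intro add_mono) (auto simp: dist_norm)
      also have "\<dots> \<le> 2 * e k" by (simp add: e_def)
      finally show ?thesis by (simp add: dist_norm)
    qed
    from T_dist_le[OF s(1) s(1) g this] show ?thesis by (simp add: mult.commute mult.left_commute)
  qed
  have "summable (\<lambda>k. (2 * L2_norm M g) * e k)"
    unfolding e_def by (intro summable_mult summable_geometric) simp
  from L2_complete[OF T_L2[OF s(1) g] d this]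
  obtain h where h: "h \<in> L2 M" "(\<lambda>k. L2_norm M (\<lambda>x. T (s k) g x - h x)) \<longlonglongrightarrow> 0" by blast
  have "has \<phi> g h"
  proof (rule hasI[OF h(1)])
    fix \<epsilon> :: real assume eps: "0 < \<epsilon>"
    have "e \<longlonglongrightarrow> 0" unfolding e_def by (rule LIMSEQ_realpow_zero) auto
    then have "\<forall>\<^sub>F k in sequentially. e k < \<epsilon>" using eps by (rule order_tendstoD)
    moreover have "\<forall>\<^sub>F k in sequentially. L2_norm M (\<lambda>x. T (s k) g x - h x) < \<epsilon>"
      using h(2) eps by (rule order_tendstoD)
    ultimately have "\<forall>\<^sub>F k in sequentially. e k < \<epsilon> \<and> L2_norm M (\<lambda>x. T (s k) g x - h x) < \<epsilon>"
      by (rule eventually_conj)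
    then obtain k where "e k < \<epsilon>" "L2_norm M (\<lambda>x. T (s k) g x - h x) < \<epsilon>"
      using eventually_happens'[OF sequentially_bot] by blast
    then show "\<exists>s. simple_function borel s \<and> (\<forall>\<omega>. cmod (s \<omega> - \<phi> \<omega>) \<le> \<epsilon>) \<and>
              L2_norm M (\<lambda>x. T s g x - h x) \<le> \<epsilon>"
      by (intro exI[of _ "s k"] conjI allI s(1) order_trans[OF s(2)] less_imp_le)
  qed
  then show ?thesis by blast
qed

lemma has_\<Phi>:
  assumes "\<phi> \<in> borel_measurable borel" "bounded (range \<phi>)" "g \<in> L2 M"
  shows "has \<phi> g (\<Phi> \<phi> g)"
  unfolding pvm_integral_def using has_exists[OF assms] by (rule someI_ex)

lemma has_linear:
  assumes m: "\<phi> \<in> borel_measurable borel" "bounded (range \<phi>)" "\<psi> \<in> borel_measurable borel" "bounded (range \<psi>)"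
    and h: "has \<phi> g h" "has \<psi> g k" and g: "g \<in> L2 M"
  shows "has (\<lambda>\<omega>. a * \<phi> \<omega> + b * \<psi> \<omega>) g (\<lambda>x. a * h x + b * k x)"
proof (rule hasI)
  note hL = has_L2[OF h(1)] has_L2[OF h(2)]
  show "(\<lambda>x. a * h x + b * k x) \<in> L2 M" by (intro L2_add L2_scale hL)
  fix \<epsilon> :: real assume eps: "0 < \<epsilon>"
  \<comment> \<open>\<open>C\<close> dominates both error factors, that of the uniform distance and
    that of the \<open>L2\<close> distance, so that a single \<open>\<delta>\<close> serves both
    requirements of \<open>hasI\<close>.\<close>
  define C where "C = (cmod a + cmod b) * (L2_norm M g + 1) + 1"
  have g0: "0 \<le> L2_norm M g" by simp
  have C: "0 < C" unfolding C_def using g0 by (intro add_nonneg_pos mult_nonneg_nonneg add_nonneg_nonneg) auto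
  have ab: "(cmod a + cmod b) * 1 \<le> C" "(cmod a + cmod b) * L2_norm M g \<le> C"
    using g0 by (auto simp: C_def algebra_simps add_nonneg_nonneg)
  define \<delta> where "\<delta> = \<epsilon> / C"
  have d: "0 < \<delta>" using eps C by (simp add: \<delta>_def)
  obtain s where s: "simple_function borel s" "\<And>\<omega>. cmod (s \<omega> - \<phi> \<omega>) \<le> \<delta>"
    using uniform_simple_approximation[OF m(1,2) d] by blast
  obtain u where u: "simple_function borel u" "\<And>\<omega>. cmod (u \<omega> - \<psi> \<omega>) \<le> \<delta>"
    using uniform_simple_approximation[OF m(3,4) d] by blast
  let ?w = "\<lambda>\<omega>. a * s \<omega> + b * u \<omega>"
  have w: "simple_function borel ?w"
    using s(1) u(1) by (intro simple_function_add simple_function_mult simple_function_const)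
  have "cmod (?w \<omega> - (a * \<phi> \<omega> + b * \<psi> \<omega>)) \<le> \<epsilon>" for \<omega>
  proof -
    have "?w \<omega> - (a * \<phi> \<omega> + b * \<psi> \<omega>) = a * (s \<omega> - \<phi> \<omega>) + b * (u \<omega> - \<psi> \<omega>)"
      by (simp add: algebra_simps)
    also have "cmod \<dots> \<le> cmod a * \<delta> + cmod b * \<delta>"
      by (rule norm_triangle_mono) (use s(2) u(2) in \<open>auto simp: norm_mult intro!: mult_left_mono\<close>)
    also have "\<dots> \<le> C * \<delta>" using mult_right_mono[OF ab(1), of \<delta>] d by (simp add: distrib_right)
    also have "\<dots> = \<epsilon>" using C by (simp add: \<delta>_def)
    finally show ?thesis .
  qed
  moreover have "L2_norm M (\<lambda>x. T ?w g x - (a * h x + b * k x)) \<le> \<epsilon>"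
  proof -
    have "AE x in M. T ?w g x - (a * h x + b * k x) = a * (T s g x - h x) + b * (T u g x - k x)"
      using T_linear[OF s(1) u(1) g, of a b] by eventually_elim (simp add: algebra_simps)
    then have "L2_norm M (\<lambda>x. T ?w g x - (a * h x + b * k x)) =
        L2_norm M (\<lambda>x. a * (T s g x - h x) + b * (T u g x - k x))"
      using w s(1) u(1) g hL by (intro L2_norm_cong_AE L2_measurable L2_diff L2_add L2_scale T_L2)
    also have "\<dots> \<le> L2_norm M (\<lambda>x. a * (T s g x - h x)) + L2_norm M (\<lambda>x. b * (T u g x - k x))"
      using s(1) u(1) g hL by (intro L2_norm_triangle L2_scale L2_diff T_L2)
    also have "\<dots> \<le> cmod a * (\<delta> * L2_norm M g) + cmod b * (\<delta> * L2_norm M g)"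
      unfolding L2_norm_scale
      by (intro add_mono mult_left_mono has_dist_le[OF h(1) s(1) g s(2)] has_dist_le[OF h(2) u(1) g u(2)]) auto
    also have "\<dots> = \<delta> * ((cmod a + cmod b) * L2_norm M g)" by (simp add: algebra_simps)
    also have "\<dots> \<le> \<delta> * C" using ab(2) d by (intro mult_left_mono) auto
    also have "\<dots> = \<epsilon>" using C by (simp add: \<delta>_def)
    finally show ?thesis .
  qed
  ultimately show "\<exists>s. simple_function borel s \<and> (\<forall>\<omega>. cmod (s \<omega> - (a * \<phi> \<omega> + b * \<psi> \<omega>)) \<le> \<epsilon>) \<and>
      L2_norm M (\<lambda>x. T s g x - (a * h x + b * k x)) \<le> \<epsilon>"
    using w by blast
qed

lemma has_norm_le:
  assumes m: "\<phi> \<in> borel_measurable borel" and h: "has \<phi> g h" and g: "g \<in> L2 M"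
    and K: "\<And>\<omega>. cmod (\<phi> \<omega>) \<le> K"
  shows "L2_norm M h \<le> K * L2_norm M g"
proof (rule field_le_epsilon)
  fix \<delta> :: real assume d: "0 < \<delta>"
  define \<eta> where "\<eta> = \<delta> / (2 * (L2_norm M g + 1))"
  have p: "0 < L2_norm M g + 1" using L2_norm_nonneg[of M g] by linarith
  have eta: "0 < \<eta>" using d p by (simp add: \<eta>_def)
  have "bounded (range \<phi>)" using K by (auto simp: bounded_iff)
  then obtain s where s: "simple_function borel s" "\<And>\<omega>. cmod (s \<omega> - \<phi> \<omega>) \<le> \<eta>"
    using uniform_simple_approximation[OF m _ eta] by blast
  have "cmod (s \<omega>) \<le> K + \<eta>" for \<omega>
    using norm_triangle_sub[of "s \<omega>" "\<phi> \<omega>"] K[of \<omega>] s(2)[of \<omega>] by linarith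
  then have "L2_norm M (T s g) \<le> (K + \<eta>) * L2_norm M g" by (rule T_norm_le[OF s(1) g])
  moreover have "L2_norm M (\<lambda>x. T s g x - h x) \<le> \<eta> * L2_norm M g" by (rule has_dist_le[OF h s(1) g s(2)])
  moreover have "L2_norm M h \<le> L2_norm M (T s g) + L2_norm M (\<lambda>x. T s g x - h x)"
    using L2_norm_triangle_sub[OF T_L2[OF s(1) g] L2_diff[OF T_L2[OF s(1) g] has_L2[OF h]]] by simp
  moreover have "2 * \<eta> * L2_norm M g \<le> 2 * \<eta> * (L2_norm M g + 1)" using eta by (intro mult_left_mono) auto
  moreover have "2 * \<eta> * (L2_norm M g + 1) = \<delta>"
  proof -
    have "2 * (\<delta> / (2 * P)) * P = \<delta>" if "0 < P" for P :: real using that by simp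
    from this[OF p] show ?thesis unfolding \<eta>_def .
  qed
  ultimately show "L2_norm M h \<le> K * L2_norm M g + \<delta>" by (simp add: distrib_right)
qed

lemma has_unique:
  assumes m: "\<phi> \<in> borel_measurable borel" "bounded (range \<phi>)" and h: "has \<phi> g h" "has \<phi> g k" and g: "g \<in> L2 M"
  shows "L2_norm M (\<lambda>x. h x - k x) = 0"
proof -
  have "has (\<lambda>\<omega>. 0) g (\<lambda>x. h x - k x)"
    using has_linear[OF m m h g, of 1 "-1"] by simp
  from has_norm_le[OF _ this g, of 0] show ?thesis by (simp add: antisym)
qed

text \<open>The product of simple approximants acts as \<open>T s\<close> after \<open>T u\<close>.
  The error splits into replacing \<open>T u g\<close> by \<open>h\<close> under the bounded
  operator \<open>T s\<close>, and replacing \<open>T s h\<close> by \<open>k\<close>.\<close>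

lemma has_mult:
  assumes m: "\<phi> \<in> borel_measurable borel" "bounded (range \<phi>)" "\<psi> \<in> borel_measurable borel" "bounded (range \<psi>)"
    and h: "has \<psi> g h" "has \<phi> h k" and g: "g \<in> L2 M"
  shows "has (\<lambda>\<omega>. \<phi> \<omega> * \<psi> \<omega>) g k"
proof (rule hasI)
  note hL = has_L2[OF h(1)] and kL = has_L2[OF h(2)]
  show "k \<in> L2 M" by (rule kL)
  obtain A where A: "\<And>\<omega>. cmod (\<phi> \<omega>) \<le> A" using m(2) by (auto simp: bounded_iff)
  obtain B where B: "\<And>\<omega>. cmod (\<psi> \<omega>) \<le> B" using m(4) by (auto simp: bounded_iff)
  have A0: "0 \<le> A" and B0: "0 \<le> B" using A[of 0] B[of 0] norm_ge_zero order_trans by blast+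
  fix \<epsilon> :: real assume eps: "0 < \<epsilon>"
  define C where "C = (A + 1) * (L2_norm M g + 1) + L2_norm M h + B + A + 1"
  have g0: "0 \<le> L2_norm M g" and h0: "0 \<le> L2_norm M h" by simp_all
  have C: "0 < C" unfolding C_def using g0 h0 A0 B0 by (intro add_nonneg_pos add_nonneg_nonneg mult_nonneg_nonneg) auto
  have C1: "A + 1 + B \<le> C" and C2: "(A + 1) * L2_norm M g + L2_norm M h \<le> C"
    using g0 h0 A0 B0 by (auto simp: C_def algebra_simps add_nonneg_nonneg)
  \<comment> \<open>The cap at 1 bounds the approximant of \<open>\<phi>\<close> by
    \<open>A + 1\<close>.\<close>
  define \<delta> where "\<delta> = min 1 (\<epsilon> / C)"
  have d: "0 < \<delta>" "\<delta> \<le> 1" using eps C by (auto simp: \<delta>_def)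
  have dC: "\<delta> * C \<le> \<epsilon>" using C by (simp add: \<delta>_def min_def field_simps)
  obtain s where s: "simple_function borel s" "\<And>\<omega>. cmod (s \<omega> - \<phi> \<omega>) \<le> \<delta>"
    using uniform_simple_approximation[OF m(1,2) d(1)] by blast
  obtain u where u: "simple_function borel u" "\<And>\<omega>. cmod (u \<omega> - \<psi> \<omega>) \<le> \<delta>"
    using uniform_simple_approximation[OF m(3,4) d(1)] by blast
  let ?w = "\<lambda>\<omega>. s \<omega> * u \<omega>"
  have sA: "cmod (s \<omega>) \<le> A + 1" for \<omega>
    using norm_triangle_sub[of "s \<omega>" "\<phi> \<omega>"] A[of \<omega>] s(2)[of \<omega>] d(2) by linarith
  have w: "simple_function borel ?w" using s(1) u(1) by (intro simple_function_mult)
  note uL = T_L2[OF u(1) g] and shL = T_L2[OF s(1) hL] and suL = T_L2[OF s(1) T_L2[OF u(1) g]]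
  have "cmod (?w \<omega> - \<phi> \<omega> * \<psi> \<omega>) \<le> \<epsilon>" for \<omega>
  proof -
    have "?w \<omega> - \<phi> \<omega> * \<psi> \<omega> = s \<omega> * (u \<omega> - \<psi> \<omega>) + (s \<omega> - \<phi> \<omega>) * \<psi> \<omega>"
      by (simp add: algebra_simps)
    also have "cmod \<dots> \<le> (A + 1) * \<delta> + \<delta> * B"
      by (rule norm_triangle_mono)
        (use s(2) u(2) sA B A0 d in \<open>auto simp: norm_mult intro!: mult_mono\<close>)
    also have "\<dots> = \<delta> * (A + 1 + B)" by (simp add: algebra_simps)
    also have "\<dots> \<le> \<delta> * C" using C1 d by (intro mult_left_mono) auto
    finally show ?thesis using dC by simp
  qed
  moreover have "L2_norm M (\<lambda>x. T ?w g x - k x) \<le> \<epsilon>"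
  proof -
    have "L2_norm M (\<lambda>x. T ?w g x - k x) = L2_norm M (\<lambda>x. T s (T u g) x - k x)"
      using T_mult[OF s(1) u(1) g] T_L2[OF w g] suL kL
      by (intro L2_norm_cong_AE L2_measurable L2_diff) (auto elim: eventually_mono)
    also have "\<dots> \<le> L2_norm M (\<lambda>x. T s (T u g) x - T s h x) + L2_norm M (\<lambda>x. T s h x - k x)"
      by (intro L2_norm_dist_triangle suL shL kL)
    also have "L2_norm M (\<lambda>x. T s (T u g) x - T s h x) = L2_norm M (T s (\<lambda>x. T u g x - h x))"
      using T_linear_right[OF s(1) uL hL] suL shL T_L2[OF s(1) L2_diff[OF uL hL]]
      by (intro L2_norm_cong_AE L2_measurable L2_diff) (auto elim: eventually_mono)
    also have "\<dots> \<le> (A + 1) * L2_norm M (\<lambda>x. T u g x - h x)"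
      by (rule T_norm_le[OF s(1) L2_diff[OF uL hL] sA])
    also have "\<dots> \<le> (A + 1) * (\<delta> * L2_norm M g)"
      using A0 by (intro mult_left_mono has_dist_le[OF h(1) u(1) g u(2)]) auto
    also have "L2_norm M (\<lambda>x. T s h x - k x) \<le> \<delta> * L2_norm M h"
      by (rule has_dist_le[OF h(2) s(1) hL s(2)])
    also have "(A + 1) * (\<delta> * L2_norm M g) + \<delta> * L2_norm M h = \<delta> * ((A + 1) * L2_norm M g + L2_norm M h)"
      by (simp add: algebra_simps)
    also have "\<dots> \<le> \<delta> * C" using C2 d by (intro mult_left_mono) auto
    finally show ?thesis using dC by simp
  qed
  ultimately show "\<exists>s. simple_function borel s \<and> (\<forall>\<omega>. cmod (s \<omega> - \<phi> \<omega> * \<psi> \<omega>) \<le> \<epsilon>) \<and>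
      L2_norm M (\<lambda>x. T s g x - k x) \<le> \<epsilon>"
    using w by blast
qed

lemma has_const:
  assumes g: "g \<in> L2 M"
  shows "has (\<lambda>\<omega>. c) g (\<lambda>x. c * g x)"
proof (rule hasI[OF L2_scale[OF g]])
  fix \<epsilon> :: real assume "0 < \<epsilon>"
  have s: "simple_function borel (\<lambda>\<omega>::real. c)" by simp
  have "range (\<lambda>\<omega>::real. c) = {c}" "(\<lambda>\<omega>::real. c) -` {c} = UNIV" by auto
  then have "T (\<lambda>\<omega>. c) g = (\<lambda>x. c * E UNIV g x)" by (simp add: pvm_simple_integral_def)
  moreover have "L2_norm M (\<lambda>x. c * E UNIV g x - c * g x) = L2_norm M (\<lambda>x. 0)"
    using E_UNIV[OF g] by (intro L2_norm_cong_AE L2_measurable L2_diff L2_scale E_L2 L2_zero g) (auto elim: eventually_mono)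
  ultimately show "\<exists>s. simple_function borel s \<and> (\<forall>\<omega>. cmod (s \<omega> - c) \<le> \<epsilon>) \<and>
      L2_norm M (\<lambda>x. T s g x - c * g x) \<le> \<epsilon>"
    using s \<open>0 < \<epsilon>\<close> by (intro exI[of _ "\<lambda>\<omega>. c"]) auto
qed

lemma has_indicator:
  assumes B [measurable]: "B \<in> sets borel" and g: "g \<in> L2 M"
  shows "has (indicator B) g (E B g)"
proof (rule hasI[OF E_L2[OF B g]])
  fix \<epsilon> :: real assume "0 < \<epsilon>"
  have s: "simple_function borel (indicator B :: real \<Rightarrow> complex)" by simp
  have "AE x in M. T (indicator B) g x = E B g x"
    using E_empty[OF g]
  proof eventually_elim
    fix x assume e: "E {} g x = 0"
    have vim: "(indicator B :: real \<Rightarrow> complex) -` {1} = B" by (auto simp: indicator_def split: if_splits)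
    have fin: "finite (range (indicator B :: real \<Rightarrow> complex))" by (rule simple_finite_range[OF s])
    \<comment> \<open>The value 0 contributes nothing, and the value 1 is absent from the range when
      \<open>B\<close> is empty; intersecting the range with \<open>{1}\<close> covers both
      situations.\<close>
    have "T (indicator B) g x = (\<Sum>c\<in>range (indicator B) \<inter> {1}. c * E (indicator B -` {c}) g x)"
      unfolding pvm_simple_integral_def
      by (rule sum.mono_neutral_right[OF fin]) (auto simp: indicator_def split: if_splits)
    also have "\<dots> = E B g x"
    proof (cases "B = {}")
      case True
      then show ?thesis using e by (auto simp: indicator_def)
    next
      case False
      then have "range (indicator B) \<inter> {1 :: complex} = {1}" by (auto simp: indicator_def image_iff)
      then show ?thesis by (simp add: vim)
    qed
    finally show "T (indicator B) g x = E B g x" .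
  qed
  then have "L2_norm M (\<lambda>x. T (indicator B) g x - E B g x) = L2_norm M (\<lambda>x. 0)"
    by (intro L2_norm_cong_AE L2_measurable L2_diff L2_zero T_L2 E_L2 g s B) (auto elim: eventually_mono)
  then show "\<exists>s. simple_function borel s \<and> (\<forall>\<omega>. cmod (s \<omega> - indicator B \<omega>) \<le> \<epsilon>) \<and>
      L2_norm M (\<lambda>x. T s g x - E B g x) \<le> \<epsilon>"
    using s \<open>0 < \<epsilon>\<close> by (intro exI[of _ "indicator B"]) auto
qed

text \<open>A multiplier that is small only on \<open>B\<close> is cut in two; the part off
  \<open>B\<close> is the calculus applied to \<open>E (- B) g\<close>, so its size is governed by
  the spectral mass of \<open>g\<close> outside \<open>B\<close>. This stands in for dominated
  convergence against scalar spectral measures.\<close>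

lemma has_norm_le_split:
  assumes m: "\<phi> \<in> borel_measurable borel" and B [measurable]: "B \<in> sets borel" and h: "has \<phi> g h" and g: "g \<in> L2 M"
    and "0 \<le> \<epsilon>" and e: "\<And>\<omega>. \<omega> \<in> B \<Longrightarrow> cmod (\<phi> \<omega>) \<le> \<epsilon>" and K: "\<And>\<omega>. cmod (\<phi> \<omega>) \<le> K"
  shows "L2_norm M h \<le> \<epsilon> * L2_norm M g + K * L2_norm M (E (- B) g)"
proof -
  note [measurable] = m
  have K0: "0 \<le> K" using K[of 0] norm_ge_zero order_trans by blast
  have bK: "bounded (range \<psi>)" if "\<And>\<omega>. cmod (\<psi> \<omega>) \<le> cmod (\<phi> \<omega>)" for \<psi> :: "real \<Rightarrow> complex"
    unfolding bounded_iff using order_trans[OF that K] by blast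
  let ?p = "\<lambda>\<omega>. \<phi> \<omega> * indicator B \<omega>" and ?q = "\<lambda>\<omega>. \<phi> \<omega> * indicator (- B) \<omega>"
  have p: "has ?p g (\<Phi> ?p g)" by (intro has_\<Phi> g bK) (auto split: split_indicator)
  have iB: "has (indicator (- B)) g (E (- B) g)" by (rule has_indicator[OF _ g]) simp
  have EL: "E (- B) g \<in> L2 M" using E_L2[OF _ g, of "- B"] by simp
  have ph: "has \<phi> (E (- B) g) (\<Phi> \<phi> (E (- B) g))" by (intro has_\<Phi> bK m EL) auto
  have q: "has ?q g (\<Phi> \<phi> (E (- B) g))"
  proof (rule has_mult[OF _ _ _ _ iB ph g])
    show "bounded (range (indicator (- B) :: real \<Rightarrow> complex))"
      by (auto simp: bounded_iff split: split_indicator intro!: exI[of _ 1])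
  qed (auto intro!: bK)
  have "has (\<lambda>\<omega>. 1 * ?p \<omega> + 1 * ?q \<omega>) g (\<lambda>x. 1 * \<Phi> ?p g x + 1 * \<Phi> \<phi> (E (- B) g) x)"
    by (rule has_linear[OF _ _ _ _ p q g]) (auto intro!: bK split: split_indicator)
  moreover have "(\<lambda>\<omega>. 1 * ?p \<omega> + 1 * ?q \<omega>) = \<phi>" by (auto split: split_indicator)
  ultimately have "L2_norm M (\<lambda>x. h x - (\<Phi> ?p g x + \<Phi> \<phi> (E (- B) g) x)) = 0"
    using has_unique[OF m bK h _ g] by simp
  then have "L2_norm M h \<le> L2_norm M (\<lambda>x. \<Phi> ?p g x + \<Phi> \<phi> (E (- B) g) x)"
    using L2_norm_triangle[OF L2_diff[OF has_L2[OF h] L2_add[OF has_L2[OF p] has_L2[OF ph]]] L2_add[OF has_L2[OF p] has_L2[OF ph]]]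
    by simp
  also have "\<dots> \<le> L2_norm M (\<Phi> ?p g) + L2_norm M (\<Phi> \<phi> (E (- B) g))"
    by (rule L2_norm_triangle[OF has_L2[OF p] has_L2[OF ph]])
  also have "L2_norm M (\<Phi> ?p g) \<le> \<epsilon> * L2_norm M g"
    by (rule has_norm_le[OF _ p g]) (use e \<open>0 \<le> \<epsilon>\<close> in \<open>auto split: split_indicator\<close>)
  also have "L2_norm M (\<Phi> \<phi> (E (- B) g)) \<le> K * L2_norm M (E (- B) g)"
    by (rule has_norm_le[OF m ph EL K])
  finally show ?thesis by simp
qed

text \<open>The shells \<open>i \<le> \<bar>\<omega>\<bar> < i + 1\<close> partition the line, and
  the remainder in countable additivity after \<open>m\<close> shells is the projection of the
  complement of the first \<open>m\<close>.\<close>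

lemma E_tail:
  assumes g: "g \<in> L2 M"
  shows "(\<lambda>m. L2_norm M (E (- {\<omega>. \<bar>\<omega>\<bar> < real m}) g)) \<longlonglongrightarrow> 0"
proof -
  define B where "B i = {\<omega>::real. real i \<le> \<bar>\<omega>\<bar> \<and> \<bar>\<omega>\<bar> < real (Suc i)}" for i
  have [measurable]: "B i \<in> sets borel" for i unfolding B_def by measurable
  have ix: "i = nat \<lfloor>\<bar>\<omega>\<bar>\<rfloor>" if "\<omega> \<in> B i" for i \<omega>
  proof -
    have "\<lfloor>\<bar>\<omega>\<bar>\<rfloor> = int i" using that by (intro floor_unique) (auto simp: B_def)
    then show ?thesis by simp
  qed
  then have disj: "disjoint_family B" unfolding disjoint_family_on_def by blast
  have U: "(\<Union>i. B i) = UNIV"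
  proof -
    have "\<omega> \<in> B (nat \<lfloor>\<bar>\<omega>\<bar>\<rfloor>)" for \<omega>
      unfolding B_def mem_Collect_eq by (simp del: of_nat_Suc) linarith
    then show ?thesis by blast
  qed
  have Um: "(\<Union>i<m. B i) = {\<omega>. \<bar>\<omega>\<bar> < real m}" for m
  proof -
    have "\<omega> \<in> B (nat \<lfloor>\<bar>\<omega>\<bar>\<rfloor>) \<and> nat \<lfloor>\<bar>\<omega>\<bar>\<rfloor> < m" if "\<bar>\<omega>\<bar> < real m" for \<omega>
      using that by (simp add: B_def) linarith
    moreover have "\<bar>\<omega>\<bar> < real m" if "\<omega> \<in> B i" "i < m" for i \<omega>
    proof -
      have "real (Suc i) \<le> real m" using that by linarith
      then show ?thesis using that by (simp add: B_def)
    qed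
    ultimately show ?thesis by blast
  qed
  have "L2_norm M (\<lambda>x. E (\<Union>i. B i) g x - (\<Sum>i<m. E (B i) g x)) = L2_norm M (E (- {\<omega>. \<bar>\<omega>\<bar> < real m}) g)" for m
  proof (rule L2_norm_cong_AE)
    let ?A = "{\<omega>. \<bar>\<omega>\<bar> < real m}"
    have A: "?A \<in> sets borel" by measurable
    have "AE x in M. E (\<Union>i<m. B i) g x = (\<Sum>i<m. E (B i) g x)"
      by (intro E_finite_UN g disjoint_family_on_mono[OF _ disj]) auto
    moreover have "AE x in M. E (?A \<union> - ?A) g x = E ?A g x + E (- ?A) g x"
      using A by (intro E_Un g) auto
    ultimately show "AE x in M. E (\<Union>i. B i) g x - (\<Sum>i<m. E (B i) g x) = E (- ?A) g x"
      unfolding U Um by eventually_elim simp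
    show "E (- ?A) g \<in> borel_measurable M" using A by (intro L2_measurable E_L2 g) auto
  qed (intro L2_measurable L2_diff L2_sum E_L2 g; simp add: U)
  then show ?thesis using E_sums[OF _ disj g] by simp
qed

end

section \<open>The resolvent as a Laplace transform of the exponentials\<close>

text \<open>Exponential weight cut off at 0, so that Laplace transforms at the point 1 become
  integrals over the whole line. On its support the number of time steps, rounded up, is
  positive.\<close>

definition expw :: "real \<Rightarrow> real" where
  "expw t = indicator {0<..} t * exp (- t)"

definition resolvent :: "real \<Rightarrow> complex" where
  "resolvent \<omega> = 1 / (1 - \<i> * of_real \<omega>)"

text \<open>Laplace transform of the exponential sampled at times rounded up to multiples of
  \<open>h\<close>, which is the rounding of the discrete evolution.\<close>

definition step_kernel :: "real \<Rightarrow> real \<Rightarrow> complex" where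
  "step_kernel h \<omega> = (LINT t|lborel. of_real (expw t) * exp (\<i> * of_real (\<omega> * (h * of_int \<lceil>t / h\<rceil>))))"

lemma expw_measurable [measurable]: "expw \<in> borel_measurable borel"
  unfolding expw_def by measurable

lemma expw_nonneg [simp]: "0 \<le> expw t"
  by (simp add: expw_def)

lemma expw_le_1 [simp]: "expw t \<le> 1"
  by (auto simp: expw_def indicator_def)

lemma integrable_exp_minus_atLeast:
  "has_bochner_integral lborel (\<lambda>t. indicator {a..} t * exp (- t)) (exp (- a :: real))"
proof -
  have "(\<integral>\<^sup>+t. ennreal (exp (- t)) * indicator {a..} t \<partial>lborel) = 0 - (- exp (- a))"
  proof (rule nn_integral_FTC_atLeast)
    show "((\<lambda>t::real. - exp (- t)) \<longlongrightarrow> 0) at_top"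
      by (intro tendsto_minus_cancel_left[THEN iffD1] filterlim_compose[OF exp_at_bot] filterlim_uminus_at_bot_at_top | simp)+
  qed (auto intro!: derivative_eq_intros)
  then have "(\<integral>\<^sup>+t. ennreal (indicator {a..} t * exp (- t)) \<partial>lborel) = ennreal (exp (- a))"
    by (subst nn_integral_cong[where v="\<lambda>t. ennreal (exp (- t)) * indicator {a..} t"]) (auto split: split_indicator)
  then show ?thesis by (intro has_bochner_integral_nn_integral) auto
qed

lemma expw_integrable: "integrable lborel expw"
proof (rule Bochner_Integration.integrable_bound)
  show "integrable lborel (\<lambda>t::real. indicator {0..} t * exp (- t))"
    using integrable_exp_minus_atLeast[of 0] by (rule integrable.intros)
qed (auto simp: expw_def split: split_indicator)

lemma expw_mult_integrable:
  assumes [measurable]: "f \<in> borel_measurable lborel" and K: "\<And>t. 0 < t \<Longrightarrow> cmod (f t) \<le> K"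
  shows "integrable lborel (\<lambda>t. of_real (expw t) * f t)"
proof (rule Bochner_Integration.integrable_bound)
  show "integrable lborel (\<lambda>t. K * expw t)" using expw_integrable by simp
  show "AE t in lborel. norm (complex_of_real (expw t) * f t) \<le> norm (K * expw t)"
  proof (intro AE_I2)
    fix t :: real
    have "0 < t \<Longrightarrow> \<bar>exp (- t)\<bar> * cmod (f t) \<le> \<bar>K\<bar> * exp (- t)"
      using K[of t] by (simp add: mult.commute)
    then show "norm (complex_of_real (expw t) * f t) \<le> norm (K * expw t)"
      by (auto simp: norm_mult abs_mult expw_def split: split_indicator)
  qed
qed simp

lemma one_minus_ii_nonzero: "1 - \<i> * complex_of_real \<omega> \<noteq> 0"
  by (auto simp: complex_eq_iff)

text \<open>The antiderivative is \<open>exp (t a) / a\<close> with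
  \<open>a = \<i> \<omega> - 1\<close>; the real part \<open>- 1\<close> makes it vanish at infinity
  for every frequency.\<close>

lemma resolvent_integral:
  "(LINT t|lborel. of_real (expw t) * exp (\<i> * of_real (\<omega> * t))) = resolvent \<omega>"
proof -
  define a where "a = \<i> * complex_of_real \<omega> - 1"
  have a0: "a \<noteq> 0" using one_minus_ii_nonzero[of \<omega>] by (auto simp: a_def)
  define F where "F t = exp (of_real t * a) / a" for t :: real
  have eq: "complex_of_real (expw t) * exp (\<i> * of_real (\<omega> * t)) = indicator {0<..} t *\<^sub>R exp (of_real t * a)" for t
  proof -
    have "exp (of_real t * a) = of_real (exp (- t)) * exp (\<i> * of_real (\<omega> * t))"
      unfolding a_def exp_of_real[symmetric] exp_add[symmetric] by (simp add: algebra_simps)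
    then show ?thesis by (auto simp: expw_def split: split_indicator)
  qed
  have int: "set_integrable lborel {0<..} (\<lambda>t. exp (of_real t * a))"
    unfolding set_integrable_def eq[symmetric] by (rule expw_mult_integrable[of _ 1]) auto
  have "(LBINT t=0..\<infinity>. exp (of_real t * a)) = 0 - 1 / a"
  proof (rule interval_integral_FTC_integrable)
    show "set_integrable lborel (einterval 0 \<infinity>) (\<lambda>t. exp (of_real t * a))"
      using int by (simp add: zero_ereal_def)
    show "(F has_vector_derivative exp (of_real t * a)) (at t)" for t
      unfolding F_def using a0
      by (intro has_vector_derivative_real_field[where f="\<lambda>z. exp (z * a) / a"])
        (auto intro!: derivative_eq_intros)
    have "(F \<longlongrightarrow> F 0) (at_right 0)"
      unfolding F_def using a0 by (intro tendsto_intros) auto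
    then show "((F \<circ> real_of_ereal) \<longlongrightarrow> 1 / a) (at_right 0)"
      by (simp add: zero_ereal_def ereal_tendsto_simps F_def)
    have lim: "((\<lambda>t::real. exp (- t) / cmod a) \<longlongrightarrow> 0 / cmod a) at_top"
      by (intro tendsto_intros filterlim_compose[OF exp_at_bot] filterlim_uminus_at_bot_at_top) (use a0 in auto)
    have nF: "norm (F t) = exp (- t) / cmod a" for t
      unfolding F_def norm_divide norm_exp_eq_Re by (simp add: a_def)
    have "((\<lambda>t. norm (F t)) \<longlongrightarrow> 0) at_top" unfolding nF using lim by (simp only: div_0)
    then have "(F \<longlongrightarrow> 0) at_top" by (rule tendsto_norm_zero_cancel)
    then show "((F \<circ> real_of_ereal) \<longlongrightarrow> 0) (at_left \<infinity>)"
      by (simp add: ereal_tendsto_simps)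
  qed (auto intro!: continuous_intros)
  then have "(LINT t|lborel. indicator {0<..} t *\<^sub>R exp (of_real t * a)) = - (1 / a)"
    unfolding interval_lebesgue_integral_0_infty set_lebesgue_integral_def by simp
  moreover have "- (1 / a) = resolvent \<omega>"
    unfolding resolvent_def minus_divide_right by (simp add: a_def)
  ultimately show ?thesis unfolding eq by simp
qed

lemma norm_resolvent_le: "cmod (resolvent \<omega>) \<le> 1"
proof -
  have "1 \<le> cmod (1 - \<i> * complex_of_real \<omega>)"
    using complex_Re_le_cmod[of "1 - \<i> * complex_of_real \<omega>"] by simp
  then show ?thesis by (simp add: resolvent_def norm_divide divide_simps)
qed

lemma resolvent_lipschitz: "cmod (resolvent a - resolvent b) \<le> \<bar>a - b\<bar>"
proof -
  have "resolvent a - resolvent b = \<i> * of_real (a - b) * resolvent a * resolvent b"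
    using one_minus_ii_nonzero[of a] one_minus_ii_nonzero[of b]
    by (simp add: resolvent_def field_simps)
  then have "cmod (resolvent a - resolvent b) = \<bar>a - b\<bar> * (cmod (resolvent a) * cmod (resolvent b))"
    by (simp only: norm_mult norm_of_real norm_ii mult_1 mult.assoc)
  also have "\<dots> \<le> \<bar>a - b\<bar> * (1 * 1)"
    by (intro mult_left_mono mult_mono norm_resolvent_le) auto
  finally show ?thesis by simp
qed

lemma resolvent_measurable [measurable]: "resolvent \<in> borel_measurable borel"
  unfolding resolvent_def by measurable

lemma resolvent_bounded: "bounded (range resolvent)"
  using norm_resolvent_le by (auto simp: bounded_iff)

section \<open>Comparison of the stepped Laplace transform with the resolvent\<close>

lemma norm_exp_ii_diff_le: "cmod (exp (\<i> * of_real a) - exp (\<i> * of_real b)) \<le> \<bar>a - b\<bar>"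
proof -
  have "exp (\<i> * of_real a) - exp (\<i> * of_real b) = exp (\<i> * of_real b) * (exp (\<i> * of_real (a - b)) - 1)"
    unfolding right_diff_distrib exp_add[symmetric] by (simp add: algebra_simps)
  then have "cmod (exp (\<i> * of_real a) - exp (\<i> * of_real b)) = 2 * \<bar>sin ((a - b) / 2)\<bar>"
    by (simp only: norm_mult norm_exp_i_times mult_1 dist_exp_i_1)
  also have "\<dots> \<le> 2 * \<bar>(a - b) / 2\<bar>" by (intro mult_left_mono abs_sin_x_le_abs_x) auto
  finally show ?thesis by simp
qed

text \<open>Shifting the variable by one step \<open>h\<close> reproduces the integral up to a factor.\<close>

lemma step_kernel_equation:
  fixes h \<omega> :: real
  assumes h: "0 < h"
  defines "z \<equiv> of_real h - \<i> * of_real (\<omega> * h)"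
  shows "step_kernel h \<omega> * (1 - exp (- z)) = exp (\<i> * of_real (\<omega> * h)) * (1 - of_real (exp (- h)))"
proof -
  define e where "e t = exp (\<i> * of_real (\<omega> * (h * of_int \<lceil>t / h\<rceil>)))" for t :: real
  define f where "f t = complex_of_real (expw t) * e t" for t
  \<comment> \<open>The weight shifted by \<open>h\<close> starts at \<open>- h\<close> instead of
    0; \<open>g\<close> is \<open>exp (- t)\<close> on the half-open interval gained by the shift,
    with total mass \<open>exp h - 1\<close>.\<close>
  define g where "g t = complex_of_real (indicator {-h..} t * exp (- t) - indicator {0..} t * exp (- t))" for t :: real
  have [measurable]: "e \<in> borel_measurable borel" unfolding e_def by measurable
  have f: "integrable lborel f" unfolding f_def
    by (rule expw_mult_integrable[of _ 1]) (auto simp: e_def)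
  have g: "has_bochner_integral lborel g (of_real (exp h - 1))"
    unfolding g_def
    using has_bochner_integral_diff[OF integrable_exp_minus_atLeast[of "-h"] integrable_exp_minus_atLeast[of 0]]
    by (intro has_bochner_integral_of_real) simp
  have K: "step_kernel h \<omega> = integral\<^sup>L lborel f" by (simp add: step_kernel_def f_def[abs_def] e_def)
  have "integral\<^sup>L lborel f = (LINT t|lborel. f (h + 1 * t))"
    using lborel_integral_real_affine[of 1 f h] by simp
  also have "\<dots> = (LINT t|lborel. exp (- z) * (f t + g t))"
  proof (rule integral_cong_AE)
    \<comment> \<open>The two breakpoints are excluded because open and closed half-lines differ
      there.\<close>
    have "AE t in lborel. t \<noteq> - h" "AE t in lborel. t \<noteq> 0" by (rule AE_lborel_singleton)+
    then show "AE t in lborel. f (h + 1 * t) = exp (- z) * (f t + g t)"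
    proof eventually_elim
      fix t assume t: "t \<noteq> - h" "t \<noteq> 0"
      have c: "\<lceil>(h + t) / h\<rceil> = \<lceil>t / h\<rceil> + 1"
        using h by (simp add: add_divide_distrib ceiling_add_one add.commute[of 1])
      have eh: "e (h + t) = exp (\<i> * of_real (\<omega> * h)) * e t"
        unfolding e_def c exp_add[symmetric] by (simp add: algebra_simps)
      have ez: "exp (- z) = of_real (exp (- h)) * exp (\<i> * of_real (\<omega> * h))"
        unfolding z_def exp_of_real[symmetric] exp_add[symmetric] by simp
      \<comment> \<open>During the step just before time 0 the rounded time is 0, so the phase is 1
        and the correction \<open>g\<close> carries no oscillation.\<close>
      have ce: "e t = 1" if "-h < t" "t < 0"
      proof -
        have "\<lceil>t / h\<rceil> = 0" using that h by (intro ceiling_unique) (auto simp: field_simps)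
        then show ?thesis by (simp add: e_def)
      qed
      have "f (h + t) = of_real (expw (h + t)) * (exp (\<i> * of_real (\<omega> * h)) * e t)"
        by (simp add: f_def eh)
      also have "\<dots> = exp (- z) * (f t + g t)"
      proof -
        have ex: "exp (- (h + t)) = exp (- h) * exp (- t)" by (simp flip: exp_add)
        consider "t < -h" | "-h < t" "t < 0" | "0 < t" using t by linarith
        then show ?thesis
        proof cases
          case 2
          then show ?thesis unfolding expw_def ex f_def g_def ez using ce h by simp
        qed (unfold expw_def ex f_def g_def ez, use h in simp_all)
      qed
      finally show "f (h + 1 * t) = exp (- z) * (f t + g t)" by simp
    qed
  qed (auto simp: f_def g_def)
  also have "\<dots> = exp (- z) * (integral\<^sup>L lborel f + of_real (exp h - 1))"
    using g f by (simp add: has_bochner_integral_iff)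
  finally have "step_kernel h \<omega> * (1 - exp (- z)) = exp (- z) * of_real (exp h - 1)"
    unfolding K by (simp add: algebra_simps)
  also have "\<dots> = exp (\<i> * of_real (\<omega> * h)) * (1 - of_real (exp (- h)))"
    by (simp add: z_def exp_diff exp_minus exp_of_real[symmetric] field_simps)
  finally show ?thesis .
qed

text \<open>The cubic Taylor remainder and \<open>\<bar>u\<bar> \<le> 2\<close>, from
  \<open>pi < 4\<close>, give \<open>\<bar>sin u - u\<bar> \<le> 2 * \<bar>u\<bar> / 3\<close>. The
  best constant is \<open>2 / pi\<close>; a third comes out of the Taylor bound alone.\<close>

lemma abs_sin_ge_third:
  fixes u :: real
  assumes "\<bar>u\<bar> \<le> pi / 2"
  shows "\<bar>u\<bar> / 3 \<le> \<bar>sin u\<bar>"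
proof -
  have "\<bar>sin u - u\<bar> \<le> \<bar>u\<bar> ^ 3 / 6"
    using Maclaurin_sin_bound[of u 3]
    by (simp add: sin_coeff_def eval_nat_numeral lessThan_Suc fact_numeral field_simps)
  moreover have "\<bar>u\<bar> ^ 3 \<le> \<bar>u\<bar> * 4"
  proof -
    have "\<bar>u\<bar> \<le> 2" using assms pi_less_4 by linarith
    then have "\<bar>u\<bar> * \<bar>u\<bar> \<le> 2 * 2" by (intro mult_mono) auto
    then have "\<bar>u\<bar> * (\<bar>u\<bar> * \<bar>u\<bar>) \<le> \<bar>u\<bar> * 4" by (intro mult_left_mono) auto
    then show ?thesis by (simp add: power3_eq_cube mult.assoc)
  qed
  ultimately show ?thesis by (auto simp: abs_if split: if_splits)
qed

text \<open>With \<open>c = exp (- h)\<close>, the squared modulus of \<open>1 - exp (- z)\<close>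
  is \<open>(1 - c)\<^sup>2 + 4 * c * (sin (y / 2))\<^sup>2\<close>. The restriction of
  \<open>y\<close> to one band is essential: at \<open>y = 2 * pi\<close> this falls back to
  \<open>(1 - c)\<^sup>2\<close>, while \<open>cmod z\<close> does not shrink.\<close>

lemma norm_one_minus_exp_ge:
  fixes h y :: real
  assumes h: "0 < h" "h \<le> 1" and y: "\<bar>y\<bar> \<le> pi"
  defines "z \<equiv> complex_of_real h - \<i> * of_real y"
  shows "cmod z / 6 \<le> cmod (1 - exp (- z))"
proof (rule power2_le_imp_le)
  define c where "c = exp (- h)"
  have c3: "1 / 3 \<le> c"
  proof -
    have "exp h \<le> 3" using exp_le h by (meson exp_le_cancel_iff order_trans)
    then show ?thesis by (simp add: c_def exp_minus divide_simps)
  qed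
  have ch: "h / 2 \<le> 1 - c"
  proof -
    have "c \<le> 1 / (1 + h)" using exp_ge_add_one_self[of h] h
      by (simp add: c_def exp_minus inverse_eq_divide frac_le)
    moreover have "h / 2 \<le> 1 - 1 / (1 + h)" using h by (simp add: field_simps)
    ultimately show ?thesis by linarith
  qed
  have "\<bar>y / 2\<bar> / 3 \<le> \<bar>sin (y / 2)\<bar>" using y by (intro abs_sin_ge_third) auto
  then have "(\<bar>y / 2\<bar> / 3)\<^sup>2 \<le> \<bar>sin (y / 2)\<bar>\<^sup>2" by (intro power_mono) auto
  then have sy: "y\<^sup>2 / 36 \<le> (sin (y / 2))\<^sup>2" by (simp add: power2_eq_square)
  have cosy: "cos y = 1 - 2 * (sin (y / 2))\<^sup>2" using cos_double_sin[of "y / 2"] by simp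
  have "exp (- z) = of_real c * exp (\<i> * of_real y)"
    unfolding c_def z_def exp_of_real[symmetric] exp_add[symmetric] by simp
  then have ez: "exp (- z) = of_real c * (of_real (cos y) + \<i> * of_real (sin y))"
    by (simp add: exp_Euler cos_of_real sin_of_real)
  have "(cmod (1 - exp (- z)))\<^sup>2 = (1 - c * cos y)\<^sup>2 + (c * sin y)\<^sup>2"
    unfolding ez cmod_power2 by simp
  also have "\<dots> = 1 - 2 * c * cos y + c\<^sup>2 * ((sin y)\<^sup>2 + (cos y)\<^sup>2)"
    by algebra
  also have "\<dots> = (1 - c)\<^sup>2 + 2 * c * (1 - cos y)"
    by (simp only: sin_cos_squared_add) (simp add: power2_eq_square algebra_simps)
  also have "\<dots> = (1 - c)\<^sup>2 + 4 * (c * (sin (y / 2))\<^sup>2)" unfolding cosy by simp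
  finally have eq: "(cmod (1 - exp (- z)))\<^sup>2 = (1 - c)\<^sup>2 + 4 * (c * (sin (y / 2))\<^sup>2)" .
  have "(h / 2)\<^sup>2 \<le> (1 - c)\<^sup>2" using ch h by (intro power_mono) auto
  then have f1: "h\<^sup>2 \<le> 4 * (1 - c)\<^sup>2" by (simp add: power_divide)
  have f2: "1 / 3 * (y\<^sup>2 / 36) \<le> c * (sin (y / 2))\<^sup>2"
    using c3 sy by (intro mult_mono) auto
  have f3: "(cmod z / 6)\<^sup>2 = (h\<^sup>2 + y\<^sup>2) / 36"
    unfolding power_divide cmod_power2 z_def by simp
  \<comment> \<open>Collects the constants: \<open>108 = 3 * 36\<close> comes from
    \<open>c \<ge> 1 / 3\<close> and the 36 in \<open>sy\<close>; then \<open>4 \<le> 36\<close> and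
    \<open>108 \<le> 4 * 36\<close> are used.\<close>
  have "(a + b) / 36 \<le> A + 4 * X" if "a \<le> 4 * A" "1 / 3 * (b / 36) \<le> X" "0 \<le> a" "0 \<le> b"
    for a b A X :: real
  proof -
    have "b \<le> 108 * X" using that(2) by simp
    then have "a + b \<le> 36 * (A + 4 * X)" using that(1,3,4) by (simp add: distrib_left)
    then show ?thesis by simp
  qed
  from this[OF f1 f2 zero_le_power2 zero_le_power2]
  show "(cmod z / 6)\<^sup>2 \<le> (cmod (1 - exp (- z)))\<^sup>2" unfolding eq f3 .
qed simp

text \<open>Both functions are quotients, \<open>w / D\<close> and \<open>h / z\<close>. After
  cross-multiplication only second-order errors remain: \<open>3 * (cmod z)\<^sup>2\<close> for
  \<open>D\<close> against \<open>z\<close>, and \<open>2 * (h * cmod z)\<close> for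
  \<open>w\<close> against \<open>h\<close>. Their total \<open>5 * h * (cmod z)\<^sup>2\<close>,
  divided by \<open>cmod D * cmod z\<close>, which is at least \<open>(cmod z)\<^sup>2 / 6\<close>,
  gives the constant 30.\<close>

lemma step_kernel_resolvent:
  assumes h: "0 < h" "h \<le> 1" and y: "\<bar>\<omega> * h\<bar> \<le> pi"
  shows "cmod (step_kernel h \<omega> - resolvent \<omega>) \<le> 30 * h"
proof -
  define z where "z = of_real h - \<i> * of_real (\<omega> * h)"
  define D where "D = 1 - exp (- z)"
  define w where "w = exp (\<i> * of_real (\<omega> * h)) * (1 - of_real (exp (- h)))"
  have zh: "h \<le> cmod z" "\<bar>\<omega> * h\<bar> \<le> cmod z"
    using abs_Re_le_cmod[of z] abs_Im_le_cmod[of z] h by (auto simp: z_def)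
  then have z0: "0 < cmod z" using h by linarith
  have D: "cmod z / 6 \<le> cmod D"
    unfolding D_def z_def by (rule norm_one_minus_exp_ge[OF h y])
  then have D0: "D \<noteq> 0" using z0 by auto
  have K: "step_kernel h \<omega> * D = w"
    unfolding D_def w_def z_def by (rule step_kernel_equation[OF h(1)])
  have R: "resolvent \<omega> * z = of_real h"
    using one_minus_ii_nonzero[of \<omega>] by (simp add: resolvent_def z_def field_simps)
  have "(step_kernel h \<omega> - resolvent \<omega>) * (D * z) = w * z - of_real h * D"
    using K R by (simp add: algebra_simps)
  also have "\<dots> = of_real h * (z - D) + z * (w - of_real h)" by (simp add: algebra_simps)
  finally have eq: "(step_kernel h \<omega> - resolvent \<omega>) * (D * z) = of_real h * (z - D) + z * (w - of_real h)" .
  \<comment> \<open>Second-order Taylor remainder of \<open>exp\<close>; the factor 3 bounds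
    \<open>exp h\<close> for \<open>h \<le> 1\<close>.\<close>
  have zD: "cmod (z - D) \<le> 3 * (cmod z)\<^sup>2"
  proof -
    have Rez: "Re z = h" by (simp add: z_def)
    have "exp \<bar>h\<bar> \<le> 3" using exp_le h by (metis abs_of_pos exp_le_cancel_iff order_trans)
    then have "exp \<bar>h\<bar> * (cmod z)\<^sup>2 \<le> 3 * (cmod z)\<^sup>2" by (intro mult_right_mono) auto
    moreover have "cmod (exp (- z) - (1 - z)) \<le> exp \<bar>h\<bar> * (cmod z)\<^sup>2"
      using Taylor_exp[of "-z" 1] by (simp add: Rez power2_eq_square)
    moreover have "z - D = exp (- z) - (1 - z)" by (simp add: D_def)
    ultimately show ?thesis by (simp only:)
  qed
  have wh: "cmod (w - of_real h) \<le> 2 * (h * cmod z)"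
  proof -
    define u where "u = exp (\<i> * of_real (\<omega> * h))"
    have c1: "1 - exp (- h) \<le> h" using exp_ge_add_one_self[of "-h"] by simp
    have c2: "h - h\<^sup>2 \<le> 1 - exp (- h)"
    proof -
      have "exp (- h) \<le> 1 / (1 + h)" using exp_ge_add_one_self[of h] h
        by (simp add: exp_minus inverse_eq_divide frac_le)
      moreover have "h - h\<^sup>2 \<le> 1 - 1 / (1 + h)" using h by (simp add: field_simps power2_eq_square)
      ultimately show ?thesis by linarith
    qed
    have "w - of_real h = (u - 1) * of_real h - u * of_real (h - (1 - exp (- h)))"
      by (simp add: w_def u_def algebra_simps)
    also have "cmod \<dots> \<le> cmod ((u - 1) * of_real h) + cmod (u * of_real (h - (1 - exp (- h))))"
      by (rule norm_triangle_ineq4)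
    also have "\<dots> = cmod (u - 1) * h + \<bar>h - (1 - exp (- h))\<bar>"
      using h by (simp only: norm_mult norm_of_real) (simp add: u_def)
    also have "cmod (u - 1) \<le> \<bar>\<omega> * h\<bar>"
      using norm_exp_ii_diff_le[of "\<omega> * h" 0] by (simp add: u_def)
    also have "\<bar>h - (1 - exp (- h))\<bar> \<le> h * h" using c1 c2 by (simp add: power2_eq_square)
    finally have "cmod (w - of_real h) \<le> \<bar>\<omega> * h\<bar> * h + h * h" using h by (simp add: mult_right_mono)
    also have "\<dots> \<le> cmod z * h + h * cmod z"
      using zh h by (intro add_mono mult_left_mono mult_right_mono) auto
    finally show ?thesis by (simp add: mult.commute)
  qed
  have "cmod (step_kernel h \<omega> - resolvent \<omega>) * ((cmod z / 6) * cmod z) \<le> cmod (step_kernel h \<omega> - resolvent \<omega>) * (cmod D * cmod z)"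
    using D by (intro mult_left_mono mult_right_mono) auto
  also have "\<dots> = cmod (of_real h * (z - D) + z * (w - of_real h))"
    unfolding eq[symmetric] by (simp add: norm_mult)
  also have "\<dots> \<le> h * (3 * (cmod z)\<^sup>2) + cmod z * (2 * (h * cmod z))"
    by (rule norm_triangle_mono) (use zD wh h in \<open>auto simp: norm_mult intro!: mult_left_mono\<close>)
  finally have "cmod (step_kernel h \<omega> - resolvent \<omega>) * (cmod z)\<^sup>2 \<le> (30 * h) * (cmod z)\<^sup>2"
    by (simp add: power2_eq_square algebra_simps)
  then show ?thesis using z0 by (simp add: mult_le_cancel_right)
qed

section \<open>The resolvent as a time average of the unitary group\<close>

lemma simple_real_approximation:
  obtains \<sigma> :: "nat \<Rightarrow> real \<Rightarrow> real" where "\<And>m. simple_function borel (\<sigma> m)"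
    "\<And>m \<omega>. \<bar>\<omega>\<bar> < real m \<Longrightarrow> \<bar>\<omega> - \<sigma> m \<omega>\<bar> \<le> inverse (real (Suc m))"
proof -
  have "\<exists>\<sigma>. simple_function borel \<sigma> \<and> (\<forall>\<omega>. \<bar>\<omega>\<bar> < real m \<longrightarrow> \<bar>\<omega> - \<sigma> \<omega>\<bar> \<le> inverse (real (Suc m)))" for m
  proof -
    \<comment> \<open>The identity is unbounded, so it is truncated at \<open>m\<close> before
      rounding; frequencies beyond \<open>m\<close> are left to \<open>E_tail\<close>.\<close>
    define \<phi> where "\<phi> \<omega> = complex_of_real (if \<bar>\<omega>\<bar> < real m then \<omega> else 0)" for \<omega>
    have "\<phi> \<in> borel_measurable borel" unfolding \<phi>_def by measurable
    moreover have "bounded (range \<phi>)"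
      unfolding bounded_iff by (rule exI[of _ "real m"]) (auto simp: \<phi>_def)
    ultimately obtain s where s: "simple_function borel s" "\<And>\<omega>. cmod (s \<omega> - \<phi> \<omega>) \<le> inverse (real (Suc m))"
      using uniform_simple_approximation[of \<phi> borel "inverse (real (Suc m))"] by auto
    have "\<bar>\<omega> - Re (s \<omega>)\<bar> \<le> inverse (real (Suc m))" if "\<bar>\<omega>\<bar> < real m" for \<omega>
    proof -
      have "\<bar>\<omega> - Re (s \<omega>)\<bar> = \<bar>Re (s \<omega> - \<phi> \<omega>)\<bar>" using that by (simp add: \<phi>_def abs_minus_commute)
      also have "\<dots> \<le> cmod (s \<omega> - \<phi> \<omega>)" by (rule abs_Re_le_cmod)
      finally show ?thesis using s(2)[of \<omega>] by linarith
    qed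
    moreover have "simple_function borel (\<lambda>\<omega>. Re (s \<omega>))" by (rule simple_function_compose1[OF s(1)])
    ultimately show ?thesis by blast
  qed
  then show thesis using that by metis
qed

locale pvm_group = pvm +
  fixes U :: "real \<Rightarrow> ('a \<Rightarrow> complex) \<Rightarrow> ('a \<Rightarrow> complex)"
  assumes U: "\<And>t g. g \<in> L2 M \<Longrightarrow> has_pvm_integral M E (\<lambda>\<omega>. exp (\<i> * of_real (\<omega> * t))) g (U t g)"
begin

lemma U_L2: "g \<in> L2 M \<Longrightarrow> U t g \<in> L2 M"
  using U by (rule has_L2)

lemma U_norm_le: "g \<in> L2 M \<Longrightarrow> L2_norm M (U t g) \<le> L2_norm M g"
  using has_norm_le[OF _ U[of g t], of 1] by simp

text \<open>Replacing the frequency by the simple function \<open>\<sigma> m\<close> turns both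
  sides into finite sums, for which the identity is \<open>resolvent_integral\<close> at each value.
  The limit in \<open>m\<close> is taken by dominated convergence in \<open>t\<close>. Working with
  inner products avoids integrating functions with values in \<open>L2\<close>.\<close>

lemma resolvent_inner:
  assumes k: "k \<in> L2 M" and g: "g \<in> L2 M"
  shows "integrable lborel (\<lambda>t. of_real (expw t) * L2_inner M k (U t g))"
    and "(LINT t|lborel. of_real (expw t) * L2_inner M k (U t g)) = L2_inner M k (\<Phi> resolvent g)"
proof -
  obtain \<sigma> :: "nat \<Rightarrow> real \<Rightarrow> real" where \<sigma>: "\<And>m. simple_function borel (\<sigma> m)"
    "\<And>m \<omega>. \<bar>\<omega>\<bar> < real m \<Longrightarrow> \<bar>\<omega> - \<sigma> m \<omega>\<bar> \<le> inverse (real (Suc m))"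
    using simple_real_approximation by blast
  define A where "A m h = (\<Sum>b\<in>range (\<sigma> m). h b * L2_inner M k (E (\<sigma> m -` {b}) g))" for m and h :: "real \<Rightarrow> complex"
  \<comment> \<open>Error of the discretization: where \<open>\<bar>\<omega>\<bar> < m\<close> a
    function with Lipschitz constant \<open>K\<close> changes by at most \<open>K / (m + 1)\<close>;
    elsewhere two values of modulus at most 1 differ by at most 2.\<close>
  define D where "D K m = L2_norm M k * (K * inverse (real (Suc m)) * L2_norm M g
      + 2 * L2_norm M (E (- {\<omega>. \<bar>\<omega>\<bar> < real m}) g))" for K and m :: nat
  have hs: "simple_function borel (\<lambda>\<omega>. h (\<sigma> m \<omega>))" for h :: "real \<Rightarrow> complex" and m
    by (rule simple_function_compose1[OF \<sigma>(1)])
  have EL: "E (\<sigma> m -` {b}) g \<in> L2 M" for m b by (intro E_L2 simple_preimage \<sigma> g)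
  have A: "A m h = L2_inner M k (T (\<lambda>\<omega>. h (\<sigma> m \<omega>)) g)" for m h
  proof -
    have "L2_inner M k (T (\<lambda>\<omega>. h (\<sigma> m \<omega>)) g) = L2_inner M k (\<lambda>x. \<Sum>b\<in>range (\<sigma> m). h b * E (\<sigma> m -` {b}) g x)"
      by (rule L2_inner_cong_AE[OF _ _ _ _ _ T_compose[OF \<sigma>(1) g]])
        (auto intro!: L2_measurable k T_L2 hs g L2_sum L2_scale EL)
    also have "\<dots> = A m h"
      unfolding A_def by (subst L2_inner_sum_right) (auto intro!: k L2_scale EL simp: L2_inner_scale_right)
    finally show ?thesis by simp
  qed
  have A_bound: "cmod (A m h) \<le> L2_norm M k * L2_norm M g" if "\<And>\<omega>. cmod (h \<omega>) \<le> 1" for m h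
  proof -
    have "cmod (A m h) \<le> L2_norm M k * L2_norm M (T (\<lambda>\<omega>. h (\<sigma> m \<omega>)) g)"
      unfolding A by (intro L2_Cauchy_Schwarz k T_L2 hs g)
    also have "\<dots> \<le> L2_norm M k * L2_norm M g"
      using T_norm_le[OF hs g, of h m 1] that by (intro mult_left_mono) auto
    finally show ?thesis .
  qed
  have A_dist: "cmod (A m h - L2_inner M k y) \<le> D K m"
    if [measurable]: "h \<in> borel_measurable borel" and h1: "\<And>\<omega>. cmod (h \<omega>) \<le> 1" and "0 \<le> K"
      and lip: "\<And>a b. cmod (h a - h b) \<le> K * \<bar>a - b\<bar>" and y: "has h g y" for m h K y
  proof -
    let ?s = "\<lambda>\<omega>. h (\<sigma> m \<omega>)"
    let ?B = "{\<omega>. \<bar>\<omega>\<bar> < real m}"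
    have hb: "bounded (range h)" using h1 by (auto simp: bounded_iff)
    note sb = simple_bounded_measurable[OF hs[of h m]]
    have "has (\<lambda>\<omega>. 1 * h \<omega> + (-1) * ?s \<omega>) g (\<lambda>x. 1 * y x + (-1) * T ?s g x)"
      by (intro has_linear that sb hb y g has_simple hs)
    then have hd: "has (\<lambda>\<omega>. h \<omega> - ?s \<omega>) g (\<lambda>x. y x - T ?s g x)" by simp
    have "L2_norm M (\<lambda>x. y x - T ?s g x) \<le> (K * inverse (real (Suc m))) * L2_norm M g + 2 * L2_norm M (E (- ?B) g)"
    proof (rule has_norm_le_split[OF _ _ hd g])
      show "(\<lambda>\<omega>. h \<omega> - ?s \<omega>) \<in> borel_measurable borel" using sb by measurable
      show "cmod (h \<omega> - ?s \<omega>) \<le> 2" for \<omega>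
        using norm_triangle_ineq4[of "h \<omega>" "?s \<omega>"] h1[of \<omega>] h1[of "\<sigma> m \<omega>"] by linarith
      show "cmod (h \<omega> - ?s \<omega>) \<le> K * inverse (real (Suc m))" if "\<omega> \<in> ?B" for \<omega>
        using lip[of \<omega> "\<sigma> m \<omega>"] \<sigma>(2)[of \<omega> m] that \<open>0 \<le> K\<close>
        by (auto intro: order_trans mult_left_mono)
    qed (use \<open>0 \<le> K\<close> in auto)
    then have "L2_norm M k * L2_norm M (\<lambda>x. y x - T ?s g x) \<le> D K m"
      unfolding D_def by (intro mult_left_mono) auto
    moreover have "cmod (L2_inner M k (\<lambda>x. y x - T ?s g x)) \<le> L2_norm M k * L2_norm M (\<lambda>x. y x - T ?s g x)"
      by (intro L2_Cauchy_Schwarz k L2_diff has_L2[OF y] T_L2 hs g)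
    moreover have "L2_inner M k (\<lambda>x. y x - T ?s g x) = L2_inner M k y - A m h"
      unfolding A by (intro L2_inner_diff_right k has_L2[OF y] T_L2 hs g)
    ultimately show ?thesis by (simp add: norm_minus_commute)
  qed
  have D0: "D K \<longlonglongrightarrow> 0" for K
  proof -
    have "(\<lambda>m. L2_norm M k * (K * inverse (real (Suc m)) * L2_norm M g
      + 2 * L2_norm M (E (- {\<omega>. \<bar>\<omega>\<bar> < real m}) g))) \<longlonglongrightarrow> L2_norm M k * (K * 0 * L2_norm M g + 2 * 0)"
      by (intro tendsto_intros LIMSEQ_inverse_real_of_nat E_tail g)
    then show ?thesis by (simp add: D_def[abs_def])
  qed
  have lim: "(\<lambda>m. A m h) \<longlonglongrightarrow> L2_inner M k y"
    if "h \<in> borel_measurable borel" "\<And>\<omega>. cmod (h \<omega>) \<le> 1" "0 \<le> K"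
      "\<And>a b. cmod (h a - h b) \<le> K * \<bar>a - b\<bar>" "has h g y" for h K y
  proof (rule LIM_zero_cancel, rule tendsto_norm_zero_cancel)
    show "(\<lambda>m. cmod (A m h - L2_inner M k y)) \<longlonglongrightarrow> 0"
      by (rule tendsto_sandwich[OF _ _ tendsto_const D0[of K]]) (use A_dist[OF that] in auto)
  qed
  define e where "e t = (\<lambda>\<omega>. exp (\<i> * complex_of_real (\<omega> * t)))" for t
  have e_meas: "(\<lambda>t. e t \<omega>) \<in> borel_measurable lborel" for \<omega> unfolding e_def by measurable
  have ptw: "(\<lambda>m. A m (e t)) \<longlonglongrightarrow> L2_inner M k (U t g)" for t
  proof (rule lim)
    \<comment> \<open>The Lipschitz constant grows with \<open>t\<close>, so this gives convergence
      at each time but not uniformly in time; \<open>A_bound\<close> supplies the majorant.\<close>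
    show "cmod (e t a - e t b) \<le> \<bar>t\<bar> * \<bar>a - b\<bar>" for a b
      unfolding e_def using norm_exp_ii_diff_le[of "a * t" "b * t"]
      by (simp only: left_diff_distrib[symmetric] abs_mult mult.commute)
    show "has (e t) g (U t g)" unfolding e_def by (rule U[OF g])
    show "e t \<in> borel_measurable borel" unfolding e_def by measurable
  qed (auto simp: e_def)
  let ?f = "\<lambda>m t. complex_of_real (expw t) * A m (e t)"
  have f_int: "integrable lborel (?f m)" and f_val: "integral\<^sup>L lborel (?f m) = A m resolvent" for m
  proof -
    have i: "integrable lborel (\<lambda>t. of_real (expw t) * e t b)" for b
      by (rule expw_mult_integrable[of _ 1, OF e_meas]) (simp add: e_def)
    have v: "(LINT t|lborel. of_real (expw t) * e t b) = resolvent b" for b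
      unfolding e_def by (rule resolvent_integral)
    have eq: "?f m = (\<lambda>t. \<Sum>b\<in>range (\<sigma> m). (of_real (expw t) * e t b) * L2_inner M k (E (\<sigma> m -` {b}) g))"
      by (simp add: A_def sum_distrib_left mult.assoc)
    show "integrable lborel (?f m)" unfolding eq
      by (intro Bochner_Integration.integrable_sum integrable_mult_left i)
    have "integral\<^sup>L lborel (?f m) = (\<Sum>b\<in>range (\<sigma> m). resolvent b * L2_inner M k (E (\<sigma> m -` {b}) g))"
      unfolding eq by (subst Bochner_Integration.integral_sum) (auto intro!: integrable_mult_left i simp: v)
    then show "integral\<^sup>L lborel (?f m) = A m resolvent" by (simp add: A_def)
  qed
  have f_lim: "(\<lambda>m. ?f m t) \<longlonglongrightarrow> of_real (expw t) * L2_inner M k (U t g)" for t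
    by (intro tendsto_intros ptw)
  have [measurable]: "?f m \<in> borel_measurable lborel" for m using f_int by (rule borel_measurable_integrable)
  \<comment> \<open>Measurability in \<open>t\<close> of the inner product is inherited from the
    finite sums.\<close>
  have m: "(\<lambda>t. of_real (expw t) * L2_inner M k (U t g)) \<in> borel_measurable lborel"
    by (rule borel_measurable_LIMSEQ_metric[OF _ f_lim]) measurable
  have w: "integrable lborel (\<lambda>t. expw t * (L2_norm M k * L2_norm M g))"
    using expw_integrable by simp
  have bd: "AE t in lborel. norm (?f m t) \<le> expw t * (L2_norm M k * L2_norm M g)" for m
    by (auto simp: norm_mult e_def intro!: mult_left_mono A_bound)
  show "integrable lborel (\<lambda>t. of_real (expw t) * L2_inner M k (U t g))"
    by (rule integrable_dominated_convergence[where s="?f", OF m _ w _ bd]) (use f_lim in auto)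
  have "(\<lambda>m. integral\<^sup>L lborel (?f m)) \<longlonglongrightarrow> (LINT t|lborel. of_real (expw t) * L2_inner M k (U t g))"
    by (rule integral_dominated_convergence[where s="?f", OF m _ w _ bd]) (use f_lim in auto)
  moreover have "(\<lambda>m. integral\<^sup>L lborel (?f m)) \<longlonglongrightarrow> L2_inner M k (\<Phi> resolvent g)"
    unfolding f_val
    by (rule lim[of _ 1])
      (auto intro: norm_resolvent_le has_\<Phi> resolvent_bounded g order_trans[OF resolvent_lipschitz])
  ultimately show "(LINT t|lborel. of_real (expw t) * L2_inner M k (U t g)) = L2_inner M k (\<Phi> resolvent g)"
    by (rule LIMSEQ_unique)
qed

end

section \<open>Approximation by indicators of compact sets\<close>

lemma L2_dominated_convergence:
  fixes f :: "nat \<Rightarrow> 'a \<Rightarrow> complex"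
  assumes f: "\<And>i. f i \<in> L2 M" and h: "h \<in> L2 M" and w: "w \<in> L2 M"
    and lim: "\<And>x. x \<in> space M \<Longrightarrow> (\<lambda>i. f i x) \<longlonglongrightarrow> h x"
    and bd: "\<And>i x. x \<in> space M \<Longrightarrow> cmod (f i x - h x) \<le> cmod (w x)"
  shows "(\<lambda>i. L2_norm M (\<lambda>x. f i x - h x)) \<longlonglongrightarrow> 0"
proof -
  note [measurable] = L2_measurable[OF f] L2_measurable[OF h]
  have "(\<lambda>i. LINT x|M. (cmod (f i x - h x))\<^sup>2) \<longlonglongrightarrow> (LINT x|M. 0)"
  proof (rule integral_dominated_convergence)
    show "integrable M (\<lambda>x. (cmod (w x))\<^sup>2)" using w by (rule L2_square_integrable)
    show "AE x in M. (\<lambda>i. (cmod (f i x - h x))\<^sup>2) \<longlonglongrightarrow> 0"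
    proof (intro AE_I2)
      fix x assume x: "x \<in> space M"
      have "(\<lambda>i. (cmod (f i x - h x))\<^sup>2) \<longlonglongrightarrow> (cmod (h x - h x))\<^sup>2"
        by (intro tendsto_intros lim x)
      then show "(\<lambda>i. (cmod (f i x - h x))\<^sup>2) \<longlonglongrightarrow> 0" by simp
    qed
    show "AE x in M. norm ((cmod (f i x - h x))\<^sup>2) \<le> (cmod (w x))\<^sup>2" for i
      using bd by (intro AE_I2) (simp add: power_mono)
  qed auto
  then have "(\<lambda>i. sqrt (LINT x|M. (cmod (f i x - h x))\<^sup>2)) \<longlonglongrightarrow> sqrt 0"
    by (intro tendsto_real_sqrt) simp
  then show ?thesis by (simp add: L2_norm_def)
qed

lemma (in finite_measure) indicator_L2:
  assumes "A \<inter> space M \<in> sets M"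
  shows "(indicator A :: 'a \<Rightarrow> complex) \<in> L2 M"
proof -
  have m: "(indicator A :: 'a \<Rightarrow> complex) \<in> borel_measurable M"
    using assms by (simp add: borel_measurable_indicator_iff)
  have "integrable M (\<lambda>x. (cmod (indicator A x))\<^sup>2)"
    by (rule integrable_const_bound[of _ 1]) (use m in \<open>auto split: split_indicator\<close>)
  with m show ?thesis by (simp add: L2_def)
qed

lemma (in finite_measure) L2_norm_indicator_diff:
  assumes "A \<in> sets M" "B \<in> sets M"
  shows "(L2_norm M (\<lambda>x. indicator A x - indicator B x))\<^sup>2 = measure M (A - B) + measure M (B - A)"
proof -
  have "(cmod (indicator A x - indicator B x))\<^sup>2 = indicator (A - B) x + indicator (B - A) x" for x
    by (auto split: split_indicator)
  moreover have "integrable M (indicator C :: 'a \<Rightarrow> real)" if "C \<in> sets M" for C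
    using that by (intro integrable_real_indicator) (simp_all add: less_top[symmetric])
  ultimately show ?thesis unfolding L2_norm_square using assms by simp
qed

text \<open>An induction principle in place of a density theorem. Closure under \<open>L2\<close>
  limits is used both for actual limits and, at distance zero, to make \<open>P\<close> insensitive
  to changes off \<open>X\<close>. The class grows from compact to closed sets, to Borel sets by
  Dynkin's theorem, then to simple functions and to all of \<open>L2\<close>.\<close>

lemma L2_approximation_induct:
  fixes X :: "'b::topological_space set" and P :: "('b \<Rightarrow> complex) \<Rightarrow> bool"
  assumes "finite_measure M" and sp: "space M = X" and st: "sets M = sets (restrict_space borel X)"
    and "compact X" and "closed X"
    and ind: "\<And>A. compact A \<Longrightarrow> A \<subseteq> X \<Longrightarrow> P (indicator A)"
    and lin: "\<And>f g a b. f \<in> L2 M \<Longrightarrow> g \<in> L2 M \<Longrightarrow> P f \<Longrightarrow> P g \<Longrightarrow> P (\<lambda>x. a * f x + b * g x)"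
    and cl: "\<And>f. f \<in> L2 M \<Longrightarrow> (\<And>\<epsilon>. 0 < \<epsilon> \<Longrightarrow> \<exists>g\<in>L2 M. P g \<and> L2_norm M (\<lambda>x. f x - g x) < \<epsilon>) \<Longrightarrow> P f"
    and f: "f \<in> L2 M"
  shows "P f"
proof -
  interpret finite_measure M by fact
  have XB: "X \<inter> B \<in> sets M" if "B \<in> sets borel" for B
    using that by (auto simp: st sets_restrict_space)
  have iL: "(indicator B :: 'b \<Rightarrow> complex) \<in> L2 M" if "B \<in> sets borel" for B
    using XB[OF that] by (intro indicator_L2) (simp add: sp Int_commute)
  have cong: "P h" if "P k" "k \<in> L2 M" "h \<in> L2 M" "\<And>x. x \<in> X \<Longrightarrow> h x = k x" for h k
  proof (rule cl[OF that(3)])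
    fix \<epsilon> :: real assume "0 < \<epsilon>"
    have "L2_norm M (\<lambda>x. h x - k x) = L2_norm M (\<lambda>x. 0)"
      using that by (intro L2_norm_cong_AE L2_measurable L2_diff L2_zero AE_I2) (auto simp: sp)
    then show "\<exists>g\<in>L2 M. P g \<and> L2_norm M (\<lambda>x. h x - g x) < \<epsilon>" using that \<open>0 < \<epsilon>\<close> by auto
  qed
  have lim: "P h" if "\<And>i. P (k i)" "\<And>i. k i \<in> L2 M" "h \<in> L2 M" "(\<lambda>i. L2_norm M (\<lambda>x. k i x - h x)) \<longlonglongrightarrow> 0"
    for h and k :: "nat \<Rightarrow> 'b \<Rightarrow> complex"
  proof (rule cl[OF that(3)])
    fix \<epsilon> :: real assume "0 < \<epsilon>"
    from order_tendstoD(2)[OF that(4) this] obtain i where "L2_norm M (\<lambda>x. k i x - h x) < \<epsilon>"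
      using eventually_happens'[OF sequentially_bot] by blast
    then show "\<exists>g\<in>L2 M. P g \<and> L2_norm M (\<lambda>x. h x - g x) < \<epsilon>"
      using that(1,2) by (auto simp: L2_norm_minus_commute[of M h] intro!: bexI[of _ "k i"])
  qed
  have closed: "P (indicator B)" if "closed B" for B
  proof (rule cong)
    show "P (indicator (X \<inter> B))" using that \<open>compact X\<close> by (intro ind compact_Int_closed) auto
    show "(indicator (X \<inter> B) :: 'b \<Rightarrow> complex) \<in> L2 M" "(indicator B :: 'b \<Rightarrow> complex) \<in> L2 M"
      using that \<open>closed X\<close> by (auto intro!: iL)
  qed (auto split: split_indicator)
  have compl: "P (indicator (UNIV - B))" if "P (indicator B)" "B \<in> sets borel" for B
  proof -
    have "P (\<lambda>x. 1 * indicator UNIV x + (-1) * indicator B x)"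
      by (rule lin[OF iL iL closed that(1)]) (use that(2) in simp_all)
    moreover have "(\<lambda>x. 1 * indicator UNIV x + (-1) * indicator B x :: complex) = indicator (UNIV - B)"
      by (auto split: split_indicator)
    ultimately show ?thesis by simp
  qed
  have borel: "P (indicator B)" if "B \<in> sets borel" for B
  proof -
    \<comment> \<open>The Dynkin argument runs on the Borel sets of the whole space, generated by
      the intersection-stable open sets; \<open>indicator B\<close> and
      \<open>indicator (X \<inter> B)\<close> agree on the space of \<open>M\<close>.\<close>
    have "B \<in> sigma_sets UNIV {S. open S}" using that by (simp add: borel_def)
    then show ?thesis
    proof (induction B rule: sigma_sets_induct_disjoint[rotated 2, consumes 1, case_names basic empty compl union stable space])
      case (basic A)
      then have "closed (UNIV - A)" by auto
      then have "P (indicator (UNIV - (UNIV - A)))" by (intro compl closed) auto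
      then show ?case unfolding Diff_Diff_Int Int_UNIV_left .
    next
      case empty
      then show ?case by (intro closed) auto
    next
      case (compl A)
      then show ?case by (intro \<open>\<And>B. P (indicator B) \<Longrightarrow> B \<in> sets borel \<Longrightarrow> P (indicator (UNIV - B))\<close>) (auto simp: borel_def)
    next
      case (union A)
      have Ab: "A i \<in> sets borel" for i using union(2) by (auto simp: borel_def)
      define k where "k i = (indicator (\<Union>j<i. A j) :: 'b \<Rightarrow> complex)" for i
      have kL: "k i \<in> L2 M" for i unfolding k_def using Ab by (intro iL sets.finite_UN) auto
      have Pk: "P (k i)" for i
      proof (induction i)
        case 0 show ?case unfolding k_def lessThan_0 UN_empty by (rule closed[OF closed_empty])
      next
        case (Suc i)
        have "P (\<lambda>x. 1 * k i x + 1 * indicator (A i) x)" by (intro lin kL iL Ab Suc union(3))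
        moreover have "A i \<inter> A j = {}" if "j < i" for j
          using disjoint_family_onD[OF union(1), of i j] that by simp
        then have "A i \<inter> (\<Union>j<i. A j) = {}" by blast
        then have "(\<lambda>x. 1 * k i x + 1 * indicator (A i) x) = k (Suc i)"
          by (intro ext) (auto simp: k_def lessThan_Suc indicator_def)
        ultimately show ?case by simp
      qed
      show ?case
      proof (rule lim[OF Pk kL])
        show UL: "(indicator (\<Union>i. A i) :: 'b \<Rightarrow> complex) \<in> L2 M" using Ab by (intro iL) auto
        show "(\<lambda>i. L2_norm M (\<lambda>x. k i x - indicator (\<Union>i. A i) x)) \<longlonglongrightarrow> 0"
        proof (rule L2_dominated_convergence[OF kL UL, of "indicator UNIV"])
          show "(indicator UNIV :: 'b \<Rightarrow> complex) \<in> L2 M" by (intro iL) auto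
          show "(\<lambda>i. k i x) \<longlonglongrightarrow> indicator (\<Union>i. A i) x" for x
            unfolding k_def by (rule LIMSEQ_indicator_UN)
        qed (auto simp: k_def split: split_indicator)
      qed
    qed (auto simp: Int_stable_def)
  qed
  have setsM: "P (indicator B)" "(indicator B :: 'b \<Rightarrow> complex) \<in> L2 M" if "B \<in> sets M" for B
  proof -
    from that obtain B' where B': "B' \<in> sets borel" "B = X \<inter> B'" by (auto simp: st sets_restrict_space)
    show L: "(indicator B :: 'b \<Rightarrow> complex) \<in> L2 M" using that by (intro indicator_L2) auto
    show "P (indicator B)"
      by (rule cong[OF borel[OF B'(1)] iL[OF B'(1)] L]) (auto simp: B' split: split_indicator)
  qed
  have sum: "P (\<lambda>x. \<Sum>y\<in>Y. y * indicator (B y) x)" if "finite Y" "\<And>y. y \<in> Y \<Longrightarrow> B y \<in> sets M" for Y B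
    using that
  proof (induction Y rule: finite_induct)
    case empty
    have "P (\<lambda>x. 0 * indicator UNIV x + 0 * indicator UNIV x)" by (intro lin iL closed) auto
    then show ?case by simp
  next
    case (insert y Y)
    have "P (\<lambda>x. y * indicator (B y) x + 1 * (\<Sum>y\<in>Y. y * indicator (B y) x))"
      using insert by (intro lin setsM L2_sum L2_scale) auto
    then show ?case unfolding sum.insert[OF insert.hyps] mult_1 .
  qed
  \<comment> \<open>The approximants satisfy \<open>cmod (F i x) \<le> 2 * cmod (f x)\<close>, so
    their distance to \<open>f\<close> is dominated by the modulus of
    \<open>3 * f x\<close>.\<close>
  from borel_measurable_implies_sequence_metric[OF L2_measurable[OF f], of 0]
  obtain F where F: "\<And>i. simple_function M (F i)" "\<And>x. x \<in> space M \<Longrightarrow> (\<lambda>i. F i x) \<longlonglongrightarrow> f x"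
    "\<And>i x. x \<in> space M \<Longrightarrow> cmod (F i x) \<le> 2 * cmod (f x)"
    unfolding norm_conv_dist[symmetric] by blast
  \<comment> \<open>\<open>F i\<close> is controlled only on the space of \<open>M\<close>;
    \<open>G i\<close> is its canonical form, a finite combination of indicators of measurable
    sets.\<close>
  define G where "G i x = (\<Sum>y\<in>F i ` space M. y * indicator (F i -` {y} \<inter> space M) x)" for i x
  have GF: "G i x = F i x" if "x \<in> space M" for i x
  proof -
    have "G i x = (\<Sum>y\<in>F i ` space M. if y = F i x then y else 0)"
      unfolding G_def using that by (intro sum.cong) (auto simp: indicator_def)
    then show ?thesis using simple_functionD(1)[OF F(1)] that by simp
  qed
  have GL: "G i \<in> L2 M" for i
    unfolding G_def using simple_functionD(2)[OF F(1)] by (intro L2_sum L2_scale setsM(2)) auto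
  show "P f"
  proof (rule lim[OF _ GL f])
    show "P (G i)" for i
      unfolding G_def using simple_functionD[OF F(1)] by (intro sum) auto
    show "(\<lambda>i. L2_norm M (\<lambda>x. G i x - f x)) \<longlonglongrightarrow> 0"
    proof (rule L2_dominated_convergence[OF GL f L2_scale[OF f, of 3]])
      fix x assume x: "x \<in> space M"
      then show "(\<lambda>i. G i x) \<longlonglongrightarrow> f x" using F(2) GF by simp
      show "cmod (G i x - f x) \<le> cmod (3 * f x)" for i
        using norm_triangle_ineq4[of "F i x" "f x"] F(3)[OF x, of i] by (simp add: GF x norm_mult)
    qed
  qed
qed

section \<open>Permutations of cells and their spectra\<close>

locale cell_map = finite_measure M for M :: "'a measure" +
  fixes P :: "'a set set" and F :: "'a set \<Rightarrow> 'a set"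
  assumes finite_cells: "finite P"
    and cell_sets: "\<And>p. p \<in> P \<Longrightarrow> p \<in> sets M"
    and cover: "\<Union>P = space M"
    and overlap: "\<And>p p'. p \<in> P \<Longrightarrow> p' \<in> P \<Longrightarrow> p \<noteq> p' \<Longrightarrow> emeasure M (p \<inter> p') = 0"
    and cell_measure: "\<And>p. p \<in> P \<Longrightarrow> measure M p = measure M (space M) / real (card P)"
    and space_pos: "0 < measure M (space M)"
    and bij: "bij_betw F P P"
begin

definition cell_size :: real where
  "cell_size = measure M (space M) / real (card P)"

text \<open>Functions on the finite set of cells, transported to the space. On overlaps of cells the
  values add up, so evaluations hold only almost everywhere.\<close>

definition step :: "('a set \<Rightarrow> complex) \<Rightarrow> 'a \<Rightarrow> complex" where
  "step a x = (\<Sum>p\<in>P. a p * indicator p x)"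

abbreviation rewind :: "nat \<Rightarrow> 'a set \<Rightarrow> 'a set" where
  "rewind j \<equiv> inv_into P F ^^ j"

abbreviation W :: "('a \<Rightarrow> complex) \<Rightarrow> 'a \<Rightarrow> complex" where
  "W \<equiv> averaging M P"

abbreviation Uk :: "nat \<Rightarrow> ('a \<Rightarrow> complex) \<Rightarrow> 'a \<Rightarrow> complex" where
  "Uk j \<equiv> discrete_koopman M P F (int j)"

lemma cells_nonempty: "P \<noteq> {}"
  using cover space_pos by auto

lemma cell_size_pos: "0 < cell_size"
  using space_pos finite_cells cells_nonempty by (simp add: cell_size_def card_gt_0_iff)

lemma indicator_cell_L2: "p \<in> P \<Longrightarrow> (indicator p :: 'a \<Rightarrow> complex) \<in> L2 M"
  using cell_sets by (intro indicator_L2) auto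

lemma indicator_Union_L2: "Q \<subseteq> P \<Longrightarrow> (indicator (\<Union>Q) :: 'a \<Rightarrow> complex) \<in> L2 M"
  using cell_sets finite_subset[OF _ finite_cells] by (intro indicator_L2 sets.Int sets.finite_Union) auto

lemma step_L2: "step a \<in> L2 M"
  unfolding step_def by (intro L2_sum L2_scale indicator_cell_L2)

text \<open>Cells overlap in null sets and cover the space, so almost every point determines its
  cell; computations with \<open>step\<close> thereby reduce to computations on the finite set
  \<open>P\<close>.\<close>

lemma AE_unique_cell: "AE x in M. \<exists>p\<in>P. \<forall>p'\<in>P. x \<in> p' \<longleftrightarrow> p' = p"
proof -
  have "AE x in M. \<forall>p\<in>P. \<forall>p'\<in>P. p \<noteq> p' \<longrightarrow> \<not> (x \<in> p \<and> x \<in> p')"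
  proof (intro AE_finite_allI finite_cells)
    fix p p' assume p: "p \<in> P" "p' \<in> P"
    show "AE x in M. p \<noteq> p' \<longrightarrow> \<not> (x \<in> p \<and> x \<in> p')"
    proof (cases "p = p'")
      case False
      then have "p \<inter> p' \<in> null_sets M" using p cell_sets overlap by (intro null_setsI) auto
      then have "AE x in M. x \<notin> p \<inter> p'" by (rule AE_not_in)
      then show ?thesis by eventually_elim auto
    qed auto
  qed
  then show ?thesis
  proof (rule AE_mp, intro AE_I2 impI)
    fix x assume x: "x \<in> space M" and "\<forall>p\<in>P. \<forall>p'\<in>P. p \<noteq> p' \<longrightarrow> \<not> (x \<in> p \<and> x \<in> p')"
    moreover obtain p where "p \<in> P" "x \<in> p" using x cover by blast
    ultimately show "\<exists>p\<in>P. \<forall>p'\<in>P. x \<in> p' \<longleftrightarrow> p' = p" by (intro bexI[of _ p]) auto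
  qed
qed

lemma step_at:
  assumes "p \<in> P" "\<forall>p'\<in>P. x \<in> p' \<longleftrightarrow> p' = p"
  shows "step a x = a p"
proof -
  have "step a x = (\<Sum>p'\<in>P. if p' = p then a p else 0)"
    unfolding step_def using assms(2) by (intro sum.cong) (auto simp: indicator_def)
  then show ?thesis using assms(1) finite_cells by simp
qed

lemma integral_cell: "p \<in> P \<Longrightarrow> (LINT x|M. indicator p x :: complex) = of_real cell_size"
proof -
  assume p: "p \<in> P"
  have "(LINT x|M. complex_of_real (indicator p x)) = of_real (LINT x|M. indicator p x)"
    by (rule integral_complex_of_real)
  moreover have "(LINT x|M. indicator p x :: real) = cell_size"
    using cell_sets[OF p] cell_measure[OF p] by (simp add: cell_size_def)
  moreover have "(\<lambda>x. complex_of_real (indicator p x)) = indicator p" by (auto split: split_indicator)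
  ultimately show ?thesis by simp
qed

text \<open>Up to the factor \<open>cell_size\<close>, \<open>step\<close> is an isometry from
  functions on \<open>P\<close> with counting measure. Hence a permutation of the cells preserves
  norms, by reindexing a sum.\<close>

lemma inner_step: "L2_inner M (step a) (step b) = of_real cell_size * (\<Sum>p\<in>P. cnj (a p) * b p)"
proof -
  have "L2_inner M (step a) (step b) = (LINT x|M. step (\<lambda>p. cnj (a p) * b p) x)"
    unfolding L2_inner_def
  proof (rule integral_cong_AE)
    show "AE x in M. cnj (step a x) * step b x = step (\<lambda>p. cnj (a p) * b p) x"
      using AE_unique_cell
    proof eventually_elim
      fix x assume "\<exists>p\<in>P. \<forall>p'\<in>P. x \<in> p' \<longleftrightarrow> p' = p"
      then obtain p where p: "p \<in> P" "\<forall>p'\<in>P. x \<in> p' \<longleftrightarrow> p' = p" by blast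
      show "cnj (step a x) * step b x = step (\<lambda>p. cnj (a p) * b p) x"
        unfolding step_at[OF p] ..
    qed
    have [measurable]: "step c \<in> borel_measurable M" for c using step_L2 by (rule L2_measurable)
    show "(\<lambda>x. cnj (step a x) * step b x) \<in> borel_measurable M" by measurable
    show "step (\<lambda>p. cnj (a p) * b p) \<in> borel_measurable M" by measurable
  qed
  also have "\<dots> = (\<Sum>p\<in>P. cnj (a p) * b p * (LINT x|M. indicator p x))"
    unfolding step_def
  proof (subst Bochner_Integration.integral_sum)
    fix p assume "p \<in> P"
    then have "integrable M (indicator p :: 'a \<Rightarrow> complex)"
      using cell_sets by (intro integrable_const_bound[of _ 1]) (auto split: split_indicator)
    then show "integrable M (\<lambda>x. cnj (a p) * b p * indicator p x)" by (rule integrable_mult_right)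
  qed simp
  also have "\<dots> = of_real cell_size * (\<Sum>p\<in>P. cnj (a p) * b p)"
    by (simp add: integral_cell sum_distrib_left mult.commute)
  finally show ?thesis .
qed

lemma cell_avg_inner: "g \<in> L2 M \<Longrightarrow> p \<in> P \<Longrightarrow> cell_avg M P g p = L2_inner M (indicator p) g / of_real cell_size"
proof -
  have "(LINT x|M. g x * indicator p x) = L2_inner M (indicator p) g"
    unfolding L2_inner_def by (intro Bochner_Integration.integral_cong) (auto split: split_indicator)
  then show ?thesis by (simp add: cell_avg_def cell_size_def)
qed

lemma cell_avg_cong_AE:
  assumes "f \<in> L2 M" "g \<in> L2 M" "AE x in M. f x = g x" "p \<in> P"
  shows "cell_avg M P f p = cell_avg M P g p"
  using assms L2_inner_cong_AE[of "indicator p" M f "indicator p" g]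
  by (simp add: cell_avg_inner L2_measurable indicator_cell_L2)

lemma cell_avg_linear:
  assumes "f \<in> L2 M" "g \<in> L2 M" "p \<in> P"
  shows "cell_avg M P (\<lambda>x. a * f x + b * g x) p = a * cell_avg M P f p + b * cell_avg M P g p"
  using assms
  by (simp add: cell_avg_inner L2_add L2_scale L2_inner_add_right indicator_cell_L2 L2_inner_scale_right
      add_divide_distrib)

lemma cell_avg_sum:
  assumes "\<And>k. k \<in> K \<Longrightarrow> f k \<in> L2 M" "p \<in> P"
  shows "cell_avg M P (\<lambda>x. \<Sum>k\<in>K. c k * f k x) p = (\<Sum>k\<in>K. c k * cell_avg M P (f k) p)"
  using assms
  by (simp add: cell_avg_inner L2_sum L2_scale L2_inner_sum_right indicator_cell_L2 L2_inner_scale_right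
      sum_divide_distrib)

lemma step_indicator: "p \<in> P \<Longrightarrow> step (\<lambda>p'. if p' = p then 1 else 0) = indicator p"
  unfolding step_def using finite_cells
  by (simp add: if_distrib[where f="\<lambda>c. c * _"] cong: if_cong)

lemma cell_avg_step: "p \<in> P \<Longrightarrow> cell_avg M P (step a) p = a p"
  using cell_size_pos finite_cells inner_step[of "\<lambda>p'. if p' = p then 1 else 0" a]
  by (simp add: cell_avg_inner step_L2 step_indicator if_distrib[where f="\<lambda>c. c * _"]
      if_distrib[where f=cnj] cong: if_cong)

lemma averaging_step: "W g = step (cell_avg M P g)"
  by (simp add: averaging_def step_def[abs_def])

lemma averaging_L2: "W g \<in> L2 M"
  by (simp add: averaging_step step_L2)

lemma step_cong: "(\<And>p. p \<in> P \<Longrightarrow> a p = b p) \<Longrightarrow> step a = step b"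
  unfolding step_def by (intro ext sum.cong) auto

text \<open>This is the orthogonality of \<open>g - W g\<close> to step functions: averaging is the
  orthogonal projection onto them, which yields the contraction bound.\<close>

lemma inner_step_right:
  assumes g: "g \<in> L2 M"
  shows "L2_inner M (step a) g = L2_inner M (step a) (W g)"
proof -
  have "L2_inner M (step a) g = (\<Sum>p\<in>P. cnj (a p) * L2_inner M (indicator p) g)"
    unfolding step_def
    by (subst L2_inner_sum_left) (auto intro!: g L2_scale indicator_cell_L2 simp: L2_inner_scale_left)
  also have "\<dots> = (\<Sum>p\<in>P. of_real cell_size * (cnj (a p) * cell_avg M P g p))"
    using cell_size_pos by (intro sum.cong) (auto simp: cell_avg_inner g)
  also have "\<dots> = L2_inner M (step a) (W g)"
    unfolding averaging_step inner_step by (simp add: sum_distrib_left)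
  finally show ?thesis .
qed

lemma averaging_norm_le:
  assumes g: "g \<in> L2 M"
  shows "L2_norm M (W g) \<le> L2_norm M g"
proof (cases "L2_norm M (W g) = 0")
  case False
  have "of_real ((L2_norm M (W g))\<^sup>2) = L2_inner M (W g) g"
    unfolding L2_inner_self[symmetric] using inner_step_right[OF g, of "cell_avg M P g"]
    by (simp add: averaging_step)
  then have "(L2_norm M (W g))\<^sup>2 = cmod (L2_inner M (W g) g)"
    by (metis norm_of_real abs_power2)
  also have "\<dots> \<le> L2_norm M (W g) * L2_norm M g" by (intro L2_Cauchy_Schwarz averaging_L2 g)
  finally show ?thesis using False by (simp add: power2_eq_square less_le)
qed simp

lemma averaging_linear:
  assumes "f \<in> L2 M" "g \<in> L2 M"
  shows "W (\<lambda>x. a * f x + b * g x) = (\<lambda>x. a * W f x + b * W g x)"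
proof -
  have "W (\<lambda>x. a * f x + b * g x) = step (\<lambda>p. a * cell_avg M P f p + b * cell_avg M P g p)"
    unfolding averaging_step by (intro step_cong cell_avg_linear assms)
  then show ?thesis
    by (simp add: averaging_step step_def[abs_def] distrib_right sum.distrib sum_distrib_left mult.assoc)
qed

lemma averaging_diff:
  "f \<in> L2 M \<Longrightarrow> g \<in> L2 M \<Longrightarrow> W (\<lambda>x. f x - g x) = (\<lambda>x. W f x - W g x)"
  using averaging_linear[of f g 1 "-1"] by simp

lemma bij_rewind: "bij_betw (rewind j) P P"
proof (induction j)
  case (Suc j)
  then show ?case using bij_betw_trans[OF Suc bij_betw_inv_into[OF bij]] by (simp add: funpow_Suc_right comp_def)
qed (simp add: bij_betw_def)

lemma rewind_in: "p \<in> P \<Longrightarrow> rewind j p \<in> P"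
  using bij_rewind by (auto simp: bij_betw_def)

lemma int_iterate_rewind: "int_iterate P F (- int j) = rewind j"
  by (cases "j = 0") (auto simp: int_iterate_def)

lemma Uk_sum: "Uk j g x = (\<Sum>p\<in>P. cell_avg M P g p * indicator (rewind j p) x)"
  by (simp add: discrete_koopman_def int_iterate_rewind)

text \<open>Inverse of \<open>rewind j\<close> on the cells. It moves the permutation from the sets
  to the coefficients, so that \<open>Uk j g\<close> becomes a \<open>step\<close> function.\<close>

definition fwd :: "nat \<Rightarrow> 'a set \<Rightarrow> 'a set" where
  "fwd j = inv_into P (rewind j)"

lemma fwd_rewind: "p \<in> P \<Longrightarrow> fwd j (rewind j p) = p"
  using bij_rewind unfolding fwd_def by (intro inv_into_f_f) (auto simp: bij_betw_def)

lemma Uk_step: "Uk j g = step (\<lambda>p. cell_avg M P g (fwd j p))"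
proof
  fix x
  show "Uk j g x = step (\<lambda>p. cell_avg M P g (fwd j p)) x"
    unfolding Uk_sum step_def
    by (subst sum.reindex_bij_betw[OF bij_rewind, of _ j, symmetric]) (simp add: fwd_rewind)
qed

lemma Uk_L2: "Uk j g \<in> L2 M"
  by (simp add: Uk_step step_L2)

lemma Uk_norm: "L2_norm M (Uk j g) = L2_norm M (W g)"
proof -
  have "of_real ((L2_norm M (Uk j g))\<^sup>2) = complex_of_real ((L2_norm M (W g))\<^sup>2)"
    unfolding L2_inner_self[symmetric] Uk_step averaging_step inner_step
    by (subst sum.reindex_bij_betw[OF bij_rewind, of _ j, symmetric]) (simp add: fwd_rewind)
  then show ?thesis by (simp only: of_real_eq_iff) (metis L2_norm_nonneg power2_eq_iff_nonneg)
qed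

lemma Uk_norm_le: "g \<in> L2 M \<Longrightarrow> L2_norm M (Uk j g) \<le> L2_norm M g"
  using averaging_norm_le Uk_norm by simp

lemma Uk_cong_AE:
  assumes "f \<in> L2 M" "g \<in> L2 M" "AE x in M. f x = g x"
  shows "Uk j f = Uk j g"
  unfolding Uk_sum[abs_def] using cell_avg_cong_AE[OF assms] by (intro ext sum.cong) auto

lemma Uk_linear:
  assumes "f \<in> L2 M" "g \<in> L2 M"
  shows "Uk j (\<lambda>x. a * f x + b * g x) = (\<lambda>x. a * Uk j f x + b * Uk j g x)"
proof
  fix x
  have "Uk j (\<lambda>x. a * f x + b * g x) x =
      (\<Sum>p\<in>P. (a * cell_avg M P f p + b * cell_avg M P g p) * indicator (rewind j p) x)"
    unfolding Uk_sum using cell_avg_linear[OF assms] by (intro sum.cong) auto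
  then show "Uk j (\<lambda>x. a * f x + b * g x) x = a * Uk j f x + b * Uk j g x"
    by (simp add: Uk_sum distrib_right sum.distrib sum_distrib_left mult.assoc)
qed

lemma Uk_diff: "f \<in> L2 M \<Longrightarrow> g \<in> L2 M \<Longrightarrow> Uk j (\<lambda>x. f x - g x) = (\<lambda>x. Uk j f x - Uk j g x)"
  using Uk_linear[of f g j 1 "-1"] by simp

lemma Uk_sum_arg:
  assumes "\<And>k. k \<in> K \<Longrightarrow> f k \<in> L2 M"
  shows "Uk j (\<lambda>x. \<Sum>k\<in>K. c k * f k x) x = (\<Sum>k\<in>K. c k * Uk j (f k) x)"
proof -
  have "Uk j (\<lambda>x. \<Sum>k\<in>K. c k * f k x) x =
      (\<Sum>p\<in>P. (\<Sum>k\<in>K. c k * cell_avg M P (f k) p) * indicator (rewind j p) x)"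
    unfolding Uk_sum by (intro sum.cong refl arg_cong2[where f="(*)"] cell_avg_sum assms)
  also have "\<dots> = (\<Sum>k\<in>K. c k * Uk j (f k) x)"
    unfolding Uk_sum sum_distrib_left sum_distrib_right by (subst sum.swap) (simp add: mult.assoc)
  finally show ?thesis .
qed

text \<open>The discrete operator is defined separately for each number of steps. That these are the
  powers of one operator follows because averaging recovers the coefficients of a step
  function.\<close>

lemma Uk_Suc: "Uk (Suc j) g = Uk 1 (Uk j g)"
proof
  fix x
  have "cell_avg M P (Uk j g) (rewind j p) = cell_avg M P g p" if "p \<in> P" for p
    unfolding Uk_step using that by (simp add: cell_avg_step rewind_in fwd_rewind)
  then have "Uk (Suc j) g x = (\<Sum>p\<in>P. cell_avg M P (Uk j g) (rewind j p) * indicator (rewind 1 (rewind j p)) x)"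
    unfolding Uk_sum[of "Suc j"] by (intro sum.cong) auto
  also have "\<dots> = Uk 1 (Uk j g) x"
    unfolding Uk_sum[of 1] by (rule sum.reindex_bij_betw[OF bij_rewind])
  finally show "Uk (Suc j) g x = Uk 1 (Uk j g) x" .
qed

lemma L2_cells_step: "step a \<in> L2_cells M P"
  unfolding L2_cells_def using step_L2 by (auto simp: step_def)

lemma averaging_cells: "W g \<in> L2_cells M P"
  by (simp add: averaging_step L2_cells_step)

lemma averaging_id:
  assumes "f \<in> L2_cells M P"
  shows "AE x in M. W f x = f x"
proof -
  from assms obtain c where fL: "f \<in> L2 M" and c: "AE x in M. f x = step c x"
    by (auto simp: L2_cells_def step_def)
  have "W f = step c"
    unfolding averaging_step using cell_avg_cong_AE[OF fL step_L2 c] by (intro step_cong) (simp add: cell_avg_step)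
  then show ?thesis using c by auto
qed

lemma Uk_averaging: "g \<in> L2 M \<Longrightarrow> Uk j (W g) = Uk j g"
  unfolding Uk_sum[abs_def] averaging_step by (intro ext sum.cong) (auto simp: cell_avg_step)

lemma indicator_Union_AE:
  assumes Q: "Q \<subseteq> P"
  shows "AE x in M. indicator (\<Union>Q) x = step (indicator Q) x"
  using AE_unique_cell
proof eventually_elim
  fix x assume "\<exists>p\<in>P. \<forall>p'\<in>P. x \<in> p' \<longleftrightarrow> p' = p"
  then obtain p where p: "p \<in> P" "\<forall>p'\<in>P. x \<in> p' \<longleftrightarrow> p' = p" by blast
  have "x \<in> \<Union>Q \<longleftrightarrow> p \<in> Q"
  proof
    assume "x \<in> \<Union>Q"
    then obtain p' where p': "p' \<in> Q" "x \<in> p'" by blast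
    with Q bspec[OF p(2), of p'] show "p \<in> Q" by auto
  next
    assume "p \<in> Q"
    with bspec[OF p(2) p(1)] show "x \<in> \<Union>Q" by auto
  qed
  then show "indicator (\<Union>Q) x = step (indicator Q) x"
    unfolding step_at[OF p] by (simp add: indicator_def)
qed

lemma Union_sets: "Q \<subseteq> P \<Longrightarrow> \<Union>Q \<in> sets M"
  using cell_sets finite_subset[OF _ finite_cells] by (intro sets.finite_Union) auto

lemma measure_Union_cells:
  assumes Q: "Q \<subseteq> P"
  shows "measure M (\<Union>Q) = real (card Q) * cell_size"
proof -
  have "L2_norm M (indicator (\<Union>Q)) = L2_norm M (step (indicator Q))"
    by (intro L2_norm_cong_AE L2_measurable indicator_Union_L2 Q step_L2 indicator_Union_AE)
  moreover have "(L2_norm M (indicator (\<Union>Q)))\<^sup>2 = measure M (\<Union>Q)"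
  proof -
    have "(L2_norm M (indicator (\<Union>Q)))\<^sup>2 = (L2_norm M (\<lambda>x. indicator (\<Union>Q) x - indicator {} x))\<^sup>2" by simp
    then show ?thesis using L2_norm_indicator_diff[OF Union_sets[OF Q] sets.empty_sets] by simp
  qed
  moreover have "complex_of_real ((L2_norm M (step (indicator Q)))\<^sup>2) = of_real (real (card Q) * cell_size)"
  proof -
    have "(\<Sum>p\<in>P. cnj (indicator Q p) * indicator Q p) = (\<Sum>p\<in>P. indicator Q p :: complex)"
      by (intro sum.cong) (auto split: split_indicator)
    also have "\<dots> = of_nat (card (P \<inter> Q))"
      using finite_cells by (simp add: sum.If_cases indicator_def)
    also have "P \<inter> Q = Q" using Q by auto
    finally show ?thesis unfolding L2_inner_self[symmetric] inner_step by (simp add: mult.commute)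
  qed
  ultimately show ?thesis by (simp only: of_real_eq_iff)
qed

text \<open>A further cell inside the union would leave the union unchanged but raise its measure by
  \<open>cell_size\<close>. So the cells of a union can be recovered from the set, which is how
  \<open>iterate_on_union\<close> acts on it.\<close>

lemma cell_subset_Union:
  assumes Q: "Q \<subseteq> P" and p: "p \<in> P" "p \<subseteq> \<Union>Q"
  shows "p \<in> Q"
proof (rule ccontr)
  assume n: "p \<notin> Q"
  have U: "\<Union>(insert p Q) = \<Union>Q" and ins: "insert p Q \<subseteq> P" using Q p by auto
  have "real (card (insert p Q)) * cell_size = real (card Q) * cell_size"
    unfolding measure_Union_cells[OF Q, symmetric] measure_Union_cells[OF ins, symmetric] U ..
  then show False using n cell_size_pos finite_subset[OF Q finite_cells] by simp
qed

lemma iterate_on_Union: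
  assumes "Q \<subseteq> P"
  shows "iterate_on_union P F (- int j) (\<Union>Q) = \<Union>(rewind j ` Q)"
proof -
  have "{p \<in> P. p \<subseteq> \<Union>Q} = Q" using cell_subset_Union[OF assms] assms by auto
  then show ?thesis by (simp add: iterate_on_union_def int_iterate_rewind)
qed

lemma rewind_image: "Q \<subseteq> P \<Longrightarrow> rewind j ` Q \<subseteq> P"
  using rewind_in by blast

lemma measure_rewind_image:
  assumes "Q \<subseteq> P"
  shows "measure M (\<Union>(rewind j ` Q)) = measure M (\<Union>Q)"
proof -
  have "card (rewind j ` Q) = card Q"
    using bij_rewind assms by (intro card_image inj_on_subset[OF _ assms]) (auto simp: bij_betw_def)
  then show ?thesis using assms rewind_image by (simp add: measure_Union_cells)
qed

text \<open>On indicators of cell unions the operator is the set map \<open>rewind\<close>, up to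
  null overlaps; this links the operators to the sets in the Hausdorff distance.\<close>

lemma Uk_indicator_Union:
  assumes Q: "Q \<subseteq> P"
  shows "AE x in M. Uk j (indicator (\<Union>Q)) x = indicator (\<Union>(rewind j ` Q)) x"
proof -
  have "Uk j (indicator (\<Union>Q)) = Uk j (step (indicator Q))"
    by (intro Uk_cong_AE indicator_Union_L2 step_L2 indicator_Union_AE Q)
  also have "\<dots> = step (indicator (rewind j ` Q))"
  proof
    fix x
    have "Uk j (step (indicator Q)) x = (\<Sum>p\<in>P. indicator (rewind j ` Q) (rewind j p) * indicator (rewind j p) x)"
      unfolding Uk_sum
    proof (intro sum.cong refl)
      fix p assume p: "p \<in> P"
      have "rewind j p \<in> rewind j ` Q \<longleftrightarrow> p \<in> Q"
        using p Q bij_rewind[of j] by (auto simp: bij_betw_def dest: inj_onD)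
      then show "cell_avg M P (step (indicator Q)) p * indicator (rewind j p) x =
          indicator (rewind j ` Q) (rewind j p) * indicator (rewind j p) x"
        by (simp add: cell_avg_step[OF p] indicator_def)
    qed
    also have "\<dots> = step (indicator (rewind j ` Q)) x"
      unfolding step_def by (rule sum.reindex_bij_betw[OF bij_rewind])
    finally show "Uk j (step (indicator Q)) x = step (indicator (rewind j ` Q)) x" .
  qed
  finally show ?thesis using indicator_Union_AE[OF rewind_image[OF Q], of j] by auto
qed

end

section \<open>Spectral calculus of the discrete evolution\<close>

locale cell_spectrum = cell_map M P F for M :: "'a measure" and P F +
  fixes q :: nat and v :: "nat \<Rightarrow> 'a \<Rightarrow> complex" and \<theta> :: "nat \<Rightarrow> real" and h :: real
  assumes eigenbasis: "koopman_eigenbasis M P F q v \<theta>" and h_pos: "0 < h"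
begin

abbreviation D :: "(real \<Rightarrow> complex) \<Rightarrow> ('a \<Rightarrow> complex) \<Rightarrow> 'a \<Rightarrow> complex" where
  "D \<equiv> discrete_spectral_op M q v (\<lambda>k. \<theta> k / h)"

lemma v_cells: "k \<in> {1..q} \<Longrightarrow> v k \<in> L2_cells M P"
  using eigenbasis by (simp add: koopman_eigenbasis_def)

lemma v_L2: "k \<in> {1..q} \<Longrightarrow> v k \<in> L2 M"
  using v_cells by (simp add: L2_cells_def)

lemma v_orthonormal: "j \<in> {1..q} \<Longrightarrow> k \<in> {1..q} \<Longrightarrow> L2_inner M (v j) (v k) = (if j = k then 1 else 0)"
  using eigenbasis unfolding koopman_eigenbasis_def by blast

lemma D_L2: "D \<phi> f \<in> L2 M"
  unfolding discrete_spectral_op_def by (intro L2_sum L2_scale v_L2[THEN L2_scale[where c="L2_inner M (v _) f"], simplified mult.commute])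

lemma D_alt: "D \<phi> f = (\<lambda>x. \<Sum>k=1..q. (\<phi> (\<theta> k / h) * L2_inner M (v k) f) * v k x)"
  unfolding discrete_spectral_op_def by (simp add: mult.assoc mult.commute[of "v _ _"])

lemma expansion:
  assumes f: "f \<in> L2_cells M P"
  shows "AE x in M. f x = (\<Sum>k=1..q. L2_inner M (v k) f * v k x)"
proof -
  have fL: "f \<in> L2 M" using f by (simp add: L2_cells_def)
  obtain c where c: "AE x in M. f x = (\<Sum>k=1..q. c k * v k x)"
    using eigenbasis f unfolding koopman_eigenbasis_def by blast
  have "L2_inner M (v j) f = c j" if j: "j \<in> {1..q}" for j
  proof -
    have "L2_inner M (v j) f = L2_inner M (v j) (\<lambda>x. \<Sum>k=1..q. c k * v k x)"
      using c fL j by (intro L2_inner_cong_AE) (auto intro!: L2_measurable L2_sum L2_scale v_L2)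
    also have "\<dots> = (\<Sum>k=1..q. c k * L2_inner M (v j) (v k))"
      using j by (subst L2_inner_sum_right) (auto intro!: L2_scale v_L2 simp: L2_inner_scale_right)
    also have "\<dots> = (\<Sum>k=1..q. if k = j then c j else 0)"
      using j by (intro sum.cong) (auto simp: v_orthonormal)
    also have "\<dots> = c j" using j by simp
    finally show ?thesis .
  qed
  then have "(\<Sum>k=1..q. L2_inner M (v k) f * v k x) = (\<Sum>k=1..q. c k * v k x)" for x
    by (intro sum.cong) auto
  then show ?thesis using c by simp
qed

lemma norm_expansion:
  "(L2_norm M (\<lambda>x. \<Sum>k=1..q. c k * v k x))\<^sup>2 = (\<Sum>k=1..q. (cmod (c k))\<^sup>2)"
proof -
  have "(L2_norm M (v k))\<^sup>2 = 1" if "k \<in> {1..q}" for k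
    using L2_inner_self[of M "v k"] v_orthonormal[OF that that] by (metis of_real_eq_1_iff)
  then have "(L2_norm M (\<lambda>x. c k * v k x))\<^sup>2 = (cmod (c k))\<^sup>2" if "k \<in> {1..q}" for k
    using that by (simp add: L2_norm_scale power_mult_distrib)
  moreover have "(L2_norm M (\<lambda>x. \<Sum>k=1..q. c k * v k x))\<^sup>2 = (\<Sum>k=1..q. (L2_norm M (\<lambda>x. c k * v k x))\<^sup>2)"
    by (rule L2_norm_sum_orthogonal)
      (auto intro!: L2_scale v_L2 simp: L2_inner_scale_left L2_inner_scale_right v_orthonormal)
  ultimately show ?thesis by simp
qed

text \<open>Parseval in the eigenbasis. The bound on \<open>\<phi>\<close> is asked only at the
  eigenfrequencies, because the stepped kernel is compared with the resolvent only in the band that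
  contains them.\<close>

lemma D_norm_le:
  assumes f: "f \<in> L2_cells M P" and K: "\<And>k. k \<in> {1..q} \<Longrightarrow> cmod (\<phi> (\<theta> k / h)) \<le> K" and "0 \<le> K"
  shows "L2_norm M (D \<phi> f) \<le> K * L2_norm M f"
proof (rule power2_le_imp_le)
  have fL: "f \<in> L2 M" using f by (simp add: L2_cells_def)
  have "L2_norm M f = L2_norm M (\<lambda>x. \<Sum>k=1..q. L2_inner M (v k) f * v k x)"
    by (intro L2_norm_cong_AE expansion[OF f] L2_measurable fL L2_sum L2_scale v_L2)
  then have nf: "(L2_norm M f)\<^sup>2 = (\<Sum>k=1..q. (cmod (L2_inner M (v k) f))\<^sup>2)"
    by (simp only: norm_expansion)
  have "(L2_norm M (D \<phi> f))\<^sup>2 = (\<Sum>k=1..q. (cmod (\<phi> (\<theta> k / h)))\<^sup>2 * (cmod (L2_inner M (v k) f))\<^sup>2)"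
    unfolding D_alt norm_expansion by (simp add: norm_mult power_mult_distrib)
  also have "\<dots> \<le> (\<Sum>k=1..q. K\<^sup>2 * (cmod (L2_inner M (v k) f))\<^sup>2)"
    using K by (intro sum_mono mult_right_mono power_mono) auto
  also have "\<dots> = (K * L2_norm M f)\<^sup>2" by (simp add: nf sum_distrib_left power_mult_distrib)
  finally show "(L2_norm M (D \<phi> f))\<^sup>2 \<le> (K * L2_norm M f)\<^sup>2" .
qed (use \<open>0 \<le> K\<close> in simp)

lemma inner_v_D: "j \<in> {1..q} \<Longrightarrow> L2_inner M (v j) (D \<phi> f) = \<phi> (\<theta> j / h) * L2_inner M (v j) f"
proof -
  assume j: "j \<in> {1..q}"
  have "L2_inner M (v j) (D \<phi> f) = (\<Sum>k=1..q. (\<phi> (\<theta> k / h) * L2_inner M (v k) f) * L2_inner M (v j) (v k))"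
    unfolding D_alt using j by (subst L2_inner_sum_right) (auto intro!: L2_scale v_L2 simp: L2_inner_scale_right)
  also have "\<dots> = (\<Sum>k=1..q. if k = j then \<phi> (\<theta> j / h) * L2_inner M (v j) f else 0)"
    using j by (intro sum.cong) (auto simp: v_orthonormal)
  also have "\<dots> = \<phi> (\<theta> j / h) * L2_inner M (v j) f" using j by simp
  finally show ?thesis .
qed

lemma D_mult: "D \<phi> (D \<psi> f) = D (\<lambda>\<omega>. \<phi> \<omega> * \<psi> \<omega>) f"
  by (rule ext, simp only: D_alt[of \<phi> "D \<psi> f"] D_alt[of "\<lambda>\<omega>. \<phi> \<omega> * \<psi> \<omega>"], intro sum.cong)
    (simp_all add: inner_v_D mult.assoc)

lemma D_linear: "D (\<lambda>\<omega>. a * \<phi> \<omega> + b * \<psi> \<omega>) f = (\<lambda>x. a * D \<phi> f x + b * D \<psi> f x)"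
  unfolding D_alt by (simp add: algebra_simps sum.distrib sum_distrib_left)

lemma D_diff_arg:
  assumes "f \<in> L2 M" "g \<in> L2 M"
  shows "D \<phi> (\<lambda>x. f x - g x) = (\<lambda>x. D \<phi> f x - D \<phi> g x)"
proof -
  have *: "L2_inner M (v k) (\<lambda>x. f x - g x) = L2_inner M (v k) f - L2_inner M (v k) g" if "k \<in> {1..q}" for k
    using that by (intro L2_inner_diff_right v_L2 assms)
  then have "D \<phi> (\<lambda>x. f x - g x) x = (\<Sum>k=1..q. (\<phi> (\<theta> k / h) * L2_inner M (v k) f) * v k x -
      (\<phi> (\<theta> k / h) * L2_inner M (v k) g) * v k x)" for x
    unfolding D_alt
  proof (intro sum.cong refl)
    fix k assume k: "k \<in> {1..q}"
    show "\<phi> (\<theta> k / h) * L2_inner M (v k) (\<lambda>x. f x - g x) * v k x = (\<phi> (\<theta> k / h) * L2_inner M (v k) f) * v k x -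
      (\<phi> (\<theta> k / h) * L2_inner M (v k) g) * v k x"
      unfolding *[OF k] by (simp add: algebra_simps)
  qed
  then show ?thesis unfolding D_alt by (simp add: sum_subtractf)
qed

lemma D_one: "AE x in M. D (\<lambda>\<omega>. 1) f x = f x" if "f \<in> L2_cells M P"
  using expansion[OF that] by eventually_elim (simp add: D_alt)

text \<open>A further step multiplies each coefficient by its eigenvalue, and the step size
  \<open>h\<close> cancels between the frequency \<open>\<theta> k / h\<close> and the elapsed
  time.\<close>

lemma Uk_spectral:
  assumes f: "f \<in> L2_cells M P"
  shows "AE x in M. Uk j f x = D (\<lambda>\<omega>. exp (\<i> * of_real (\<omega> * (h * real j)))) f x"
proof (induction j)
  case 0
  have "Uk 0 f = W f" by (rule ext) (simp add: Uk_sum averaging_def del: of_nat_0)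
  then show ?case using averaging_id[OF f] D_one[OF f] by auto
next
  case (Suc j)
  let ?e = "\<lambda>j \<omega>. exp (\<i> * complex_of_real (\<omega> * (h * real j)))"
  let ?c = "\<lambda>k. ?e j (\<theta> k / h) * L2_inner M (v k) f"
  have "Uk (Suc j) f = Uk 1 (D (?e j) f)"
    unfolding Uk_Suc by (intro Uk_cong_AE Uk_L2 D_L2 Suc)
  then have eq: "Uk (Suc j) f x = (\<Sum>k=1..q. ?c k * Uk 1 (v k) x)" for x
    unfolding D_alt by (simp only: Uk_sum_arg v_L2)
  have "AE x in M. \<forall>k\<in>{1..q}. Uk 1 (v k) x = exp (\<i> * of_real (\<theta> k)) * v k x"
  proof (intro AE_finite_allI)
    fix k assume "k \<in> {1..q}"
    then show "AE x in M. Uk 1 (v k) x = exp (\<i> * of_real (\<theta> k)) * v k x"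
      using eigenbasis by (simp add: koopman_eigenbasis_def)
  qed simp
  then show ?case
  proof eventually_elim
    fix x assume *: "\<forall>k\<in>{1..q}. Uk 1 (v k) x = exp (\<i> * of_real (\<theta> k)) * v k x"
    have "Uk (Suc j) f x = (\<Sum>k=1..q. (?e (Suc j) (\<theta> k / h) * L2_inner M (v k) f) * v k x)"
      unfolding eq
    proof (intro sum.cong refl)
      fix k assume k: "k \<in> {1..q}"
      have "?e (Suc j) (\<theta> k / h) = ?e j (\<theta> k / h) * exp (\<i> * of_real (\<theta> k))"
        unfolding exp_add[symmetric] using h_pos by (simp add: algebra_simps)
      then show "?c k * Uk 1 (v k) x = (?e (Suc j) (\<theta> k / h) * L2_inner M (v k) f) * v k x"
        unfolding bspec[OF * k] by (simp only: ac_simps)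
    qed
    then show "Uk (Suc j) f x = D (?e (Suc j)) f x" by (simp only: D_alt)
  qed
qed

lemma inner_D: "y \<in> L2 M \<Longrightarrow> L2_inner M y (D \<phi> f) = (\<Sum>k=1..q. \<phi> (\<theta> k / h) * (L2_inner M (v k) f * L2_inner M y (v k)))"
  unfolding D_alt by (subst L2_inner_sum_right) (auto intro!: L2_scale v_L2 simp: L2_inner_scale_right mult.assoc)

text \<open>Only finitely many frequencies occur, so the time integral is taken coefficient by
  coefficient. Converting the step count to a natural number loses nothing, as the weight vanishes
  for \<open>t \<le> 0\<close>.\<close>

lemma step_kernel_inner:
  assumes y: "y \<in> L2 M" and f: "f \<in> L2_cells M P"
  shows "integrable lborel (\<lambda>t. of_real (expw t) * L2_inner M y (Uk (nat \<lceil>t / h\<rceil>) f))"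
    and "(LINT t|lborel. of_real (expw t) * L2_inner M y (Uk (nat \<lceil>t / h\<rceil>) f)) = L2_inner M y (D (step_kernel h) f)"
proof -
  define a where "a k = L2_inner M (v k) f * L2_inner M y (v k)" for k
  let ?g = "\<lambda>k t. of_real (expw t) * exp (\<i> * of_real (\<theta> k / h * (h * of_int \<lceil>t / h\<rceil>)))"
  have eq: "of_real (expw t) * L2_inner M y (Uk (nat \<lceil>t / h\<rceil>) f) = (\<Sum>k=1..q. ?g k t * a k)" for t
  proof (cases "0 < t")
    case True
    let ?j = "nat \<lceil>t / h\<rceil>"
    have "0 \<le> \<lceil>t / h\<rceil>" using True h_pos by (simp add: zero_le_ceiling divide_pos_pos less_trans[of "-1" 0])
    then have j: "real ?j = of_int \<lceil>t / h\<rceil>" by simp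
    have "L2_inner M y (Uk ?j f) = L2_inner M y (D (\<lambda>\<omega>. exp (\<i> * of_real (\<omega> * (h * real ?j)))) f)"
      by (rule L2_inner_cong_AE[OF _ _ AE_I2[OF refl] _ _ Uk_spectral[OF f]]) (intro L2_measurable y Uk_L2 D_L2)+
    then show ?thesis unfolding inner_D[OF y] j by (simp add: a_def sum_distrib_left mult.assoc)
  next
    case False
    then show ?thesis by (simp add: expw_def)
  qed
  have i: "integrable lborel (?g k)" for k
    by (rule expw_mult_integrable[of _ 1]) auto
  show "integrable lborel (\<lambda>t. of_real (expw t) * L2_inner M y (Uk (nat \<lceil>t / h\<rceil>) f))"
    unfolding eq by (intro Bochner_Integration.integrable_sum integrable_mult_left i)
  have "(LINT t|lborel. of_real (expw t) * L2_inner M y (Uk (nat \<lceil>t / h\<rceil>) f)) = (\<Sum>k=1..q. step_kernel h (\<theta> k / h) * a k)"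
    unfolding eq step_kernel_def
    by (subst Bochner_Integration.integral_sum) (intro integrable_mult_left i, simp only: integral_mult_left_zero)
  then show "(LINT t|lborel. of_real (expw t) * L2_inner M y (Uk (nat \<lceil>t / h\<rceil>) f)) = L2_inner M y (D (step_kernel h) f)"
    by (simp add: inner_D[OF y] a_def)
qed

text \<open>Eigenphases lie in \<open>[- pi, pi)\<close>, so every eigenfrequency meets the band
  condition of \<open>step_kernel_resolvent\<close>. The error is therefore uniform over a spectrum
  that may spread without bound as the step shrinks.\<close>

lemma D_resolvent_step_kernel:
  assumes f: "f \<in> L2_cells M P" and "h \<le> 1"
  shows "L2_norm M (\<lambda>x. D (step_kernel h) f x - D resolvent f x) \<le> 30 * h * L2_norm M f"
proof -
  have "(\<lambda>x. D (step_kernel h) f x - D resolvent f x) = D (\<lambda>\<omega>. step_kernel h \<omega> - resolvent \<omega>) f"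
    using D_linear[of 1 "step_kernel h" "-1" resolvent f] by simp
  moreover have "L2_norm M (D (\<lambda>\<omega>. step_kernel h \<omega> - resolvent \<omega>) f) \<le> 30 * h * L2_norm M f"
  proof (rule D_norm_le[OF f])
    fix k assume "k \<in> {1..q}"
    then have "- pi \<le> \<theta> k \<and> \<theta> k < pi" using eigenbasis unfolding koopman_eigenbasis_def by blast
    then show "cmod (step_kernel h (\<theta> k / h) - resolvent (\<theta> k / h)) \<le> 30 * h"
      using h_pos \<open>h \<le> 1\<close> by (intro step_kernel_resolvent) auto
  qed (use h_pos in simp)
  ultimately show ?thesis by simp
qed

end

section \<open>Lipschitz flows and the Hausdorff distance\<close>

text \<open>The Hausdorff distance is measured in \<open>\<nu>\<close>, while thickenings and
  continuity use the Euclidean distance. The upper bound expands in the basis; the lower one is the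
  minimum of \<open>\<nu>\<close> over the compact unit sphere.\<close>

lemma is_norm_equivalent:
  fixes \<nu> :: "'b::euclidean_space \<Rightarrow> real"
  assumes "is_norm \<nu>"
  obtains c C where "0 < c" "0 < C" "\<And>x. c * norm x \<le> \<nu> x" "\<And>x. \<nu> x \<le> C * norm x"
proof -
  have nn: "0 \<le> \<nu> x" and z: "\<nu> x = 0 \<longleftrightarrow> x = 0" and sc: "\<nu> (r *\<^sub>R x) = \<bar>r\<bar> * \<nu> x" and tri: "\<nu> (x + y) \<le> \<nu> x + \<nu> y"
    for x y :: 'b and r :: real using assms by (auto simp: is_norm_def)
  have z0: "\<nu> 0 = 0" using z[of 0] by simp
  have sum: "\<nu> (\<Sum>i\<in>I. f i) \<le> (\<Sum>i\<in>I. \<nu> (f i))" for I and f :: "'b \<Rightarrow> 'b"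
  proof (induction I rule: infinite_finite_induct)
    case (insert i I)
    then show ?case using tri[of "f i" "\<Sum>i\<in>I. f i"] by simp
  qed (simp_all add: z0)
  define C where "C = (\<Sum>b\<in>Basis. \<nu> (b::'b)) + 1"
  have C: "0 < C" unfolding C_def using nn by (simp add: add_nonneg_pos sum_nonneg)
  have up: "\<nu> x \<le> C * norm x" for x
  proof -
    have "\<nu> x = \<nu> (\<Sum>b\<in>Basis. (x \<bullet> b) *\<^sub>R b)" by (simp add: euclidean_representation)
    also have "\<dots> \<le> (\<Sum>b\<in>Basis. \<bar>x \<bullet> b\<bar> * \<nu> b)" using sum[of "\<lambda>b. (x \<bullet> b) *\<^sub>R b" Basis] by (simp add: sc)
    also have "\<dots> \<le> (\<Sum>b\<in>Basis. norm x * \<nu> b)" using nn by (intro sum_mono mult_right_mono Basis_le_norm)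
    also have "\<dots> = (\<Sum>b\<in>Basis. \<nu> (b::'b)) * norm x" by (simp add: sum_distrib_left mult.commute)
    also have "\<dots> \<le> C * norm x" by (simp add: C_def distrib_right)
    finally show ?thesis .
  qed
  have lip: "\<bar>\<nu> x - \<nu> y\<bar> \<le> C * dist x y" for x y
  proof -
    have "\<nu> x \<le> \<nu> (x - y) + \<nu> y" "\<nu> y \<le> \<nu> (y - x) + \<nu> x" using tri[of "x - y" y] tri[of "y - x" x] by simp_all
    then show ?thesis using up[of "x - y"] up[of "y - x"] by (simp add: dist_norm norm_minus_commute abs_le_iff)
  qed
  have cont: "continuous_on (sphere 0 1) \<nu>"
    by (rule lipschitz_on_continuous_on[of C]) (use lip C in \<open>auto simp: lipschitz_on_def dist_real_def\<close>)
  have "sphere (0::'b) 1 \<noteq> {}" by simp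
  then obtain u where u: "u \<in> sphere 0 1" "\<And>y. y \<in> sphere 0 1 \<Longrightarrow> \<nu> u \<le> \<nu> y"
    using continuous_attains_inf[OF compact_sphere _ cont] by blast
  have "u \<noteq> 0" using u(1) by auto
  then have c: "0 < \<nu> u" using nn[of u] z[of u] by linarith
  have low: "\<nu> u * norm x \<le> \<nu> x" for x
  proof (cases "x = 0")
    case False
    then have "\<nu> u \<le> \<nu> ((1 / norm x) *\<^sub>R x)" by (intro u(2)) simp
    also have "\<dots> = \<nu> x / norm x" by (simp add: sc)
    finally show ?thesis using False by (simp add: pos_le_divide_eq)
  qed (use nn in simp)
  show thesis by (rule that[OF c C low up])
qed

section \<open>Lipschitz flows preserving a finite measure on a compact set\<close>

locale compact_flow = finite_measure M
  for M :: "'b::euclidean_space measure" +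
  fixes X :: "'b set" and \<nu> :: "'b \<Rightarrow> real" and S :: "real \<Rightarrow> 'b \<Rightarrow> 'b"
  assumes compact_X: "compact X" and norm_\<nu>: "is_norm \<nu>"
    and flow: "lipschitz_flow_on \<nu> X S"
    and space_X: "space M = X" and sets_X: "sets M = sets (restrict_space borel X)"
    and M_nonzero: "emeasure M X \<noteq> 0"
    and invariant: "flow_invariant M S"
begin

lemma measure_pos: "0 < measure M (space M)"
  using M_nonzero by (simp add: space_X measure_def enn2real_positive_iff less_top[symmetric] zero_less_iff_neq_zero)

lemma flow_in: "x \<in> X \<Longrightarrow> S t x \<in> X"
  using flow by (auto simp: lipschitz_flow_on_def)

lemma flow_inverse: "x \<in> X \<Longrightarrow> S t (S (- t) x) = x" "x \<in> X \<Longrightarrow> S (- t) (S t x) = x"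
  using flow by (auto simp: lipschitz_flow_on_def)

lemma flow_lipschitz:
  obtains L where "0 < L" "\<And>t s x y. \<bar>t\<bar> \<le> T \<Longrightarrow> \<bar>s\<bar> \<le> T \<Longrightarrow> x \<in> X \<Longrightarrow> y \<in> X \<Longrightarrow>
    norm (S t x - S s y) \<le> L * (\<bar>t - s\<bar> + norm (x - y))"
proof -
  obtain c C where cC: "0 < c" "0 < C" "\<And>x. c * norm x \<le> \<nu> x" "\<And>x. \<nu> x \<le> C * norm x"
    using is_norm_equivalent[OF norm_\<nu>] by metis
  have "0 < max T 1" by simp
  then obtain K where K: "\<And>t s x y. t \<in> {- max T 1..max T 1} \<Longrightarrow> s \<in> {- max T 1..max T 1} \<Longrightarrow> x \<in> X \<Longrightarrow> y \<in> X \<Longrightarrow>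
      \<nu> (S t x - S s y) \<le> K * (\<bar>t - s\<bar> + \<nu> (x - y))"
    using flow unfolding lipschitz_flow_on_def by meson
  \<comment> \<open>The given constant has unknown sign; \<open>\<bar>K\<bar> + 1\<close> makes it
    positive, and \<open>(1 + C) / c\<close> converts between the norms.\<close>
  define L where "L = (\<bar>K\<bar> + 1) * (1 + C) / c"
  have L: "0 < L" using cC by (simp add: L_def add_nonneg_pos)
  have "norm (S t x - S s y) \<le> L * (\<bar>t - s\<bar> + norm (x - y))"
    if "\<bar>t\<bar> \<le> T" "\<bar>s\<bar> \<le> T" "x \<in> X" "y \<in> X" for t s x y
  proof -
    define r where "r = \<bar>t - s\<bar> + norm (x - y)"
    have "c * norm (S t x - S s y) \<le> \<nu> (S t x - S s y)" by (rule cC)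
    also have "\<dots> \<le> K * (\<bar>t - s\<bar> + \<nu> (x - y))" using that by (intro K) auto
    also have "\<dots> \<le> (\<bar>K\<bar> + 1) * (\<bar>t - s\<bar> + \<nu> (x - y))"
      using norm_\<nu> by (intro mult_right_mono) (auto simp: is_norm_def)
    also have "\<dots> \<le> (\<bar>K\<bar> + 1) * ((1 + C) * r)"
    proof (intro mult_left_mono)
      have "\<bar>t - s\<bar> + \<nu> (x - y) \<le> \<bar>t - s\<bar> + C * norm (x - y)" using cC(4)[of "x - y"] by simp
      also have "\<dots> \<le> (1 + C) * \<bar>t - s\<bar> + (1 + C) * norm (x - y)"
        using cC(2) by (intro add_mono mult_right_mono) (auto simp: distrib_right)
      finally show "\<bar>t - s\<bar> + \<nu> (x - y) \<le> (1 + C) * r" by (simp add: r_def distrib_left)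
    qed simp
    finally have "c * norm (S t x - S s y) \<le> (\<bar>K\<bar> + 1) * (1 + C) * r" by (simp add: mult.assoc)
    then show ?thesis using cC(1) unfolding L_def r_def[symmetric] by (simp add: field_simps)
  qed
  then show thesis using that L by blast
qed

lemma flow_continuous: "continuous_on X (S t)"
proof -
  obtain L where L: "0 < L" "\<And>t' s x y. \<bar>t'\<bar> \<le> \<bar>t\<bar> \<Longrightarrow> \<bar>s\<bar> \<le> \<bar>t\<bar> \<Longrightarrow> x \<in> X \<Longrightarrow> y \<in> X \<Longrightarrow>
    norm (S t' x - S s y) \<le> L * (\<bar>t' - s\<bar> + norm (x - y))" using flow_lipschitz by blast
  have "L-lipschitz_on X (S t)"
    using L(1) L(2)[of t t] by (auto simp: lipschitz_on_def dist_norm)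
  then show ?thesis by (rule lipschitz_on_continuous_on)
qed

lemma flow_image_compact: "compact A \<Longrightarrow> A \<subseteq> X \<Longrightarrow> compact (S t ` A)"
  by (rule compact_continuous_image[OF continuous_on_subset[OF flow_continuous]])

lemma closed_X: "closed X"
  using compact_X by (rule compact_imp_closed)

lemma compact_sets: "compact A \<Longrightarrow> A \<subseteq> X \<Longrightarrow> A \<in> sets M"
  by (auto simp: sets_X sets_restrict_space intro!: image_eqI[of _ _ A] borel_compact)

text \<open>The image under \<open>S t\<close> is the preimage under its continuous inverse
  \<open>S (- t)\<close>.\<close>

lemma flow_image_sets:
  assumes B: "B \<in> sets M"
  shows "S t ` B \<in> sets M"
proof -
  have BX: "B \<subseteq> X" using sets.sets_into_space[OF B] space_X by simp
  have "S (- t) \<in> measurable (restrict_space borel X) (restrict_space borel X)"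
    by (intro measurable_restrict_space2 borel_measurable_continuous_on_restrict flow_continuous)
      (auto simp: flow_in space_restrict_space)
  then have "S (- t) \<in> measurable M M" by (simp cong: measurable_cong_sets add: sets_X)
  from measurable_sets[OF this B] have "S (- t) -` B \<inter> X \<in> sets M" by (simp add: space_X)
  moreover have "S (- t) -` B \<inter> X = S t ` B"
  proof (intro equalityI subsetI)
    fix x assume x: "x \<in> S (- t) -` B \<inter> X"
    then have "S t (S (- t) x) \<in> S t ` B" by auto
    then show "x \<in> S t ` B" using flow_inverse(1)[of x t] x by simp
  next
    fix x assume "x \<in> S t ` B"
    then obtain y where "y \<in> B" "x = S t y" by blast
    then show "x \<in> S (- t) -` B \<inter> X" using BX flow_inverse(2)[of y t] flow_in[of y t] by auto
  qed
  ultimately show ?thesis by simp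
qed

lemma flow_image_measure: "B \<in> sets M \<Longrightarrow> measure M (S t ` B) = measure M B"
  using invariant by (simp add: flow_invariant_def measure_def)

lemma koopman_indicator:
  assumes "A \<subseteq> X" "x \<in> X"
  shows "koopman S t (indicator A) x = indicator (S (- t) ` A) x"
proof -
  have "S t x \<in> A \<longleftrightarrow> x \<in> S (- t) ` A"
  proof
    assume "S t x \<in> A"
    then have "S (- t) (S t x) \<in> S (- t) ` A" by (rule imageI)
    then show "x \<in> S (- t) ` A" using flow_inverse(2)[OF assms(2), of t] by simp
  next
    assume "x \<in> S (- t) ` A"
    then obtain y where "y \<in> A" "x = S (- t) y" by blast
    then show "S t x \<in> A" using flow_inverse(1)[of y t] assms(1) by auto
  qed
  then show ?thesis by (simp add: koopman_def indicator_def)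
qed

section \<open>Thickenings and the Hausdorff distance\<close>

definition thickening :: "real \<Rightarrow> 'b set \<Rightarrow> 'b set" where
  "thickening \<delta> A = {x \<in> X. infdist x A \<le> \<delta>}"

lemma thickening_sets: "thickening \<delta> A \<in> sets M"
proof -
  have "closed {x. infdist x A \<le> \<delta>}" by (intro closed_Collect_le continuous_intros)
  moreover have "thickening \<delta> A = X \<inter> {x. infdist x A \<le> \<delta>}" by (auto simp: thickening_def)
  ultimately show ?thesis by (auto simp: sets_X sets_restrict_space)
qed

text \<open>The thickenings decrease to the closed set \<open>A\<close>, and a finite measure is
  continuous from above. Hausdorff closeness controls such outer neighbourhoods, whereas the measure
  of a set is not continuous for the Hausdorff distance.\<close>

lemma thickening_small:
  assumes A: "compact A" "A \<noteq> {}" "A \<subseteq> X" and "0 < \<epsilon>"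
  obtains \<delta> where "0 < \<delta>" "measure M (thickening \<delta> A - A) < \<epsilon>"
proof -
  define N where "N i = thickening (inverse (real (Suc i))) A - A" for i
  have N: "range N \<subseteq> sets M" using thickening_sets compact_sets[OF A(1,3)] by (auto simp: N_def)
  have "decseq N"
    by (rule antimonoI) (auto simp: N_def thickening_def intro: order_trans le_imp_inverse_le)
  moreover have "(\<Inter>i. N i) = {}"
  proof (rule ccontr)
    assume "(\<Inter>i. N i) \<noteq> {}"
    then obtain x where x: "\<And>i. x \<in> N i" by blast
    have le: "infdist x A \<le> inverse (real (Suc i))" and nA: "x \<notin> A" for i
      using x[of i] by (simp_all add: N_def thickening_def)
    have "infdist x A \<le> 0"
      by (rule LIMSEQ_le_const[OF LIMSEQ_inverse_real_of_nat]) (intro exI[of _ 0] allI impI le)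
    then have "infdist x A = 0" using infdist_nonneg[of x A] by (rule antisym)
    then show False using in_closed_iff_infdist_zero[OF compact_imp_closed[OF A(1)] A(2)] nA by simp
  qed
  ultimately have "(\<lambda>i. measure M (N i)) \<longlonglongrightarrow> 0"
    using finite_Lim_measure_decseq[OF N] by simp
  from order_tendstoD(2)[OF this \<open>0 < \<epsilon>\<close>] obtain i where "measure M (N i) < \<epsilon>"
    using eventually_happens'[OF sequentially_bot] by blast
  then show thesis using that[of "inverse (real (Suc i))"] by (simp add: N_def)
qed

text \<open>Suprema in the Hausdorff distance are taken in the reals and are meaningful only when
  bounded; compactness of \<open>X\<close> provides one bound for all sets involved.\<close>

lemma bounded_differences:
  obtains K where "\<And>x y. x \<in> X \<Longrightarrow> y \<in> X \<Longrightarrow> \<nu> (x - y) \<le> K"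
proof -
  obtain c C where cC: "0 < c" "0 < C" "\<And>x. c * norm x \<le> \<nu> x" "\<And>x. \<nu> x \<le> C * norm x"
    using is_norm_equivalent[OF norm_\<nu>] by metis
  obtain B where B: "\<And>x. x \<in> X \<Longrightarrow> norm x \<le> B"
    using compact_imp_bounded[OF compact_X] by (auto simp: bounded_iff)
  have "\<nu> (x - y) \<le> C * (B + B)" if "x \<in> X" "y \<in> X" for x y
  proof -
    have "norm (x - y) \<le> B + B" using norm_triangle_ineq4[of x y] B[OF that(1)] B[OF that(2)] by linarith
    then have "C * norm (x - y) \<le> C * (B + B)" using cC(2) by (intro mult_left_mono) auto
    then show ?thesis using cC(4)[of "x - y"] by linarith
  qed
  then show thesis by (rule that)
qed

lemma \<nu>_nonneg: "0 \<le> \<nu> x"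
  using norm_\<nu> by (simp add: is_norm_def)

lemma \<nu>_triangle: "\<nu> (x - z) \<le> \<nu> (x - y) + \<nu> (y - z)"
proof -
  have "\<nu> ((x - y) + (y - z)) \<le> \<nu> (x - y) + \<nu> (y - z)" using norm_\<nu> unfolding is_norm_def by blast
  then show ?thesis by simp
qed

lemma INF_\<nu>:
  assumes "B \<noteq> {}"
  shows "0 \<le> (INF b\<in>B. \<nu> (f b))" "b \<in> B \<Longrightarrow> (INF b\<in>B. \<nu> (f b)) \<le> \<nu> (f b)"
    and "(\<And>b. b \<in> B \<Longrightarrow> \<nu> (f b) \<le> \<nu> (g b) + \<eta>) \<Longrightarrow> (INF b\<in>B. \<nu> (f b)) \<le> (INF b\<in>B. \<nu> (g b)) + \<eta>"
proof -
  have bdd: "bdd_below ((\<lambda>b. \<nu> (f b)) ` B)" for f :: "_ \<Rightarrow> 'b"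
    using \<nu>_nonneg by (intro bdd_belowI[of _ 0]) auto
  show "0 \<le> (INF b\<in>B. \<nu> (f b))" using assms \<nu>_nonneg by (intro cINF_greatest)
  have le: "(INF b\<in>B. \<nu> (f b)) \<le> \<nu> (f b)" if "b \<in> B" for b using bdd that by (rule cINF_lower)
  show "(INF b\<in>B. \<nu> (f b)) \<le> \<nu> (f b)" if "b \<in> B" using that by (rule le)
  assume *: "\<And>b. b \<in> B \<Longrightarrow> \<nu> (f b) \<le> \<nu> (g b) + \<eta>"
  have "(INF b\<in>B. \<nu> (f b)) - \<eta> \<le> (INF b\<in>B. \<nu> (g b))"
  proof (rule cINF_greatest[OF assms])
    fix b assume b: "b \<in> B"
    show "(INF b\<in>B. \<nu> (f b)) - \<eta> \<le> \<nu> (g b)" using le[OF b] *[OF b] by linarith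
  qed
  then show "(INF b\<in>B. \<nu> (f b)) \<le> (INF b\<in>B. \<nu> (g b)) + \<eta>" by simp
qed

lemma bdd_above_INF:
  assumes "B \<noteq> {}" "\<And>a b. a \<in> A \<Longrightarrow> b \<in> B \<Longrightarrow> \<nu> (f a b) \<le> K"
  shows "bdd_above ((\<lambda>a. INF b\<in>B. \<nu> (f a b)) ` A)"
proof (intro bdd_aboveI2[of _ _ K])
  fix a assume a: "a \<in> A"
  obtain b where "b \<in> B" using assms by blast
  then show "(INF b\<in>B. \<nu> (f a b)) \<le> K" using INF_\<nu>(2)[OF assms(1), of b "f a"] assms(2)[OF a] by force
qed

text \<open>Converts a small Hausdorff distance into membership in a Euclidean thickening: the
  distance of \<open>b\<close> from \<open>A\<close> is one of the values in the second
  supremum.\<close>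

lemma hausdorff_ge:
  assumes c: "\<And>x. c * norm x \<le> \<nu> x" "0 < c"
    and A: "A \<noteq> {}" "A \<subseteq> X" and B: "b \<in> B" "B \<subseteq> X"
  shows "c * infdist b A \<le> hausdorff_dist \<nu> A B"
proof -
  obtain K where K: "\<And>x y. x \<in> X \<Longrightarrow> y \<in> X \<Longrightarrow> \<nu> (x - y) \<le> K" using bounded_differences by blast
  have "c * infdist b A \<le> (INF a\<in>A. \<nu> (a - b))"
  proof (rule cINF_greatest[OF A(1)])
    fix a assume "a \<in> A"
    then have "infdist b A \<le> norm (a - b)" using infdist_le[of a A b] by (simp add: dist_norm norm_minus_commute)
    then have "c * infdist b A \<le> c * norm (a - b)" using c(2) by (intro mult_left_mono) auto
    then show "c * infdist b A \<le> \<nu> (a - b)" using c(1)[of "a - b"] by linarith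
  qed
  also have "\<dots> \<le> (SUP b\<in>B. INF a\<in>A. \<nu> (a - b))"
    using A B K by (intro cSUP_upper bdd_above_INF[where K=K]) auto
  also have "\<dots> \<le> hausdorff_dist \<nu> A B" by (simp add: hausdorff_dist_def)
  finally show ?thesis .
qed

lemma hausdorff_bounds:
  assumes K: "\<And>x y. x \<in> X \<Longrightarrow> y \<in> X \<Longrightarrow> \<nu> (x - y) \<le> K"
    and A: "A \<noteq> {}" "A \<subseteq> X" and B: "B \<noteq> {}" "B \<subseteq> X"
  shows "0 \<le> hausdorff_dist \<nu> A B" "hausdorff_dist \<nu> A B \<le> K"
proof -
  obtain a b where ab: "a \<in> A" "b \<in> B" using A B by blast
  have "0 \<le> (INF b\<in>B. \<nu> (a - b))" using INF_\<nu>(1)[OF B(1)] .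
  also have "\<dots> \<le> (SUP a\<in>A. INF b\<in>B. \<nu> (a - b))"
    using A B K ab by (intro cSUP_upper bdd_above_INF[where K=K]) auto
  finally show "0 \<le> hausdorff_dist \<nu> A B" by (simp add: hausdorff_dist_def)
  have "(INF b\<in>B. \<nu> (x - b)) \<le> K" if "x \<in> A" for x
    using INF_\<nu>(2)[OF B(1) ab(2), of "\<lambda>b. x - b"] K[of x b] ab that A B by force
  moreover have "(INF a\<in>A. \<nu> (a - y)) \<le> K" if "y \<in> B" for y
    using INF_\<nu>(2)[OF A(1) ab(1), of "\<lambda>a. a - y"] K[of a y] ab that A B by force
  ultimately show "hausdorff_dist \<nu> A B \<le> K"
    unfolding hausdorff_dist_def using A B by (intro max.boundedI cSUP_least) auto
qed

lemma hausdorff_flow_le: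
  assumes A: "A \<noteq> {}" "A \<subseteq> X" and B: "B \<noteq> {}" "B \<subseteq> X"
    and \<eta>: "\<And>x. x \<in> A \<Longrightarrow> \<nu> (S s x - S s' x) \<le> \<eta>"
  shows "hausdorff_dist \<nu> (S s ` A) B \<le> hausdorff_dist \<nu> (S s' ` A) B + \<eta>"
proof -
  obtain K where K: "\<And>x y. x \<in> X \<Longrightarrow> y \<in> X \<Longrightarrow> \<nu> (x - y) \<le> K" using bounded_differences by blast
  have AX: "S t x \<in> X" if "x \<in> A" for t x using flow_in A that by auto
  have tri: "\<nu> (S s x - b) \<le> \<nu> (S s' x - b) + \<eta>" if "x \<in> A" for x b
    using \<nu>_triangle[of "S s x" b "S s' x"] \<eta>[OF that] by linarith
  have "(SUP x\<in>A. INF b\<in>B. \<nu> (S s x - b)) \<le> (SUP x\<in>A. INF b\<in>B. \<nu> (S s' x - b)) + \<eta>"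
  proof (rule cSUP_least[OF A(1)])
    fix x assume x: "x \<in> A"
    have "(INF b\<in>B. \<nu> (S s x - b)) \<le> (INF b\<in>B. \<nu> (S s' x - b)) + \<eta>"
      using tri[OF x] by (intro INF_\<nu>(3) B)
    also have "(INF b\<in>B. \<nu> (S s' x - b)) \<le> (SUP x\<in>A. INF b\<in>B. \<nu> (S s' x - b))"
      using x B K AX by (intro cSUP_upper bdd_above_INF[where K=K]) auto
    finally show "(INF b\<in>B. \<nu> (S s x - b)) \<le> (SUP x\<in>A. INF b\<in>B. \<nu> (S s' x - b)) + \<eta>" by simp
  qed
  moreover have "(SUP b\<in>B. INF x\<in>A. \<nu> (S s x - b)) \<le> (SUP b\<in>B. INF x\<in>A. \<nu> (S s' x - b)) + \<eta>"
  proof (rule cSUP_least[OF B(1)])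
    fix b assume b: "b \<in> B"
    have "(INF x\<in>A. \<nu> (S s x - b)) \<le> (INF x\<in>A. \<nu> (S s' x - b)) + \<eta>"
      using tri by (intro INF_\<nu>(3) A)
    also have "(INF x\<in>A. \<nu> (S s' x - b)) \<le> (SUP b\<in>B. INF x\<in>A. \<nu> (S s' x - b))"
      using b A B K AX by (intro cSUP_upper bdd_above_INF[where K=K]) auto
    finally show "(INF x\<in>A. \<nu> (S s x - b)) \<le> (SUP b\<in>B. INF x\<in>A. \<nu> (S s' x - b)) + \<eta>" by simp
  qed
  ultimately show ?thesis
    unfolding hausdorff_dist_def image_image by (simp add: max_def)
qed

lemma hausdorff_flow_continuous:
  assumes A: "A \<noteq> {}" "A \<subseteq> X" and B: "B \<noteq> {}" "B \<subseteq> X"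
  shows "continuous_on UNIV (\<lambda>s. hausdorff_dist \<nu> (S s ` A) B)"
proof -
  obtain c C where cC: "0 < c" "0 < C" "\<And>x. c * norm x \<le> \<nu> x" "\<And>x. \<nu> x \<le> C * norm x"
    using is_norm_equivalent[OF norm_\<nu>] by metis
  have "isCont (\<lambda>s. hausdorff_dist \<nu> (S s ` A) B) s0" for s0
  proof -
    define T where "T = \<bar>s0\<bar> + 1"
    obtain L where L: "0 < L" "\<And>t s x y. \<bar>t\<bar> \<le> T \<Longrightarrow> \<bar>s\<bar> \<le> T \<Longrightarrow> x \<in> X \<Longrightarrow> y \<in> X \<Longrightarrow>
      norm (S t x - S s y) \<le> L * (\<bar>t - s\<bar> + norm (x - y))" using flow_lipschitz by blast
    have one: "hausdorff_dist \<nu> (S s ` A) B \<le> hausdorff_dist \<nu> (S s' ` A) B + C * L * \<bar>s - s'\<bar>"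
      if "\<bar>s\<bar> \<le> T" "\<bar>s'\<bar> \<le> T" for s s'
    proof (rule hausdorff_flow_le[OF A B])
      fix x assume "x \<in> A"
      then have "norm (S s x - S s' x) \<le> L * \<bar>s - s'\<bar>" using L(2)[OF that, of x x] A by auto
      then have "C * norm (S s x - S s' x) \<le> C * (L * \<bar>s - s'\<bar>)" using cC(2) by (intro mult_left_mono) auto
      then show "\<nu> (S s x - S s' x) \<le> C * L * \<bar>s - s'\<bar>" using cC(4)[of "S s x - S s' x"] by (simp add: mult.assoc)
    qed
    have "(C * L)-lipschitz_on {-T<..<T} (\<lambda>s. hausdorff_dist \<nu> (S s ` A) B)"
    proof (rule lipschitz_onI)
      fix s s' assume "s \<in> {-T<..<T}" "s' \<in> {-T<..<T}"
      then have "\<bar>s\<bar> \<le> T" "\<bar>s'\<bar> \<le> T" by auto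
      with one[of s s'] one[of s' s]
      show "dist (hausdorff_dist \<nu> (S s ` A) B) (hausdorff_dist \<nu> (S s' ` A) B) \<le> C * L * dist s s'"
        by (simp add: dist_real_def abs_le_iff abs_minus_commute)
    qed (use cC L in simp)
    then have "continuous_on {-T<..<T} (\<lambda>s. hausdorff_dist \<nu> (S s ` A) B)" by (rule lipschitz_on_continuous_on)
    moreover have "s0 \<in> {-T<..<T}" by (auto simp: T_def)
    ultimately show ?thesis by (simp add: continuous_on_eq_continuous_at)
  qed
  then show ?thesis by (simp add: continuous_on_eq_continuous_at)
qed

text \<open>The discrete set depends on \<open>s\<close> only through an integer, so the integrand
  is pasted from countably many continuous functions. The Bochner integral of a nonintegrable
  function is 0 by convention, so vanishing integrals carry information only together with this
  fact.\<close>

lemma hausdorff_step_integrable: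
  fixes B :: "int \<Rightarrow> 'b set"
  assumes A: "A \<noteq> {}" "A \<subseteq> X" and B: "\<And>k. B k \<noteq> {}" "\<And>k. B k \<subseteq> X"
  shows "set_integrable lborel {a..b} (\<lambda>s. hausdorff_dist \<nu> (S s ` A) (B (time_steps h s)))"
proof -
  obtain K where K: "\<And>x y. x \<in> X \<Longrightarrow> y \<in> X \<Longrightarrow> \<nu> (x - y) \<le> K" using bounded_differences by blast
  let ?f = "\<lambda>s. hausdorff_dist \<nu> (S s ` A) (B (time_steps h s))"
  have SA: "S s ` A \<noteq> {}" "S s ` A \<subseteq> X" for s using A flow_in by auto
  note bd = hausdorff_bounds[OF K SA B]
  have [measurable]: "time_steps h \<in> measurable borel (count_space UNIV)"
    unfolding time_steps_def[abs_def] by measurable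
  have "(\<lambda>s. hausdorff_dist \<nu> (S s ` A) (B k)) \<in> borel_measurable borel" for k
    using hausdorff_flow_continuous[OF A B] by (rule borel_measurable_continuous_onI)
  then have [measurable]: "?f \<in> borel_measurable borel"
    by (rule measurable_compose_countable) simp
  show ?thesis
  proof (rule set_integrable_bound[OF _ _ AE_I2])
    show "set_integrable lborel {a..b} (\<lambda>s. K)" unfolding set_integrable_def
      by (intro integrable_scaleR_left integrable_real_indicator) (simp_all add: emeasure_lborel_Icc_eq)
    show "set_borel_measurable lborel {a..b} ?f" unfolding set_borel_measurable_def by measurable
    show "s \<in> {a..b} \<longrightarrow> norm (?f s) \<le> norm K" for s using bd[of s "time_steps h s"] by simp
  qed
qed

end

section \<open>Mean convergence of the discrete evolution\<close>

text \<open>Error majorants that vanish in the mean over time. Integrability is asked only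
  eventually, since the partitions are described from index 1 on.\<close>

definition vanishing_on :: "real \<Rightarrow> (nat \<Rightarrow> real \<Rightarrow> real) \<Rightarrow> bool" where
  "vanishing_on T a \<longleftrightarrow> (\<forall>\<^sub>F n in sequentially. set_integrable lborel {0..T} (a n)) \<and>
     (\<lambda>n. LBINT t:{0..T}. a n t) \<longlonglongrightarrow> 0"

lemma vanishing_on_linear:
  assumes "vanishing_on T a" "vanishing_on T b"
  shows "vanishing_on T (\<lambda>n t. c * a n t + d * b n t)"
proof -
  have ev: "\<forall>\<^sub>F n in sequentially. set_integrable lborel {0..T} (a n) \<and> set_integrable lborel {0..T} (b n)"
    using assms by (auto simp: vanishing_on_def intro: eventually_conj)
  have "(\<lambda>n. c * (LBINT t:{0..T}. a n t) + d * (LBINT t:{0..T}. b n t)) \<longlonglongrightarrow> c * 0 + d * 0"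
    using assms by (intro tendsto_intros) (auto simp: vanishing_on_def)
  moreover have "\<forall>\<^sub>F n in sequentially. c * (LBINT t:{0..T}. a n t) + d * (LBINT t:{0..T}. b n t) =
      (LBINT t:{0..T}. c * a n t + d * b n t)"
    using ev
  proof eventually_elim
    fix n assume "set_integrable lborel {0..T} (a n) \<and> set_integrable lborel {0..T} (b n)"
    then have "set_integrable lborel {0..T} (\<lambda>t. c * a n t)" "set_integrable lborel {0..T} (\<lambda>t. d * b n t)"
      by (auto intro: set_integrable_mult_right)
    from set_integral_add(2)[OF this]
    show "c * (LBINT t:{0..T}. a n t) + d * (LBINT t:{0..T}. b n t) = (LBINT t:{0..T}. c * a n t + d * b n t)"
      by simp
  qed
  ultimately have "(\<lambda>n. LBINT t:{0..T}. c * a n t + d * b n t) \<longlonglongrightarrow> c * 0 + d * 0"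
    by (rule Lim_transform_eventually)
  then have "(\<lambda>n. LBINT t:{0..T}. c * a n t + d * b n t) \<longlonglongrightarrow> 0"
    by (simp only: mult_zero_right add_0)
  moreover have "\<forall>\<^sub>F n in sequentially. set_integrable lborel {0..T} (\<lambda>t. c * a n t + d * b n t)"
    using ev by eventually_elim (auto intro!: set_integral_add set_integrable_mult_right)
  ultimately show ?thesis by (simp add: vanishing_on_def)
qed

locale flow_approximation = compact_flow M X \<nu> S + pvm_group M E "koopman S"
  for M :: "'b::euclidean_space measure" and X :: "'b set" and \<nu> and S and E +
  fixes \<tau> l :: "nat \<Rightarrow> real" and q :: "nat \<Rightarrow> nat" and P :: "nat \<Rightarrow> 'b set set"
    and F :: "nat \<Rightarrow> 'b set \<Rightarrow> 'b set"
  assumes \<tau>_pos: "\<And>n. 1 \<le> n \<Longrightarrow> 0 < \<tau> n" and \<tau>_lim: "\<tau> \<longlonglongrightarrow> 0"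
    and partition: "partition_seq \<nu> M q l P"
    and bij_F: "\<And>n. 1 \<le> n \<Longrightarrow> bij_betw (F n) (P n) (P n)"
    and periodic: "periodically_approximates \<nu> X S \<tau> P F"
begin

abbreviation Wn :: "nat \<Rightarrow> ('b \<Rightarrow> complex) \<Rightarrow> 'b \<Rightarrow> complex" where
  "Wn n \<equiv> averaging M (P n)"

abbreviation Vn :: "nat \<Rightarrow> real \<Rightarrow> ('b \<Rightarrow> complex) \<Rightarrow> 'b \<Rightarrow> complex" where
  "Vn n t \<equiv> discrete_koopman M (P n) (F n) (int (nat \<lceil>t / \<tau> n\<rceil>))"

abbreviation Ut :: "real \<Rightarrow> ('b \<Rightarrow> complex) \<Rightarrow> 'b \<Rightarrow> complex" where
  "Ut \<equiv> koopman S"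

text \<open>Mean convergence is stated through a majorant \<open>a\<close>, so that measurability in
  \<open>t\<close> of the \<open>L2\<close> distance does not have to be shown. The slack
  \<open>\<epsilon>\<close> absorbs errors that are small uniformly in time and makes the property
  closed under \<open>L2\<close> limits.\<close>

definition converges :: "('b \<Rightarrow> complex) \<Rightarrow> bool" where
  "converges g \<longleftrightarrow> (\<lambda>n. L2_norm M (\<lambda>x. Wn n g x - g x)) \<longlonglongrightarrow> 0 \<and>
     (\<forall>T>0. \<forall>\<epsilon>>0. \<exists>a. vanishing_on T a \<and>
        (\<forall>\<^sub>F n in sequentially. \<forall>t\<in>{0<..T}. L2_norm M (\<lambda>x. Vn n t g x - Ut t g x) \<le> \<epsilon> + a n t))"

lemma cell_map: "1 \<le> n \<Longrightarrow> cell_map M (P n) (F n)"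
proof unfold_locales
  assume n: "1 \<le> n"
  note pn = partition[unfolded partition_seq_def]
  have c: "compact p \<and> connected p \<and> measure M p = measure M (space M) / real (q n)" if "p \<in> P n" for p
    using pn[THEN conjunct2, THEN conjunct1, THEN spec, THEN mp, OF n, THEN bspec, OF that] .
  have f: "finite (P n) \<and> card (P n) = q n \<and> \<Union>(P n) = space M \<and>
        (\<forall>p\<in>P n. \<forall>p'\<in>P n. p \<noteq> p' \<longrightarrow> emeasure M (p \<inter> p') = 0)"
    using pn[THEN conjunct1, THEN spec, THEN mp, OF n] .
  show "finite (P n)" "\<Union>(P n) = space M" using f by (simp_all only:)
  show "p \<in> sets M" if "p \<in> P n" for p
  proof (rule compact_sets)
    show "compact p" using c[OF that] by (rule conjunct1)
    have "p \<subseteq> \<Union>(P n)" using that by (rule Union_upper)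
    then show "p \<subseteq> X" using f space_X by simp
  qed
  show "emeasure M (p \<inter> p') = 0" if "p \<in> P n" "p' \<in> P n" "p \<noteq> p'" for p p' using f that by blast
  show "measure M p = measure M (space M) / real (card (P n))" if "p \<in> P n" for p using c[OF that] f by (simp only:)
  show "0 < measure M (space M)" by (rule measure_pos)
  show "bij_betw (F n) (P n) (P n)" using n by (rule bij_F)
qed

lemma cell_diameter:
  assumes "1 \<le> n" "p \<in> P n" "x \<in> p" "y \<in> p"
  shows "\<nu> (x - y) \<le> l n"
proof -
  interpret cell_map M "P n" "F n" using assms(1) by (rule cell_map)
  obtain K where K: "\<And>x y. x \<in> X \<Longrightarrow> y \<in> X \<Longrightarrow> \<nu> (x - y) \<le> K" using bounded_differences by blast
  have pX: "p \<subseteq> X" using cover assms(2) space_X by auto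
  have "bdd_above ((\<lambda>z. \<nu> (fst z - snd z)) ` (p \<times> p))"
  proof (rule bdd_aboveI2[of _ _ K])
    fix z assume "z \<in> p \<times> p"
    then have "fst z \<in> X" "snd z \<in> X" using pX by auto
    then show "\<nu> (fst z - snd z) \<le> K" by (rule K)
  qed
  then have "\<nu> (fst (x, y) - snd (x, y)) \<le> norm_diam \<nu> p"
    unfolding norm_diam_def using assms by (intro cSUP_upper) auto
  also have "\<dots> \<le> l n" using partition assms(1,2) unfolding partition_seq_def by blast
  finally show ?thesis by simp
qed

lemma l_lim: "l \<longlonglongrightarrow> 0"
  using partition unfolding partition_seq_def by blast

lemma Ut_linear: "Ut t (\<lambda>x. a * f x + b * g x) = (\<lambda>x. a * Ut t f x + b * Ut t g x)"
  by (simp add: koopman_def)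

lemma Ut_diff: "Ut t (\<lambda>x. f x - g x) = (\<lambda>x. Ut t f x - Ut t g x)"
  by (simp add: koopman_def)

lemma L2_norm_combination_le:
  assumes "f \<in> L2 M" "g \<in> L2 M" "f' \<in> L2 M" "g' \<in> L2 M"
  shows "L2_norm M (\<lambda>x. (a * f x + b * g x) - (a * f' x + b * g' x)) \<le>
    cmod a * L2_norm M (\<lambda>x. f x - f' x) + cmod b * L2_norm M (\<lambda>x. g x - g' x)"
proof -
  have "(\<lambda>x. (a * f x + b * g x) - (a * f' x + b * g' x)) = (\<lambda>x. a * (f x - f' x) + b * (g x - g' x))"
    by (simp add: algebra_simps)
  then show ?thesis
    using L2_norm_triangle[OF L2_scale[OF L2_diff[OF assms(1,3)], of a] L2_scale[OF L2_diff[OF assms(2,4)], of b]]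
    by (simp add: L2_norm_scale)
qed

lemma converges_linear:
  assumes L: "f \<in> L2 M" "g \<in> L2 M" and c: "converges f" "converges g"
  shows "converges (\<lambda>x. a * f x + b * g x)"
  unfolding converges_def
proof (intro conjI allI impI)
  have "(\<lambda>n. cmod a * L2_norm M (\<lambda>x. Wn n f x - f x) + cmod b * L2_norm M (\<lambda>x. Wn n g x - g x)) \<longlonglongrightarrow>
      cmod a * 0 + cmod b * 0"
    using c by (intro tendsto_intros) (auto simp: converges_def)
  then have lim: "(\<lambda>n. cmod a * L2_norm M (\<lambda>x. Wn n f x - f x) + cmod b * L2_norm M (\<lambda>x. Wn n g x - g x)) \<longlonglongrightarrow> 0"
    by simp
  show "(\<lambda>n. L2_norm M (\<lambda>x. Wn n (\<lambda>x. a * f x + b * g x) x - (a * f x + b * g x))) \<longlonglongrightarrow> 0"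
  proof (rule tendsto_sandwich[OF _ _ tendsto_const lim])
    show "\<forall>\<^sub>F n in sequentially. L2_norm M (\<lambda>x. Wn n (\<lambda>x. a * f x + b * g x) x - (a * f x + b * g x)) \<le>
       cmod a * L2_norm M (\<lambda>x. Wn n f x - f x) + cmod b * L2_norm M (\<lambda>x. Wn n g x - g x)"
      using eventually_ge_at_top[of 1]
    proof eventually_elim
      fix n :: nat assume "1 \<le> n"
      then interpret cell_map M "P n" "F n" by (rule cell_map)
      show "L2_norm M (\<lambda>x. Wn n (\<lambda>x. a * f x + b * g x) x - (a * f x + b * g x)) \<le>
         cmod a * L2_norm M (\<lambda>x. Wn n f x - f x) + cmod b * L2_norm M (\<lambda>x. Wn n g x - g x)"
        unfolding averaging_linear[OF L] by (intro L2_norm_combination_le averaging_L2 L)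
    qed
  qed simp
  fix T \<epsilon> :: real assume "0 < T" "0 < \<epsilon>"
  define \<delta> where "\<delta> = \<epsilon> / (cmod a + cmod b + 1)"
  have p: "0 < cmod a + cmod b + 1" by (simp add: add_nonneg_pos)
  have d: "0 < \<delta>" using \<open>0 < \<epsilon>\<close> p by (simp add: \<delta>_def)
  obtain u where u: "vanishing_on T u"
    "\<forall>\<^sub>F n in sequentially. \<forall>t\<in>{0<..T}. L2_norm M (\<lambda>x. Vn n t f x - Ut t f x) \<le> \<delta> + u n t"
    using c(1) \<open>0 < T\<close> d unfolding converges_def by blast
  obtain w where w: "vanishing_on T w"
    "\<forall>\<^sub>F n in sequentially. \<forall>t\<in>{0<..T}. L2_norm M (\<lambda>x. Vn n t g x - Ut t g x) \<le> \<delta> + w n t"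
    using c(2) \<open>0 < T\<close> d unfolding converges_def by blast
  show "\<exists>a'. vanishing_on T a' \<and> (\<forall>\<^sub>F n in sequentially. \<forall>t\<in>{0<..T}.
      L2_norm M (\<lambda>x. Vn n t (\<lambda>x. a * f x + b * g x) x - Ut t (\<lambda>x. a * f x + b * g x) x) \<le> \<epsilon> + a' n t)"
  proof (intro exI conjI)
    show "vanishing_on T (\<lambda>n t. cmod a * u n t + cmod b * w n t)" by (rule vanishing_on_linear[OF u(1) w(1)])
    show "\<forall>\<^sub>F n in sequentially. \<forall>t\<in>{0<..T}.
      L2_norm M (\<lambda>x. Vn n t (\<lambda>x. a * f x + b * g x) x - Ut t (\<lambda>x. a * f x + b * g x) x) \<le>
        \<epsilon> + (cmod a * u n t + cmod b * w n t)"
      using eventually_ge_at_top[of 1] u(2) w(2)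
    proof eventually_elim
      fix n :: nat assume "1 \<le> n"
        and 1: "\<forall>t\<in>{0<..T}. L2_norm M (\<lambda>x. Vn n t f x - Ut t f x) \<le> \<delta> + u n t"
        and 2: "\<forall>t\<in>{0<..T}. L2_norm M (\<lambda>x. Vn n t g x - Ut t g x) \<le> \<delta> + w n t"
      interpret cell_map M "P n" "F n" using \<open>1 \<le> n\<close> by (rule cell_map)
      show "\<forall>t\<in>{0<..T}.
        L2_norm M (\<lambda>x. Vn n t (\<lambda>x. a * f x + b * g x) x - Ut t (\<lambda>x. a * f x + b * g x) x) \<le>
          \<epsilon> + (cmod a * u n t + cmod b * w n t)"
      proof
        fix t assume t: "t \<in> {0<..T}"
        have "L2_norm M (\<lambda>x. Vn n t (\<lambda>x. a * f x + b * g x) x - Ut t (\<lambda>x. a * f x + b * g x) x) \<le>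
            cmod a * L2_norm M (\<lambda>x. Vn n t f x - Ut t f x) + cmod b * L2_norm M (\<lambda>x. Vn n t g x - Ut t g x)"
          unfolding Uk_linear[OF L] Ut_linear by (intro L2_norm_combination_le Uk_L2 U_L2 L)
        also have "\<dots> \<le> cmod a * (\<delta> + u n t) + cmod b * (\<delta> + w n t)"
          using bspec[OF 1 t] bspec[OF 2 t] by (intro add_mono mult_left_mono) auto
        also have "\<dots> = (cmod a + cmod b) * \<delta> + (cmod a * u n t + cmod b * w n t)" by (simp add: algebra_simps)
        also have "(cmod a + cmod b) * \<delta> \<le> (cmod a + cmod b + 1) * \<delta>" using d by (intro mult_right_mono) auto
        also have "(cmod a + cmod b + 1) * \<delta> = \<epsilon>" using p by (simp add: \<delta>_def)
        finally show "L2_norm M (\<lambda>x. Vn n t (\<lambda>x. a * f x + b * g x) x - Ut t (\<lambda>x. a * f x + b * g x) x) \<le>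
          \<epsilon> + (cmod a * u n t + cmod b * w n t)" by simp
      qed
    qed
  qed
qed

text \<open>Both operators contract \<open>f - g\<close>, so replacing \<open>f\<close> by
  \<open>g\<close> costs the distance once for each. It serves averaging against the identity as
  well as the discrete against the Koopman evolution.\<close>

lemma perturbation_le:
  assumes f: "f \<in> L2 M" and g: "g \<in> L2 M" and L: "\<And>h. h \<in> L2 M \<Longrightarrow> A h \<in> L2 M" "\<And>h. h \<in> L2 M \<Longrightarrow> B h \<in> L2 M"
    and A: "A (\<lambda>x. f x - g x) = (\<lambda>x. A f x - A g x)" "L2_norm M (A (\<lambda>x. f x - g x)) \<le> L2_norm M (\<lambda>x. f x - g x)"
    and B: "B (\<lambda>x. f x - g x) = (\<lambda>x. B f x - B g x)" "L2_norm M (B (\<lambda>x. f x - g x)) \<le> L2_norm M (\<lambda>x. f x - g x)"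
  shows "L2_norm M (\<lambda>x. A f x - B f x) \<le> 2 * L2_norm M (\<lambda>x. f x - g x) + L2_norm M (\<lambda>x. A g x - B g x)"
proof -
  have "L2_norm M (\<lambda>x. A f x - B f x) \<le> L2_norm M (\<lambda>x. A f x - A g x) + L2_norm M (\<lambda>x. A g x - B f x)"
    by (intro L2_norm_dist_triangle L f g)
  also have "L2_norm M (\<lambda>x. A g x - B f x) \<le> L2_norm M (\<lambda>x. A g x - B g x) + L2_norm M (\<lambda>x. B g x - B f x)"
    by (intro L2_norm_dist_triangle L f g)
  also have "L2_norm M (\<lambda>x. B g x - B f x) \<le> L2_norm M (\<lambda>x. f x - g x)"
    using B by (simp add: L2_norm_minus_commute[of M "B g"])
  also have "L2_norm M (\<lambda>x. A f x - A g x) \<le> L2_norm M (\<lambda>x. f x - g x)" using A by simp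
  finally show ?thesis by simp
qed

lemma converges_closed:
  assumes f: "f \<in> L2 M"
    and approx: "\<And>\<epsilon>. 0 < \<epsilon> \<Longrightarrow> \<exists>g\<in>L2 M. converges g \<and> L2_norm M (\<lambda>x. f x - g x) < \<epsilon>"
  shows "converges f"
  unfolding converges_def
proof (intro conjI allI impI)
  show "(\<lambda>n. L2_norm M (\<lambda>x. Wn n f x - f x)) \<longlonglongrightarrow> 0"
  proof (rule order_tendstoI)
    fix e :: real assume e: "0 < e"
    obtain g where g: "g \<in> L2 M" "converges g" "L2_norm M (\<lambda>x. f x - g x) < e / 3"
      using approx[of "e / 3"] e by auto
    have "\<forall>\<^sub>F n in sequentially. L2_norm M (\<lambda>x. Wn n g x - g x) < e / 3"
      using g(2) e by (intro order_tendstoD(2)[where y=0]) (auto simp: converges_def)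
    with eventually_ge_at_top[of 1] show "\<forall>\<^sub>F n in sequentially. L2_norm M (\<lambda>x. Wn n f x - f x) < e"
    proof eventually_elim
      fix n :: nat assume "1 \<le> n" and a: "L2_norm M (\<lambda>x. Wn n g x - g x) < e / 3"
      interpret cell_map M "P n" "F n" using \<open>1 \<le> n\<close> by (rule cell_map)
      have "L2_norm M (\<lambda>x. Wn n f x - f x) \<le> 2 * L2_norm M (\<lambda>x. f x - g x) + L2_norm M (\<lambda>x. Wn n g x - g x)"
        using perturbation_le[of f g "Wn n" "\<lambda>h. h"] f g(1)
        by (simp add: averaging_L2 averaging_diff L2_diff averaging_norm_le flip: averaging_diff)
      then show "L2_norm M (\<lambda>x. Wn n f x - f x) < e" using a g(3) by linarith
    qed
  next
    fix e :: real assume "e < 0"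
    then show "\<forall>\<^sub>F n in sequentially. e < L2_norm M (\<lambda>x. Wn n f x - f x)"
      by (intro always_eventually allI less_le_trans[OF _ L2_norm_nonneg])
  qed
  fix T \<epsilon> :: real assume "0 < T" "0 < \<epsilon>"
  \<comment> \<open>The distance enters twice through \<open>perturbation_le\<close>, so
    \<open>\<epsilon> / 4\<close> leaves half of \<open>\<epsilon>\<close> for the error of
    \<open>g\<close>.\<close>
  obtain g where g: "g \<in> L2 M" "converges g" "L2_norm M (\<lambda>x. f x - g x) < \<epsilon> / 4"
    using approx[of "\<epsilon> / 4"] \<open>0 < \<epsilon>\<close> by auto
  have "0 < \<epsilon> / 2" using \<open>0 < \<epsilon>\<close> by simp
  then obtain u where u: "vanishing_on T u"
    "\<forall>\<^sub>F n in sequentially. \<forall>t\<in>{0<..T}. L2_norm M (\<lambda>x. Vn n t g x - Ut t g x) \<le> \<epsilon> / 2 + u n t"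
    using g(2) \<open>0 < T\<close> unfolding converges_def by blast
  show "\<exists>a. vanishing_on T a \<and> (\<forall>\<^sub>F n in sequentially. \<forall>t\<in>{0<..T}.
      L2_norm M (\<lambda>x. Vn n t f x - Ut t f x) \<le> \<epsilon> + a n t)"
  proof (intro exI conjI)
    show "vanishing_on T u" by (rule u)
    show "\<forall>\<^sub>F n in sequentially. \<forall>t\<in>{0<..T}. L2_norm M (\<lambda>x. Vn n t f x - Ut t f x) \<le> \<epsilon> + u n t"
      using eventually_ge_at_top[of 1] u(2)
    proof eventually_elim
      fix n :: nat assume "1 \<le> n"
        and a: "\<forall>t\<in>{0<..T}. L2_norm M (\<lambda>x. Vn n t g x - Ut t g x) \<le> \<epsilon> / 2 + u n t"
      interpret cell_map M "P n" "F n" using \<open>1 \<le> n\<close> by (rule cell_map)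
      show "\<forall>t\<in>{0<..T}. L2_norm M (\<lambda>x. Vn n t f x - Ut t f x) \<le> \<epsilon> + u n t"
      proof
        fix t assume t: "t \<in> {0<..T}"
        have "L2_norm M (\<lambda>x. Vn n t f x - Ut t f x) \<le> 2 * L2_norm M (\<lambda>x. f x - g x) + L2_norm M (\<lambda>x. Vn n t g x - Ut t g x)"
          by (intro perturbation_le f g(1) Uk_L2 U_L2 Uk_diff Ut_diff Uk_norm_le U_norm_le L2_diff)
        then show "L2_norm M (\<lambda>x. Vn n t f x - Ut t f x) \<le> \<epsilon> + u n t"
          using bspec[OF a t] g(3) by linarith
      qed
    qed
  qed
qed

end

section \<open>Cell unions and their Hausdorff deviation from the flow\<close>

context cell_map
begin

lemma cell_nonempty: "p \<in> P \<Longrightarrow> p \<noteq> {}"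
  using cell_measure[of p] cell_size_pos by (auto simp: cell_size_def)

lemma int_iterate_in:
  assumes p: "p \<in> P"
  shows "int_iterate P F k p \<in> P"
proof -
  have "(F ^^ j) p \<in> P" for j
    by (induction j) (use p bij in \<open>auto simp: bij_betw_def\<close>)
  then show ?thesis using rewind_in[OF p] by (simp add: int_iterate_def)
qed

lemma outer_approx_cells:
  obtains Q where "Q \<subseteq> P" "outer_approx P A = \<Union>Q" "\<And>p. p \<in> Q \<Longrightarrow> p \<inter> A \<noteq> {}"
    "A \<subseteq> space M \<Longrightarrow> A \<subseteq> \<Union>Q"
proof (rule that[of "{p \<in> P. p \<inter> A \<noteq> {}}"])
  show "A \<subseteq> \<Union>{p \<in> P. p \<inter> A \<noteq> {}}" if "A \<subseteq> space M" using that cover by blast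
qed (auto simp: outer_approx_def)

lemma iterate_outer_approx:
  assumes "A \<noteq> {}" "A \<subseteq> space M"
  shows "iterate_on_union P F k (outer_approx P A) \<noteq> {}" "iterate_on_union P F k (outer_approx P A) \<subseteq> space M"
proof -
  obtain Q where Q: "Q \<subseteq> P" "outer_approx P A = \<Union>Q" "A \<subseteq> \<Union>Q"
    using outer_approx_cells[of A] assms(2) by metis
  have "Q \<noteq> {}" using Q(3) assms(1) by auto
  then obtain p where p: "p \<in> Q" by blast
  have "int_iterate P F k p \<subseteq> iterate_on_union P F k (outer_approx P A)"
    unfolding iterate_on_union_def Q(2) using p Q(1) by blast
  moreover have "int_iterate P F k p \<noteq> {}" using p Q(1) by (intro cell_nonempty int_iterate_in) auto
  ultimately show "iterate_on_union P F k (outer_approx P A) \<noteq> {}" by auto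
  show "iterate_on_union P F k (outer_approx P A) \<subseteq> space M"
    unfolding iterate_on_union_def cover[symmetric] using int_iterate_in by blast
qed

end

context flow_approximation
begin

definition deviation :: "'b set \<Rightarrow> nat \<Rightarrow> real \<Rightarrow> real" where
  "deviation A n s = hausdorff_dist \<nu> (S s ` A)
     (iterate_on_union (P n) (F n) (time_steps (\<tau> n) s) (outer_approx (P n) A))"

lemma deviation_integrable:
  assumes "A \<noteq> {}" "A \<subseteq> X" "1 \<le> n"
  shows "set_integrable lborel {a..b} (deviation A n)"
proof -
  interpret cell_map M "P n" "F n" using assms(3) by (rule cell_map)
  show ?thesis
    unfolding deviation_def using iterate_outer_approx[of A] assms(1,2)
    by (intro hausdorff_step_integrable) (simp_all add: space_X)
qed

lemma deviation_nonneg: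
  assumes "A \<noteq> {}" "A \<subseteq> X" "1 \<le> n"
  shows "0 \<le> deviation A n s"
proof -
  interpret cell_map M "P n" "F n" using assms(3) by (rule cell_map)
  obtain K where K: "\<And>x y. x \<in> X \<Longrightarrow> y \<in> X \<Longrightarrow> \<nu> (x - y) \<le> K" using bounded_differences by blast
  have SA: "S s ` A \<noteq> {}" "S s ` A \<subseteq> X" using assms flow_in by auto
  have it: "iterate_on_union (P n) (F n) k (outer_approx (P n) A) \<noteq> {}"
    "iterate_on_union (P n) (F n) k (outer_approx (P n) A) \<subseteq> X" for k
    using iterate_outer_approx[of A k] assms(1,2) by (simp_all add: space_X)
  show ?thesis unfolding deviation_def by (rule hausdorff_bounds(1)[where K=K, OF _ SA it]) (rule K)
qed

text \<open>The Koopman operator at time \<open>t\<close> turns the indicator of \<open>A\<close>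
  into that of its image under \<open>S (- t)\<close>, hence the reflected argument. As deviations
  are nonnegative, the integral over \<open>[-T, 0]\<close> is at most that over
  \<open>[-T, T]\<close>, the quantity in the hypothesis.\<close>

lemma deviation_vanishing:
  fixes T C :: real
  assumes A: "compact A" "A \<noteq> {}" "A \<subseteq> X" and T: "0 < T"
  shows "vanishing_on T (\<lambda>n t. C * deviation A n (- t))"
proof -
  have lim: "(\<lambda>n. LBINT s:{-T..T}. deviation A n s) \<longlonglongrightarrow> 0"
  proof -
    have "compact A \<and> A \<noteq> {} \<and> A \<subseteq> X" using A by simp
    from periodic[unfolded periodically_approximates_def, THEN spec[of _ T], THEN spec[of _ A], THEN mp, OF this]
    have "(\<lambda>n. LBINT s=-T..T. deviation A n s) \<longlonglongrightarrow> 0"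
      unfolding deviation_def by (simp only: uminus_ereal.simps(1))
    moreover have "(LBINT s=-T..T. deviation A n s) = (LBINT s:{-T..T}. deviation A n s)" for n
      using T by (intro interval_integral_Icc) simp
    ultimately show ?thesis by (simp only:)
  qed
  have int: "set_integrable lborel {0..T} (\<lambda>t. deviation A n (- t))" if "1 \<le> n" for n
  proof -
    have "integrable lborel (\<lambda>s. indicator {-T..0} s *\<^sub>R deviation A n s)"
      using deviation_integrable[OF A(2,3) that] unfolding set_integrable_def .
    then have "integrable lborel (\<lambda>t. indicator {-T..0} (0 + (-1) * t) *\<^sub>R deviation A n (0 + (-1) * t))"
      by (rule lborel_integrable_real_affine) simp
    moreover have "indicator {-T..0} (0 + (-1) * t) = (indicator {0..T} t :: real)" for t
      by (auto split: split_indicator)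
    ultimately show ?thesis unfolding set_integrable_def by simp
  qed
  have le: "(LBINT t:{0..T}. deviation A n (- t)) \<le> (LBINT s:{-T..T}. deviation A n s)" if "1 \<le> n" for n
  proof -
    have "{x. - x \<in> {0..T}} = {-T..0}" by auto
    then have "(LBINT t:{0..T}. deviation A n (- t)) = (LBINT s:{-T..0}. deviation A n s)"
      using set_integral_reflect[of "{0..T}" "\<lambda>t. deviation A n (- t)"] by simp
    also have "\<dots> \<le> (LBINT s:{-T..T}. deviation A n s)"
      unfolding set_lebesgue_integral_def
      using deviation_integrable[OF A(2,3) that] deviation_nonneg[OF A(2,3) that] T
      by (intro integral_mono) (auto simp: set_integrable_def split: split_indicator)
    finally show ?thesis .
  qed
  have nn: "0 \<le> (LBINT t:{0..T}. deviation A n (- t))" if "1 \<le> n" for n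
    unfolding set_lebesgue_integral_def
    using deviation_nonneg[OF A(2,3) that] by (intro integral_nonneg_AE AE_I2) (auto split: split_indicator)
  have "(\<lambda>n. LBINT t:{0..T}. deviation A n (- t)) \<longlonglongrightarrow> 0"
  proof (rule tendsto_sandwich[OF _ _ tendsto_const lim])
    show "\<forall>\<^sub>F n in sequentially. 0 \<le> (LBINT t:{0..T}. deviation A n (- t))"
      using eventually_ge_at_top[of 1] by eventually_elim (rule nn)
    show "\<forall>\<^sub>F n in sequentially. (LBINT t:{0..T}. deviation A n (- t)) \<le> (LBINT s:{-T..T}. deviation A n s)"
      using eventually_ge_at_top[of 1] by eventually_elim (rule le)
  qed
  then have "(\<lambda>n. C * (LBINT t:{0..T}. deviation A n (- t))) \<longlonglongrightarrow> C * 0" by (intro tendsto_intros)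
  moreover have "\<forall>\<^sub>F n in sequentially. set_integrable lborel {0..T} (\<lambda>t. C * deviation A n (- t))"
    using eventually_ge_at_top[of 1] by eventually_elim (intro set_integrable_mult_right int)
  ultimately show ?thesis by (simp add: vanishing_on_def)
qed

lemma L2_norm_indicator_le_sqrt:
  assumes "A \<in> sets M" "B \<in> sets M" "measure M (A - B) + measure M (B - A) \<le> m"
  shows "L2_norm M (\<lambda>x. indicator A x - indicator B x) \<le> sqrt m"
  using assms by (intro real_le_rsqrt) (simp add: L2_norm_indicator_diff)

text \<open>Only one half of the Hausdorff distance is used: \<open>I\<close> lies in a thickening of \<open>S (- t) ` A\<close>,
  and the opposite difference is controlled by comparing the total measures.\<close>

lemma indicator_estimate:
  fixes T c L \<delta> :: real
  assumes n: "1 \<le> n" and A: "compact A" "A \<noteq> {}" "A \<subseteq> X"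
    and c: "\<And>x. c * norm x \<le> \<nu> x" "0 < c"
    and L: "0 < L" "\<And>t s x y. \<bar>t\<bar> \<le> T \<Longrightarrow> \<bar>s\<bar> \<le> T \<Longrightarrow> x \<in> X \<Longrightarrow> y \<in> X \<Longrightarrow>
      norm (S t x - S s y) \<le> L * (\<bar>t - s\<bar> + norm (x - y))"
    and \<delta>: "0 < \<delta>" and ln: "l n \<le> c * \<delta>"
  defines "m \<equiv> measure M (thickening \<delta> A - A)" and "C \<equiv> 2 * sqrt (measure M X) * L / (c * \<delta>)"
  shows "L2_norm M (\<lambda>x. Wn n (indicator A) x - indicator A x) \<le> 2 * sqrt m"
    and "\<And>t. 0 < t \<Longrightarrow> t \<le> T \<Longrightarrow>
      L2_norm M (\<lambda>x. Vn n t (indicator A) x - Ut t (indicator A) x) \<le> 3 * sqrt m + C * deviation A n (- t)"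
proof -
  interpret cell_map M "P n" "F n" using n by (rule cell_map)
  obtain Q where Q: "Q \<subseteq> P n" "outer_approx (P n) A = \<Union>Q" "\<And>p. p \<in> Q \<Longrightarrow> p \<inter> A \<noteq> {}" "A \<subseteq> \<Union>Q"
    using outer_approx_cells[of A] A(3) space_X by metis
  have As: "A \<in> sets M" and Qs: "\<Union>Q \<in> sets M" using A Q by (auto intro: compact_sets Union_sets)
  note Ns = thickening_sets[of \<delta> A]
  have m0: "0 \<le> m" by (simp add: m_def)
  have AN: "A \<subseteq> thickening \<delta> A" using A(3) \<delta> by (auto simp: thickening_def)
  \<comment> \<open>A cell meeting \<open>A\<close> has diameter at most
    \<open>l n \<le> c * \<delta>\<close> in \<open>\<nu>\<close>, hence at most
    \<open>\<delta>\<close> in the Euclidean norm.\<close>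
  have QN: "\<Union>Q \<subseteq> thickening \<delta> A"
  proof
    fix x assume "x \<in> \<Union>Q"
    then obtain p where p: "p \<in> Q" "x \<in> p" by blast
    then obtain a where a: "a \<in> p" "a \<in> A" using Q(3) by blast
    have pP: "p \<in> P n" using p Q(1) by auto
    have "c * norm (x - a) \<le> l n" using c(1)[of "x - a"] cell_diameter[OF n pP p(2) a(1)] by linarith
    then have "c * norm (x - a) \<le> c * \<delta>" using ln by linarith
    then have "norm (x - a) \<le> \<delta>" using c(2) by simp
    then have "infdist x A \<le> \<delta>" using infdist_le[OF a(2), of x] by (simp add: dist_norm)
    moreover have "x \<in> X" using pP p(2) cover space_X by blast
    ultimately show "x \<in> thickening \<delta> A" by (simp add: thickening_def)
  qed
  have Qm: "measure M (\<Union>Q - A) \<le> m"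
    unfolding m_def using QN As Ns by (intro finite_measure_mono) auto
  have iA: "(indicator A :: 'b \<Rightarrow> complex) \<in> L2 M" using As by (intro indicator_L2) auto
  have iQ: "(indicator (\<Union>Q) :: 'b \<Rightarrow> complex) \<in> L2 M" by (rule indicator_Union_L2[OF Q(1)])
  have AQ0: "A - \<Union>Q = {}" using Q(4) by auto
  have AQ: "L2_norm M (\<lambda>x. indicator A x - indicator (\<Union>Q) x) \<le> sqrt m"
    using Qm by (intro L2_norm_indicator_le_sqrt As Qs) (simp add: AQ0)
  have Qcells: "indicator (\<Union>Q) \<in> L2_cells M (P n)"
    unfolding L2_cells_def using iQ indicator_Union_AE[OF Q(1)] by (auto simp: step_def)
  \<comment> \<open>The cell cover of \<open>A\<close> is itself a cell function, so averaging fixes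
    it.\<close>
  have WQ: "L2_norm M (\<lambda>x. Wn n (indicator (\<Union>Q)) x - indicator (\<Union>Q) x) = 0"
    using averaging_id[OF Qcells] L2_norm_eq_0_iff[OF L2_diff[OF averaging_L2 iQ]] by (simp add: AE_conj_iff)
  have "L2_norm M (\<lambda>x. Wn n (indicator A) x - indicator A x) \<le>
      2 * L2_norm M (\<lambda>x. indicator A x - indicator (\<Union>Q) x) + L2_norm M (\<lambda>x. Wn n (indicator (\<Union>Q)) x - indicator (\<Union>Q) x)"
    by (rule perturbation_le[where B="\<lambda>h. h"])
      (auto intro!: iA iQ averaging_L2 averaging_diff averaging_norm_le L2_diff)
  then show "L2_norm M (\<lambda>x. Wn n (indicator A) x - indicator A x) \<le> 2 * sqrt m" using AQ WQ by linarith
  fix t assume t: "0 < t" "t \<le> T"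
  define j where "j = nat \<lceil>t / \<tau> n\<rceil>"
  define I where "I = \<Union>(rewind j ` Q)"
  define SA where "SA = S (- t) ` A"
  have Is: "I \<in> sets M" unfolding I_def by (intro Union_sets rewind_image Q)
  have SAs: "SA \<in> sets M" unfolding SA_def by (rule flow_image_sets[OF As])
  have j: "time_steps (\<tau> n) (- t) = - int j"
  proof -
    have "0 < t / \<tau> n" using t \<tau>_pos[OF n] by simp
    then have "0 \<le> \<lceil>t / \<tau> n\<rceil>" by (simp add: zero_le_ceiling)
    then show ?thesis using t by (simp add: time_steps_def j_def)
  qed
  have dev: "deviation A n (- t) = hausdorff_dist \<nu> SA I"
    unfolding deviation_def j Q(2) iterate_on_Union[OF Q(1)] I_def SA_def ..
  have dev0: "0 \<le> deviation A n (- t)" by (rule deviation_nonneg[OF A(2,3) n])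
  \<comment> \<open>A split of Markov type: a small deviation gives an inclusion of sets, while a
    large one makes \<open>C * deviation A n (- t)\<close> exceed the trivial bound. The constant
    \<open>C\<close> is dictated by the second case.\<close>
  have ISA: "L2_norm M (\<lambda>x. indicator I x - indicator SA x) \<le> 2 * sqrt m + C * deviation A n (- t)"
  proof (cases "L * deviation A n (- t) \<le> c * \<delta>")
    case True
    \<comment> \<open>A point of \<open>I\<close> is within \<open>deviation A n (- t) / c\<close>
      of \<open>SA\<close>. Carrying it and its nearest point by \<open>S t\<close> stretches the
      distance at most by \<open>L\<close>, so it lands within \<open>\<delta>\<close> of
      \<open>A\<close>.\<close>
    have IN: "I \<subseteq> S (- t) ` thickening \<delta> A"
    proof
      fix x assume x: "x \<in> I"
      have IX: "I \<subseteq> X" using sets.sets_into_space[OF Is] space_X by simp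
      have SAc: "closed SA" "SA \<noteq> {}" "SA \<subseteq> X"
        using flow_image_compact[OF A(1,3)] A flow_in by (auto simp: SA_def intro: compact_imp_closed)
      obtain y where y: "y \<in> SA" "infdist x SA = dist x y" using infdist_attains_inf[OF SAc(1,2)] by blast
      then obtain a where a: "a \<in> A" "y = S (- t) a" by (auto simp: SA_def)
      have xX: "x \<in> X" and yX: "y \<in> X" using IX x SAc(3) y by auto
      have "c * infdist x SA \<le> deviation A n (- t)"
        unfolding dev by (rule hausdorff_ge[OF c SAc(2,3) x IX])
      then have "L * (c * norm (x - y)) \<le> L * deviation A n (- t)"
        using L(1) y(2) by (intro mult_left_mono) (auto simp: dist_norm)
      then have "c * (L * norm (x - y)) \<le> c * \<delta>" using True by (simp add: mult.left_commute)
      then have "L * norm (x - y) \<le> \<delta>" using c(2) by simp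
      moreover have "norm (S t x - S t y) \<le> L * norm (x - y)" using L(2)[of t t x y] t xX yX by simp
      moreover have "S t y = a" using a A(3) flow_inverse(1)[of a t] by auto
      ultimately have "dist (S t x) a \<le> \<delta>" by (simp add: dist_norm)
      then have "infdist (S t x) A \<le> \<delta>" using infdist_le[OF a(1), of "S t x"] by linarith
      then have "S t x \<in> thickening \<delta> A" using flow_in[OF xX] by (simp add: thickening_def)
      moreover have "x = S (- t) (S t x)" using flow_inverse(2)[OF xX, of t] by simp
      ultimately show "x \<in> S (- t) ` thickening \<delta> A" by (intro image_eqI)
    qed
    have NAs: "thickening \<delta> A - A \<in> sets M" using Ns As by auto
    have "I - SA \<subseteq> S (- t) ` (thickening \<delta> A - A)" using IN by (auto simp: SA_def)
    then have "measure M (I - SA) \<le> measure M (S (- t) ` (thickening \<delta> A - A))"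
      by (intro finite_measure_mono flow_image_sets NAs)
    also have "\<dots> = m" unfolding m_def by (rule flow_image_measure[OF NAs])
    finally have 1: "measure M (I - SA) \<le> m" .
    \<comment> \<open>The flow preserves the measure of \<open>A\<close>, and permuting cells
      preserves that of its cover. So \<open>I\<close> is at least as large as \<open>SA\<close>,
      and what \<open>SA\<close> has outside \<open>I\<close> is no larger than what
      \<open>I\<close> has outside \<open>SA\<close>.\<close>
    have "measure M SA \<le> measure M I"
    proof -
      have "measure M SA = measure M A" unfolding SA_def by (rule flow_image_measure[OF As])
      also have "\<dots> \<le> measure M (\<Union>Q)" using Q(4) Qs by (rule finite_measure_mono)
      also have "\<dots> = measure M I" unfolding I_def by (rule measure_rewind_image[OF Q(1), symmetric])
      finally show ?thesis .
    qed
    moreover have "measure M (I - SA) = measure M I - measure M (I \<inter> SA)"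
      "measure M (SA - I) = measure M SA - measure M (I \<inter> SA)"
      using finite_measure_Diff'[OF Is SAs] finite_measure_Diff'[OF SAs Is] by (simp_all add: Int_commute)
    ultimately have 2: "measure M (SA - I) \<le> m" using 1 by linarith
    \<comment> \<open>The sum \<open>2 * m\<close> is relaxed to \<open>4 * m\<close> so that the
      square root is an integer multiple of \<open>sqrt m\<close>.\<close>
    have "L2_norm M (\<lambda>x. indicator I x - indicator SA x) \<le> sqrt (4 * m)"
      using 1 2 m0 by (intro L2_norm_indicator_le_sqrt Is SAs) simp
    also have "\<dots> = 2 * sqrt m" by (simp add: real_sqrt_mult)
    finally have "L2_norm M (\<lambda>x. indicator I x - indicator SA x) \<le> 2 * sqrt m" .
    moreover have "0 \<le> C * deviation A n (- t)" using dev0 L(1) c(2) \<delta> by (simp add: C_def)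
    ultimately show ?thesis by linarith
  next
    case False
    have "measure M (I - SA) \<le> measure M X" "measure M (SA - I) \<le> measure M X"
      using bounded_measure space_X by auto
    then have "L2_norm M (\<lambda>x. indicator I x - indicator SA x) \<le> sqrt (4 * measure M X)"
      using measure_nonneg[of M X] by (intro L2_norm_indicator_le_sqrt Is SAs) linarith
    also have "\<dots> = 2 * sqrt (measure M X) * 1" by (simp add: real_sqrt_mult)
    also have "\<dots> \<le> 2 * sqrt (measure M X) * (L * deviation A n (- t) / (c * \<delta>))"
      using False c(2) \<delta> by (intro mult_left_mono) (auto simp: divide_simps)
    also have "\<dots> = C * deviation A n (- t)" by (simp add: C_def)
    finally show ?thesis using m0 by (simp add: add_increasing)
  qed
  \<comment> \<open>The third \<open>sqrt m\<close> in the estimate: \<open>A\<close> is replaced by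
    its cell cover before the contraction is applied.\<close>
  have V: "L2_norm M (\<lambda>x. Vn n t (indicator A) x - Vn n t (indicator (\<Union>Q)) x) \<le> sqrt m"
    using Uk_norm_le[OF L2_diff[OF iA iQ], of j] AQ unfolding Uk_diff[OF iA iQ] j_def by linarith
  have VI: "L2_norm M (\<lambda>x. Vn n t (indicator (\<Union>Q)) x - Ut t (indicator A) x) =
      L2_norm M (\<lambda>x. indicator I x - indicator SA x)"
  proof (rule L2_norm_cong_AE)
    show "AE x in M. Vn n t (indicator (\<Union>Q)) x - Ut t (indicator A) x = indicator I x - indicator SA x"
      using Uk_indicator_Union[OF Q(1), of j] AE_space
    proof eventually_elim
      fix x assume "Uk j (indicator (\<Union>Q)) x = indicator (\<Union>(rewind j ` Q)) x" "x \<in> space M"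
      then show "Vn n t (indicator (\<Union>Q)) x - Ut t (indicator A) x = indicator I x - indicator SA x"
        using koopman_indicator[OF A(3), of x t] by (simp add: j_def I_def SA_def space_X)
    qed
    show "(\<lambda>x. Vn n t (indicator (\<Union>Q)) x - Ut t (indicator A) x) \<in> borel_measurable M"
      by (intro L2_measurable L2_diff Uk_L2 U_L2 iA)
    show "(\<lambda>x. indicator I x - indicator SA x :: complex) \<in> borel_measurable M"
      by (intro L2_measurable L2_diff indicator_L2 sets.Int sets.top Is SAs)
  qed
  have "L2_norm M (\<lambda>x. Vn n t (indicator A) x - Ut t (indicator A) x) \<le>
      L2_norm M (\<lambda>x. Vn n t (indicator A) x - Vn n t (indicator (\<Union>Q)) x) +
      L2_norm M (\<lambda>x. Vn n t (indicator (\<Union>Q)) x - Ut t (indicator A) x)"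
    by (intro L2_norm_dist_triangle Uk_L2 U_L2 iA)
  then show "L2_norm M (\<lambda>x. Vn n t (indicator A) x - Ut t (indicator A) x) \<le> 3 * sqrt m + C * deviation A n (- t)"
    using V ISA unfolding VI by linarith
qed

text \<open>\<open>\<delta>\<close> is fixed from \<open>\<epsilon>\<close> before \<open>n\<close>
  grows. The constant of \<open>indicator_estimate\<close> blows up as \<open>\<delta>\<close>
  shrinks, but once \<open>\<delta>\<close> is fixed it multiplies a quantity that vanishes in the
  mean.\<close>

lemma converges_indicator_nonempty:
  assumes A: "compact A" "A \<noteq> {}" "A \<subseteq> X"
  shows "converges (indicator A)"
proof -
  obtain c K where c: "0 < c" "\<And>x. c * norm x \<le> \<nu> x"
    using is_norm_equivalent[OF norm_\<nu>] by metis
  have choose: "\<exists>\<delta>>0. 3 * sqrt (measure M (thickening \<delta> A - A)) < \<epsilon> \<and> (\<forall>\<^sub>F n in sequentially. l n \<le> c * \<delta>)"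
    if "0 < \<epsilon>" for \<epsilon>
  proof -
    have "0 < (\<epsilon> / 3)\<^sup>2" using that by simp
    then obtain \<delta> where d: "0 < \<delta>" "measure M (thickening \<delta> A - A) < (\<epsilon> / 3)\<^sup>2"
      using thickening_small[OF A] by blast
    have "sqrt (measure M (thickening \<delta> A - A)) < \<epsilon> / 3"
      using d(2) that by (intro real_less_lsqrt) auto
    moreover have "\<forall>\<^sub>F n in sequentially. l n < c * \<delta>" using l_lim c(1) d(1) by (intro order_tendstoD) auto
    then have "\<forall>\<^sub>F n in sequentially. l n \<le> c * \<delta>" by eventually_elim simp
    ultimately show ?thesis using d(1) by (intro exI[of _ \<delta>]) auto
  qed
  show ?thesis
    unfolding converges_def
  proof (intro conjI allI impI)
    obtain L where L: "0 < L" "\<And>t s x y. \<bar>t\<bar> \<le> 1 \<Longrightarrow> \<bar>s\<bar> \<le> 1 \<Longrightarrow> x \<in> X \<Longrightarrow> y \<in> X \<Longrightarrow>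
      norm (S t x - S s y) \<le> L * (\<bar>t - s\<bar> + norm (x - y))" using flow_lipschitz by blast
    show "(\<lambda>n. L2_norm M (\<lambda>x. Wn n (indicator A) x - indicator A x)) \<longlonglongrightarrow> 0"
    proof (rule order_tendstoI)
      fix e :: real assume "0 < e"
      then obtain \<delta> where d: "0 < \<delta>" "3 * sqrt (measure M (thickening \<delta> A - A)) < e"
        "\<forall>\<^sub>F n in sequentially. l n \<le> c * \<delta>" using choose by blast
      show "\<forall>\<^sub>F n in sequentially. L2_norm M (\<lambda>x. Wn n (indicator A) x - indicator A x) < e"
        using eventually_ge_at_top[of 1] d(3)
      proof eventually_elim
        fix n assume n: "1 \<le> n" "l n \<le> c * \<delta>"
        have "0 \<le> sqrt (measure M (thickening \<delta> A - A))" by simp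
        moreover have "L2_norm M (\<lambda>x. Wn n (indicator A) x - indicator A x) \<le>
            2 * sqrt (measure M (thickening \<delta> A - A))"
          by (rule indicator_estimate(1)[where T=1, OF n(1) A c(2,1) L(1) _ d(1) n(2)]) (rule L(2))
        ultimately show "L2_norm M (\<lambda>x. Wn n (indicator A) x - indicator A x) < e"
          using d(2) by linarith
      qed
    next
      fix e :: real assume "e < 0"
      then show "\<forall>\<^sub>F n in sequentially. e < L2_norm M (\<lambda>x. Wn n (indicator A) x - indicator A x)"
        by (intro always_eventually allI less_le_trans[OF _ L2_norm_nonneg])
    qed
  next
    fix T \<epsilon> :: real assume T: "0 < T" and e: "0 < \<epsilon>"
    obtain L where L: "0 < L" "\<And>t s x y. \<bar>t\<bar> \<le> T \<Longrightarrow> \<bar>s\<bar> \<le> T \<Longrightarrow> x \<in> X \<Longrightarrow> y \<in> X \<Longrightarrow>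
      norm (S t x - S s y) \<le> L * (\<bar>t - s\<bar> + norm (x - y))" using flow_lipschitz by blast
    obtain \<delta> where d: "0 < \<delta>" "3 * sqrt (measure M (thickening \<delta> A - A)) < \<epsilon>"
      "\<forall>\<^sub>F n in sequentially. l n \<le> c * \<delta>" using choose[OF e] by blast
    define C where "C = 2 * sqrt (measure M X) * L / (c * \<delta>)"
    show "\<exists>a. vanishing_on T a \<and> (\<forall>\<^sub>F n in sequentially. \<forall>t\<in>{0<..T}.
        L2_norm M (\<lambda>x. Vn n t (indicator A) x - Ut t (indicator A) x) \<le> \<epsilon> + a n t)"
    proof (intro exI conjI)
      show "vanishing_on T (\<lambda>n t. C * deviation A n (- t))" by (rule deviation_vanishing[OF A T])
      show "\<forall>\<^sub>F n in sequentially. \<forall>t\<in>{0<..T}.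
        L2_norm M (\<lambda>x. Vn n t (indicator A) x - Ut t (indicator A) x) \<le> \<epsilon> + C * deviation A n (- t)"
        using eventually_ge_at_top[of 1] d(3)
      proof eventually_elim
        fix n assume n: "1 \<le> n" "l n \<le> c * \<delta>"
        show "\<forall>t\<in>{0<..T}. L2_norm M (\<lambda>x. Vn n t (indicator A) x - Ut t (indicator A) x) \<le> \<epsilon> + C * deviation A n (- t)"
        proof
          fix t assume "t \<in> {0<..T}"
          then have "0 < t" "t \<le> T" by auto
          then have "L2_norm M (\<lambda>x. Vn n t (indicator A) x - Ut t (indicator A) x) \<le>
              3 * sqrt (measure M (thickening \<delta> A - A)) + C * deviation A n (- t)"
            unfolding C_def by (intro indicator_estimate(2)[where T=T, OF n(1) A c(2,1) L(1) _ d(1) n(2)]) (rule L(2))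
          then show "L2_norm M (\<lambda>x. Vn n t (indicator A) x - Ut t (indicator A) x) \<le> \<epsilon> + C * deviation A n (- t)"
            using d(2) by linarith
        qed
      qed
    qed
  qed
qed

lemma converges_L2:
  assumes g: "g \<in> L2 M"
  shows "converges g"
proof (rule L2_approximation_induct[where P=converges, OF finite_measure_axioms space_X sets_X compact_X closed_X _ converges_linear converges_closed g])
  fix A assume A: "compact A" "A \<subseteq> X"
  show "converges (indicator A)"
  proof (cases "A = {}")
    \<comment> \<open>Periodic approximation speaks of nonempty sets, so the zero function is
      obtained as a trivial combination of indicators of \<open>X\<close>.\<close>
    case True
    have XL: "(indicator X :: 'b \<Rightarrow> complex) \<in> L2 M" using sets.top[of M] space_X by (intro indicator_L2) auto
    have "X \<noteq> {}" using measure_pos space_X by auto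
    then have "converges (\<lambda>x. 0 * indicator X x + 0 * indicator X x)"
      by (intro converges_linear XL converges_indicator_nonempty compact_X) auto
    moreover have "(\<lambda>x. 0 * indicator X x + 0 * indicator X x) = (indicator A :: 'b \<Rightarrow> complex)"
      using True by auto
    ultimately show ?thesis by simp
  next
    case False
    then show ?thesis using A by (intro converges_indicator_nonempty)
  qed
qed

end

section \<open>Convergence of spectral functions\<close>

context cell_spectrum
begin

text \<open>Eigenfunctions are cell functions, hence orthogonal to \<open>f - W f\<close>. The
  discrete calculus can thus be applied to the observable itself in all limits, and averaging is
  reinstated only at the end.\<close>

lemma D_averaging:
  assumes f: "f \<in> L2 M"
  shows "D \<phi> (W f) = D \<phi> f"
proof -
  have "L2_inner M (v k) (W f) = L2_inner M (v k) f" if k: "k \<in> {1..q}" for k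
  proof -
    obtain a where a: "AE x in M. v k x = step a x" using v_cells[OF k] by (auto simp: L2_cells_def step_def)
    have "L2_inner M (v k) y = L2_inner M (step a) y" if "y \<in> L2 M" for y
      by (rule L2_inner_cong_AE[OF _ _ a _ _ AE_I2[OF refl]]) (intro L2_measurable v_L2 k step_L2 that)+
    then show ?thesis using f averaging_L2 inner_step_right[OF f, of a] by simp
  qed
  then show ?thesis unfolding D_alt by (intro ext sum.cong) auto
qed

lemma D_norm_le_L2:
  assumes f: "f \<in> L2 M" and K: "\<And>\<omega>. cmod (\<phi> \<omega>) \<le> K"
  shows "L2_norm M (D \<phi> f) \<le> K * L2_norm M f"
proof -
  have K0: "0 \<le> K" using K[of 0] norm_ge_zero order_trans by blast
  have "L2_norm M (D \<phi> (W f)) \<le> K * L2_norm M (W f)" using K K0 by (intro D_norm_le averaging_cells)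
  also have "\<dots> \<le> K * L2_norm M f" using K0 by (intro mult_left_mono averaging_norm_le f)
  finally show ?thesis by (simp add: D_averaging[OF f])
qed

lemma D_one_averaging: "f \<in> L2 M \<Longrightarrow> AE x in M. D (\<lambda>\<omega>. 1) f x = W f x"
  using D_one[OF averaging_cells[of f]] D_averaging[of f] by simp

end

section \<open>From mean convergence in time to convergence of spectral functions\<close>

locale spectral_approximation = flow_approximation M X \<nu> S E \<tau> l q P F
  for M :: "'b::euclidean_space measure" and X and \<nu> and S and E and \<tau> and l and q and P and F +
  fixes v :: "nat \<Rightarrow> nat \<Rightarrow> 'b \<Rightarrow> complex" and \<theta> :: "nat \<Rightarrow> nat \<Rightarrow> real"
  assumes eigenbases: "\<And>n. 1 \<le> n \<Longrightarrow> koopman_eigenbasis M (P n) (F n) (q n) (v n) (\<theta> n)"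
begin

abbreviation Dn :: "nat \<Rightarrow> (real \<Rightarrow> complex) \<Rightarrow> ('b \<Rightarrow> complex) \<Rightarrow> 'b \<Rightarrow> complex" where
  "Dn n \<equiv> discrete_spectral_op M (q n) (v n) (\<lambda>k. \<theta> n k / \<tau> n)"

lemma cell_spectrum: "1 \<le> n \<Longrightarrow> cell_spectrum M (P n) (F n) (q n) (v n) (\<theta> n) (\<tau> n)"
  using cell_map eigenbases \<tau>_pos by (intro cell_spectrum.intro cell_spectrum_axioms.intro)

lemma null_sequenceI:
  fixes x y :: "nat \<Rightarrow> real"
  assumes "\<And>n. 1 \<le> n \<Longrightarrow> x n \<le> y n" "y \<longlonglongrightarrow> 0" "\<And>n. 0 \<le> x n"
  shows "x \<longlonglongrightarrow> 0"
proof (rule tendsto_sandwich[OF _ _ tendsto_const assms(2)])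
  show "\<forall>\<^sub>F n in sequentially. x n \<le> y n"
    using eventually_ge_at_top[of 1] by eventually_elim (rule assms)
qed (use assms in simp)

lemma averaging_tendsto: "g \<in> L2 M \<Longrightarrow> (\<lambda>n. L2_norm M (\<lambda>x. Wn n g x - g x)) \<longlonglongrightarrow> 0"
  using converges_L2 unfolding converges_def by blast

text \<open>The half-line is split at \<open>T\<close>: up to \<open>T\<close> the weight is at most
  1 and the majorant applies; beyond it the two contractions differ by at most
  \<open>2 * L2_norm M g\<close>, against a weight of mass \<open>exp (- T)\<close>.\<close>

lemma kernel_difference_le:
  fixes a :: "real \<Rightarrow> real" and \<epsilon> T :: real
  assumes n: "1 \<le> n" and k: "k \<in> L2 M" and g: "g \<in> L2 M" and T: "0 < T"
    and a: "set_integrable lborel {0..T} a"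
    and le: "\<And>t. t \<in> {0<..T} \<Longrightarrow> L2_norm M (\<lambda>x. Vn n t g x - Ut t g x) \<le> \<epsilon> + a t"
  shows "cmod (L2_inner M k (Dn n (step_kernel (\<tau> n)) g) - L2_inner M k (\<Phi> resolvent g)) \<le>
    L2_norm M k * (\<epsilon> * T + (LBINT t:{0..T}. a t)) + exp (- T) * (2 * L2_norm M k * L2_norm M g)"
proof -
  interpret cell_spectrum M "P n" "F n" "q n" "v n" "\<theta> n" "\<tau> n" using n by (rule cell_spectrum)
  define f1 where "f1 t = complex_of_real (expw t) * L2_inner M k (Vn n t g)" for t
  define f2 where "f2 t = complex_of_real (expw t) * L2_inner M k (Ut t g)" for t
  define b where "b t = L2_norm M k * (indicator {0..T} t *\<^sub>R (\<epsilon> + a t)) +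
      (indicator {T..} t * exp (- t)) * (2 * L2_norm M k * L2_norm M g)" for t
  have f1: "integrable lborel f1" "integral\<^sup>L lborel f1 = L2_inner M k (Dn n (step_kernel (\<tau> n)) g)"
    using step_kernel_inner[OF k averaging_cells[of g]]
    unfolding f1_def[abs_def] Uk_averaging[OF g] D_averaging[OF g] by auto
  have f2: "integrable lborel f2" "integral\<^sup>L lborel f2 = L2_inner M k (\<Phi> resolvent g)"
    using resolvent_inner[OF k g] unfolding f2_def[abs_def] by auto
  have e: "set_integrable lborel {0..T} (\<lambda>t. \<epsilon>)" "(LBINT t:{0..T}. \<epsilon>) = \<epsilon> * T"
    using T by (simp_all add: set_integrable_def set_lebesgue_integral_def)
  have ea: "set_integrable lborel {0..T} (\<lambda>t. \<epsilon> + a t)" "(LBINT t:{0..T}. \<epsilon> + a t) = \<epsilon> * T + (LBINT t:{0..T}. a t)"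
    using set_integral_add[OF e(1) a] e(2) by auto
  have tail: "has_bochner_integral lborel (\<lambda>t. (indicator {T..} t * exp (- t)) * (2 * L2_norm M k * L2_norm M g))
      (exp (- T) * (2 * L2_norm M k * L2_norm M g))"
    by (intro has_bochner_integral_mult_left integrable_exp_minus_atLeast)
  have b_int: "integrable lborel b" and b_val: "integral\<^sup>L lborel b = L2_norm M k * (\<epsilon> * T + (LBINT t:{0..T}. a t)) +
      exp (- T) * (2 * L2_norm M k * L2_norm M g)"
    using ea tail unfolding b_def[abs_def] set_integrable_def set_lebesgue_integral_def
    by (auto simp: has_bochner_integral_iff)
  have diff: "cmod (L2_inner M k (Vn n t g) - L2_inner M k (Ut t g)) \<le> L2_norm M k * L2_norm M (\<lambda>x. Vn n t g x - Ut t g x)" for t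
    using L2_Cauchy_Schwarz[OF k L2_diff[OF Uk_L2 U_L2[OF g]]] L2_inner_diff_right[OF k Uk_L2 U_L2[OF g]]
    by metis
  have far: "L2_norm M (\<lambda>x. Vn n t g x - Ut t g x) \<le> 2 * L2_norm M g" for t
    using L2_norm_triangle_sub[OF Uk_L2 U_L2[OF g], of "nat \<lceil>t / \<tau> n\<rceil>" g t]
      Uk_norm_le[OF g, of "nat \<lceil>t / \<tau> n\<rceil>"] U_norm_le[OF g, of t] by linarith
  \<comment> \<open>Time 0 is left out: the estimate by the majorant is given only on
    \<open>{0<..T}\<close>, so \<open>b 0\<close> might be negative.\<close>
  have bound: "cmod (f1 t - f2 t) \<le> b t" if t0: "t \<noteq> 0" for t
  proof -
    have eq: "cmod (f1 t - f2 t) = expw t * cmod (L2_inner M k (Vn n t g) - L2_inner M k (Ut t g))"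
      unfolding f1_def f2_def right_diff_distrib[symmetric] norm_mult by simp
    consider "t < 0" | "0 < t" "t \<le> T" | "T < t" using t0 by linarith
    then show ?thesis
    proof cases
      case 1
      then show ?thesis unfolding eq using T by (simp add: b_def expw_def)
    next
      case 2
      have "cmod (f1 t - f2 t) \<le> 1 * (L2_norm M k * L2_norm M (\<lambda>x. Vn n t g x - Ut t g x))"
        unfolding eq by (intro mult_mono diff) auto
      also have "\<dots> \<le> L2_norm M k * (\<epsilon> + a t)" using le[of t] 2 by (simp add: mult_left_mono)
      also have "\<dots> \<le> b t" using 2 by (simp add: b_def)
      finally show ?thesis .
    next
      case 3
      have "cmod (f1 t - f2 t) \<le> exp (- t) * (L2_norm M k * (2 * L2_norm M g))"
        unfolding eq using 3 T by (intro mult_mono order_trans[OF diff] mult_left_mono far) (auto simp: expw_def)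
      also have "\<dots> = b t" using 3 by (simp add: b_def)
      finally show ?thesis by simp
    qed
  qed
  have "L2_inner M k (Dn n (step_kernel (\<tau> n)) g) - L2_inner M k (\<Phi> resolvent g) = (LINT t|lborel. f1 t - f2 t)"
    using f1 f2 by simp
  also have "cmod \<dots> \<le> (LINT t|lborel. cmod (f1 t - f2 t))" by (rule integral_norm_bound)
  also have "\<dots> \<le> integral\<^sup>L lborel b"
  proof (rule integral_mono_AE)
    show "AE t in lborel. cmod (f1 t - f2 t) \<le> b t"
      using AE_lborel_singleton[of 0] by eventually_elim (rule bound)
  qed (use f1 f2 b_int in auto)
  finally show ?thesis unfolding b_val .
qed

text \<open>Choices are made in the order \<open>T\<close>, \<open>\<epsilon>\<close>,
  \<open>n\<close>. Four quarters of \<open>e\<close> pay for the tail beyond \<open>T\<close>, the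
  slack \<open>\<epsilon>\<close> over the time interval, the integral of the majorant, and the
  exchange of the stepped kernel for the resolvent.\<close>

lemma resolvent_weak:
  assumes k: "k \<in> L2 M" and g: "g \<in> L2 M"
  shows "(\<lambda>n. L2_inner M k (Dn n resolvent g)) \<longlonglongrightarrow> L2_inner M k (\<Phi> resolvent g)"
proof (rule LIM_zero_cancel, rule tendsto_norm_zero_cancel, rule order_tendstoI)
  fix e :: real assume "e < 0"
  then show "\<forall>\<^sub>F n in sequentially. e < cmod (L2_inner M k (Dn n resolvent g) - L2_inner M k (\<Phi> resolvent g))"
    by (intro always_eventually allI less_le_trans[OF _ norm_ge_zero])
next
  fix e :: real assume e: "0 < e"
  define Nk where "Nk = L2_norm M k"
  define Ng where "Ng = L2_norm M g"
  have N: "0 \<le> Nk" "0 \<le> Ng" by (simp_all add: Nk_def Ng_def)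
  have "((\<lambda>T. exp (- T) * (2 * Nk * Ng)) \<longlongrightarrow> 0 * (2 * Nk * Ng)) at_top"
    by (intro tendsto_intros filterlim_compose[OF exp_at_bot] filterlim_uminus_at_bot_at_top)
  then have "\<forall>\<^sub>F T in at_top. exp (- T) * (2 * Nk * Ng) < e / 4"
    using e by (intro order_tendstoD(2)[where y="0 * (2 * Nk * Ng)"]) auto
  then have "\<forall>\<^sub>F T in at_top. exp (- T) * (2 * Nk * Ng) < e / 4 \<and> 0 < T"
    using eventually_gt_at_top[of "0::real"] by (rule eventually_conj)
  then obtain T where T: "0 < T" "exp (- T) * (2 * Nk * Ng) < e / 4"
    using eventually_happens'[OF trivial_limit_at_top_linorder] by blast
  \<comment> \<open>The factor \<open>T\<close> offsets the length of the time interval, and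
    \<open>Nk + 1\<close> avoids division by zero.\<close>
  define \<epsilon> where "\<epsilon> = e / (4 * ((Nk + 1) * T))"
  have eps: "0 < \<epsilon>" using e T N by (simp add: \<epsilon>_def)
  have NeT: "Nk * (\<epsilon> * T) \<le> e / 4"
  proof -
    have "Nk * (\<epsilon> * T) \<le> (Nk + 1) * (\<epsilon> * T)" using eps T by (intro mult_right_mono) auto
    also have "\<dots> = e / 4"
    proof -
      have "R * (e / (4 * (R * T)) * T) = e / 4" if "0 < R" for R using that T(1) by simp
      from this[of "Nk + 1"] show ?thesis using N unfolding \<epsilon>_def by simp
    qed
    finally show ?thesis .
  qed
  obtain a where a: "vanishing_on T a"
    "\<forall>\<^sub>F n in sequentially. \<forall>t\<in>{0<..T}. L2_norm M (\<lambda>x. Vn n t g x - Ut t g x) \<le> \<epsilon> + a n t"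
    using converges_L2[OF g] T(1) eps unfolding converges_def by blast
  have "(\<lambda>n. Nk * (LBINT t:{0..T}. a n t)) \<longlonglongrightarrow> Nk * 0"
    using a(1) by (intro tendsto_intros) (simp add: vanishing_on_def)
  then have ev1: "\<forall>\<^sub>F n in sequentially. Nk * (LBINT t:{0..T}. a n t) < e / 4"
    using e by (intro order_tendstoD(2)[where y="Nk * 0"]) auto
  have "(\<lambda>n. Nk * (30 * \<tau> n * Ng)) \<longlonglongrightarrow> Nk * (30 * 0 * Ng)" by (intro tendsto_intros \<tau>_lim)
  then have ev2: "\<forall>\<^sub>F n in sequentially. Nk * (30 * \<tau> n * Ng) < e / 4"
    using e by (intro order_tendstoD(2)[where y="Nk * (30 * 0 * Ng)"]) auto
  have ev3: "\<forall>\<^sub>F n in sequentially. \<tau> n < 1" using \<tau>_lim by (rule order_tendstoD) simp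
  have ev4: "\<forall>\<^sub>F n in sequentially. set_integrable lborel {0..T} (a n)" using a(1) by (simp add: vanishing_on_def)
  show "\<forall>\<^sub>F n in sequentially. cmod (L2_inner M k (Dn n resolvent g) - L2_inner M k (\<Phi> resolvent g)) < e"
    using eventually_ge_at_top[of 1] a(2) ev1 ev2 ev3 ev4
  proof eventually_elim
    fix n assume n: "1 \<le> n" and le: "\<forall>t\<in>{0<..T}. L2_norm M (\<lambda>x. Vn n t g x - Ut t g x) \<le> \<epsilon> + a n t"
      and 1: "Nk * (LBINT t:{0..T}. a n t) < e / 4" and 2: "Nk * (30 * \<tau> n * Ng) < e / 4"
      and 3: "\<tau> n < 1" and 4: "set_integrable lborel {0..T} (a n)"
    interpret cell_spectrum M "P n" "F n" "q n" "v n" "\<theta> n" "\<tau> n" using n by (rule cell_spectrum)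
    have A: "cmod (L2_inner M k (Dn n (step_kernel (\<tau> n)) g) - L2_inner M k (\<Phi> resolvent g)) \<le>
        Nk * (\<epsilon> * T + (LBINT t:{0..T}. a n t)) + exp (- T) * (2 * Nk * Ng)"
      unfolding Nk_def Ng_def by (rule kernel_difference_le[OF n k g T(1) 4]) (rule bspec[OF le])
    have "L2_norm M (\<lambda>x. Dn n (step_kernel (\<tau> n)) g x - Dn n resolvent g x) \<le> 30 * \<tau> n * L2_norm M (Wn n g)"
      using D_resolvent_step_kernel[OF averaging_cells[of g] less_imp_le[OF 3]] unfolding D_averaging[OF g] .
    also have "\<dots> \<le> 30 * \<tau> n * Ng" unfolding Ng_def using h_pos by (intro mult_left_mono averaging_norm_le g) auto
    finally have "Nk * L2_norm M (\<lambda>x. Dn n (step_kernel (\<tau> n)) g x - Dn n resolvent g x) \<le> Nk * (30 * \<tau> n * Ng)"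
      using N by (intro mult_left_mono)
    moreover have "cmod (L2_inner M k (Dn n (step_kernel (\<tau> n)) g) - L2_inner M k (Dn n resolvent g)) \<le>
        Nk * L2_norm M (\<lambda>x. Dn n (step_kernel (\<tau> n)) g x - Dn n resolvent g x)"
      unfolding Nk_def L2_inner_diff_right[OF k D_L2 D_L2, symmetric] by (intro L2_Cauchy_Schwarz k L2_diff D_L2)
    moreover have "cmod (L2_inner M k (Dn n resolvent g) - L2_inner M k (\<Phi> resolvent g)) \<le>
        cmod (L2_inner M k (Dn n (step_kernel (\<tau> n)) g) - L2_inner M k (Dn n resolvent g)) +
        cmod (L2_inner M k (Dn n (step_kernel (\<tau> n)) g) - L2_inner M k (\<Phi> resolvent g))"
      using dist_triangle3[of "L2_inner M k (Dn n resolvent g)" "L2_inner M k (\<Phi> resolvent g)"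
          "L2_inner M k (Dn n (step_kernel (\<tau> n)) g)"] by (simp add: dist_norm)
    ultimately show "cmod (L2_inner M k (Dn n resolvent g) - L2_inner M k (\<Phi> resolvent g)) < e"
      using A 1 2 NeT T(2) by (simp only: distrib_left)
  qed
qed

text \<open>Strong convergence on all of \<open>L2\<close>, with measurability and boundedness
  included so that the functional calculus applies. The limit is any \<open>h\<close> with
  \<open>has \<phi> g h\<close>, not the chosen \<open>\<Phi> \<phi> g\<close>, so that limits can
  be computed from linearity and products directly.\<close>

definition spectrally_convergent :: "(real \<Rightarrow> complex) \<Rightarrow> bool" where
  "spectrally_convergent \<phi> \<longleftrightarrow> \<phi> \<in> borel_measurable borel \<and> bounded (range \<phi>) \<and>
     (\<forall>g\<in>L2 M. \<exists>h. has \<phi> g h \<and> (\<lambda>n. L2_norm M (\<lambda>x. Dn n \<phi> g x - h x)) \<longlonglongrightarrow> 0)"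

text \<open>The discrete calculus sends the constant 1 to averaging, so this rests on the strong
  convergence of the averages to the identity.\<close>

lemma spectrally_convergent_const: "spectrally_convergent (\<lambda>\<omega>. c)"
  unfolding spectrally_convergent_def
proof (intro conjI ballI)
  fix g assume g: "g \<in> L2 M"
  show "\<exists>h. has (\<lambda>\<omega>. c) g h \<and> (\<lambda>n. L2_norm M (\<lambda>x. Dn n (\<lambda>\<omega>. c) g x - h x)) \<longlonglongrightarrow> 0"
  proof (intro exI conjI)
    show "has (\<lambda>\<omega>. c) g (\<lambda>x. c * g x)" by (rule has_const[OF g])
    show "(\<lambda>n. L2_norm M (\<lambda>x. Dn n (\<lambda>\<omega>. c) g x - c * g x)) \<longlonglongrightarrow> 0"
    proof (rule null_sequenceI)
      have "(\<lambda>n. cmod c * L2_norm M (\<lambda>x. Wn n g x - g x)) \<longlonglongrightarrow> cmod c * 0"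
        by (intro tendsto_intros averaging_tendsto g)
      then show "(\<lambda>n. cmod c * L2_norm M (\<lambda>x. Wn n g x - g x)) \<longlonglongrightarrow> 0" by simp
      fix n :: nat assume n: "1 \<le> n"
      interpret cell_spectrum M "P n" "F n" "q n" "v n" "\<theta> n" "\<tau> n" using n by (rule cell_spectrum)
      have "AE x in M. Dn n (\<lambda>\<omega>. c) g x - c * g x = c * (Wn n g x - g x)"
        using D_one_averaging[OF g]
      proof eventually_elim
        fix x assume "Dn n (\<lambda>\<omega>. 1) g x = Wn n g x"
        moreover have "Dn n (\<lambda>\<omega>. c) g x = c * Dn n (\<lambda>\<omega>. 1) g x"
          by (simp add: D_alt sum_distrib_left mult.assoc)
        ultimately show "Dn n (\<lambda>\<omega>. c) g x - c * g x = c * (Wn n g x - g x)" by (simp add: right_diff_distrib)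
      qed
      then have "L2_norm M (\<lambda>x. Dn n (\<lambda>\<omega>. c) g x - c * g x) = L2_norm M (\<lambda>x. c * (Wn n g x - g x))"
        by (intro L2_norm_cong_AE L2_measurable L2_diff L2_scale D_L2 averaging_L2 g)
      then show "L2_norm M (\<lambda>x. Dn n (\<lambda>\<omega>. c) g x - c * g x) \<le> cmod c * L2_norm M (\<lambda>x. Wn n g x - g x)"
        by (simp add: L2_norm_scale)
    qed simp
  qed
qed (auto simp: bounded_iff)

lemma spectrally_convergent_linear:
  assumes \<phi>: "spectrally_convergent \<phi>" and \<psi>: "spectrally_convergent \<psi>"
  shows "spectrally_convergent (\<lambda>\<omega>. a * \<phi> \<omega> + b * \<psi> \<omega>)"
proof -
  have m: "\<phi> \<in> borel_measurable borel" "bounded (range \<phi>)" "\<psi> \<in> borel_measurable borel" "bounded (range \<psi>)"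
    using \<phi> \<psi> by (auto simp: spectrally_convergent_def)
  note [measurable] = m(1,3)
  show ?thesis
    unfolding spectrally_convergent_def
  proof (intro conjI ballI)
    show "(\<lambda>\<omega>. a * \<phi> \<omega> + b * \<psi> \<omega>) \<in> borel_measurable borel" by measurable
    show "bounded (range (\<lambda>\<omega>. a * \<phi> \<omega> + b * \<psi> \<omega>))"
      using bounded_plus_comp[OF bounded_linear_image[OF m(2) bounded_linear_mult_right[of a], unfolded image_image]
          bounded_linear_image[OF m(4) bounded_linear_mult_right[of b], unfolded image_image]] .
    fix g assume g: "g \<in> L2 M"
    obtain h where h: "has \<phi> g h" "(\<lambda>n. L2_norm M (\<lambda>x. Dn n \<phi> g x - h x)) \<longlonglongrightarrow> 0"
      using \<phi> g unfolding spectrally_convergent_def by blast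
    obtain k where k: "has \<psi> g k" "(\<lambda>n. L2_norm M (\<lambda>x. Dn n \<psi> g x - k x)) \<longlonglongrightarrow> 0"
      using \<psi> g unfolding spectrally_convergent_def by blast
    show "\<exists>h. has (\<lambda>\<omega>. a * \<phi> \<omega> + b * \<psi> \<omega>) g h \<and>
        (\<lambda>n. L2_norm M (\<lambda>x. Dn n (\<lambda>\<omega>. a * \<phi> \<omega> + b * \<psi> \<omega>) g x - h x)) \<longlonglongrightarrow> 0"
    proof (intro exI conjI)
      show "has (\<lambda>\<omega>. a * \<phi> \<omega> + b * \<psi> \<omega>) g (\<lambda>x. a * h x + b * k x)" by (rule has_linear[OF m h(1) k(1) g])
      show "(\<lambda>n. L2_norm M (\<lambda>x. Dn n (\<lambda>\<omega>. a * \<phi> \<omega> + b * \<psi> \<omega>) g x - (a * h x + b * k x))) \<longlonglongrightarrow> 0"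
      proof (rule null_sequenceI)
        have "(\<lambda>n. cmod a * L2_norm M (\<lambda>x. Dn n \<phi> g x - h x) + cmod b * L2_norm M (\<lambda>x. Dn n \<psi> g x - k x))
            \<longlonglongrightarrow> cmod a * 0 + cmod b * 0" by (intro tendsto_intros h k)
        then show "(\<lambda>n. cmod a * L2_norm M (\<lambda>x. Dn n \<phi> g x - h x) + cmod b * L2_norm M (\<lambda>x. Dn n \<psi> g x - k x)) \<longlonglongrightarrow> 0"
          by simp
        fix n :: nat assume n: "1 \<le> n"
        interpret cell_spectrum M "P n" "F n" "q n" "v n" "\<theta> n" "\<tau> n" using n by (rule cell_spectrum)
        show "L2_norm M (\<lambda>x. Dn n (\<lambda>\<omega>. a * \<phi> \<omega> + b * \<psi> \<omega>) g x - (a * h x + b * k x)) \<le>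
            cmod a * L2_norm M (\<lambda>x. Dn n \<phi> g x - h x) + cmod b * L2_norm M (\<lambda>x. Dn n \<psi> g x - k x)"
          unfolding D_linear by (intro L2_norm_combination_le D_L2 has_L2[OF h(1)] has_L2[OF k(1)])
      qed simp
    qed
  qed
qed

text \<open>The error is \<open>Dn n \<phi>\<close> applied to \<open>Dn n \<psi> g - h\<close>,
  plus \<open>Dn n \<phi> h - k\<close>. The first part needs norm convergence of the inner factor
  and a bound on \<open>Dn n \<phi>\<close> uniform in \<open>n\<close>; weak convergence would not
  suffice.\<close>

lemma spectrally_convergent_mult:
  assumes \<phi>: "spectrally_convergent \<phi>" and \<psi>: "spectrally_convergent \<psi>"
  shows "spectrally_convergent (\<lambda>\<omega>. \<phi> \<omega> * \<psi> \<omega>)"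
proof -
  have m: "\<phi> \<in> borel_measurable borel" "bounded (range \<phi>)" "\<psi> \<in> borel_measurable borel" "bounded (range \<psi>)"
    using \<phi> \<psi> by (auto simp: spectrally_convergent_def)
  note [measurable] = m(1,3)
  obtain K where K: "\<And>\<omega>. cmod (\<phi> \<omega>) \<le> K" using m(2) by (auto simp: bounded_iff)
  obtain K' where K': "\<And>\<omega>. cmod (\<psi> \<omega>) \<le> K'" using m(4) by (auto simp: bounded_iff)
  have K0: "0 \<le> K" using K[of 0] norm_ge_zero order_trans by blast
  show ?thesis
    unfolding spectrally_convergent_def
  proof (intro conjI ballI)
    show "(\<lambda>\<omega>. \<phi> \<omega> * \<psi> \<omega>) \<in> borel_measurable borel" by measurable
    show "bounded (range (\<lambda>\<omega>. \<phi> \<omega> * \<psi> \<omega>))"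
      unfolding bounded_iff using K K' K0 by (auto simp: norm_mult intro!: exI[of _ "K * K'"] mult_mono)
    fix g assume g: "g \<in> L2 M"
    obtain h where h: "has \<psi> g h" "(\<lambda>n. L2_norm M (\<lambda>x. Dn n \<psi> g x - h x)) \<longlonglongrightarrow> 0"
      using \<psi> g unfolding spectrally_convergent_def by blast
    note hL = has_L2[OF h(1)]
    obtain k where k: "has \<phi> h k" "(\<lambda>n. L2_norm M (\<lambda>x. Dn n \<phi> h x - k x)) \<longlonglongrightarrow> 0"
      using \<phi> hL unfolding spectrally_convergent_def by blast
    show "\<exists>h. has (\<lambda>\<omega>. \<phi> \<omega> * \<psi> \<omega>) g h \<and> (\<lambda>n. L2_norm M (\<lambda>x. Dn n (\<lambda>\<omega>. \<phi> \<omega> * \<psi> \<omega>) g x - h x)) \<longlonglongrightarrow> 0"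
    proof (intro exI conjI)
      show "has (\<lambda>\<omega>. \<phi> \<omega> * \<psi> \<omega>) g k" by (rule has_mult[OF m h(1) k(1) g])
      show "(\<lambda>n. L2_norm M (\<lambda>x. Dn n (\<lambda>\<omega>. \<phi> \<omega> * \<psi> \<omega>) g x - k x)) \<longlonglongrightarrow> 0"
      proof (rule null_sequenceI)
        have "(\<lambda>n. K * L2_norm M (\<lambda>x. Dn n \<psi> g x - h x) + L2_norm M (\<lambda>x. Dn n \<phi> h x - k x)) \<longlonglongrightarrow> K * 0 + 0"
          by (intro tendsto_intros h k)
        then show "(\<lambda>n. K * L2_norm M (\<lambda>x. Dn n \<psi> g x - h x) + L2_norm M (\<lambda>x. Dn n \<phi> h x - k x)) \<longlonglongrightarrow> 0"
          by simp
        fix n :: nat assume n: "1 \<le> n"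
        interpret cell_spectrum M "P n" "F n" "q n" "v n" "\<theta> n" "\<tau> n" using n by (rule cell_spectrum)
        have "L2_norm M (\<lambda>x. Dn n \<phi> (Dn n \<psi> g) x - k x) \<le>
            L2_norm M (\<lambda>x. Dn n \<phi> (Dn n \<psi> g) x - Dn n \<phi> h x) + L2_norm M (\<lambda>x. Dn n \<phi> h x - k x)"
          by (intro L2_norm_dist_triangle D_L2 has_L2[OF k(1)])
        also have "L2_norm M (\<lambda>x. Dn n \<phi> (Dn n \<psi> g) x - Dn n \<phi> h x) \<le> K * L2_norm M (\<lambda>x. Dn n \<psi> g x - h x)"
          unfolding D_diff_arg[OF D_L2 hL, symmetric] by (intro D_norm_le_L2 L2_diff D_L2 hL K)
        finally show "L2_norm M (\<lambda>x. Dn n (\<lambda>\<omega>. \<phi> \<omega> * \<psi> \<omega>) g x - k x) \<le>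
            K * L2_norm M (\<lambda>x. Dn n \<psi> g x - h x) + L2_norm M (\<lambda>x. Dn n \<phi> h x - k x)"
          by (simp add: D_mult)
      qed simp
    qed
  qed
qed

text \<open>Both calculi are bounded by the uniform norm of the multiplier, so one
  \<open>\<psi>\<close> serves all \<open>n\<close> at once in an argument with three thirds of
  \<open>e\<close>.\<close>

lemma spectrally_convergent_uniform_limit:
  assumes m: "\<phi> \<in> borel_measurable borel" "bounded (range \<phi>)"
    and approx: "\<And>\<epsilon>. 0 < \<epsilon> \<Longrightarrow> \<exists>\<psi>. spectrally_convergent \<psi> \<and> (\<forall>\<omega>. cmod (\<phi> \<omega> - \<psi> \<omega>) \<le> \<epsilon>)"
  shows "spectrally_convergent \<phi>"
  unfolding spectrally_convergent_def
proof (intro conjI ballI m)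
  fix g assume g: "g \<in> L2 M"
  obtain h where h: "has \<phi> g h" using has_exists[OF m g] by blast
  note hL = has_L2[OF h]
  have "(\<lambda>n. L2_norm M (\<lambda>x. Dn n \<phi> g x - h x)) \<longlonglongrightarrow> 0"
  proof (rule order_tendstoI)
    fix e :: real assume "e < 0"
    then show "\<forall>\<^sub>F n in sequentially. e < L2_norm M (\<lambda>x. Dn n \<phi> g x - h x)"
      by (intro always_eventually allI less_le_trans[OF _ L2_norm_nonneg])
  next
    fix e :: real assume e: "0 < e"
    define \<epsilon> where "\<epsilon> = e / (3 * (L2_norm M g + 1))"
    have p: "0 < L2_norm M g + 1" using L2_norm_nonneg[of M g] by linarith
    have eps: "0 < \<epsilon>" using e p by (simp add: \<epsilon>_def)
    have "\<epsilon> * L2_norm M g \<le> \<epsilon> * (L2_norm M g + 1)" using eps by (intro mult_left_mono) auto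
    also have "\<dots> = e / 3"
    proof -
      have "(e / (3 * R)) * R = e / 3" if "0 < R" for R :: real using that by simp
      from this[OF p] show ?thesis unfolding \<epsilon>_def .
    qed
    finally have eg: "\<epsilon> * L2_norm M g \<le> e / 3" .
    obtain \<psi> where \<psi>: "spectrally_convergent \<psi>" "\<And>\<omega>. cmod (\<phi> \<omega> - \<psi> \<omega>) \<le> \<epsilon>" using approx[OF eps] by blast
    have m': "\<psi> \<in> borel_measurable borel" "bounded (range \<psi>)" using \<psi>(1) by (auto simp: spectrally_convergent_def)
    obtain k where k: "has \<psi> g k" "(\<lambda>n. L2_norm M (\<lambda>x. Dn n \<psi> g x - k x)) \<longlonglongrightarrow> 0"
      using \<psi>(1) g unfolding spectrally_convergent_def by blast
    note kL = has_L2[OF k(1)]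
    note [measurable] = m(1) m'(1)
    have "has (\<lambda>\<omega>. 1 * \<psi> \<omega> + (-1) * \<phi> \<omega>) g (\<lambda>x. 1 * k x + (-1) * h x)"
      by (rule has_linear[OF m' m k(1) h g])
    then have "L2_norm M (\<lambda>x. 1 * k x + (-1) * h x) \<le> \<epsilon> * L2_norm M g"
      using \<psi>(2) by (intro has_norm_le[OF _ _ g]) (auto simp: norm_minus_commute)
    then have kh: "L2_norm M (\<lambda>x. k x - h x) \<le> e / 3" using eg by simp
    have "\<forall>\<^sub>F n in sequentially. L2_norm M (\<lambda>x. Dn n \<psi> g x - k x) < e / 3"
      using k(2) e by (intro order_tendstoD(2)[where y=0]) auto
    with eventually_ge_at_top[of 1] show "\<forall>\<^sub>F n in sequentially. L2_norm M (\<lambda>x. Dn n \<phi> g x - h x) < e"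
    proof eventually_elim
      fix n :: nat assume n: "1 \<le> n" and b: "L2_norm M (\<lambda>x. Dn n \<psi> g x - k x) < e / 3"
      interpret cell_spectrum M "P n" "F n" "q n" "v n" "\<theta> n" "\<tau> n" using n by (rule cell_spectrum)
      have "(\<lambda>x. Dn n \<phi> g x - Dn n \<psi> g x) = Dn n (\<lambda>\<omega>. \<phi> \<omega> - \<psi> \<omega>) g"
        using D_linear[of 1 \<phi> "-1" \<psi> g] by simp
      then have c: "L2_norm M (\<lambda>x. Dn n \<phi> g x - Dn n \<psi> g x) \<le> e / 3"
        using D_norm_le_L2[OF g, of "\<lambda>\<omega>. \<phi> \<omega> - \<psi> \<omega>" \<epsilon>] \<psi>(2) eg by simp
      have "L2_norm M (\<lambda>x. Dn n \<phi> g x - h x) \<le> L2_norm M (\<lambda>x. Dn n \<phi> g x - Dn n \<psi> g x) + L2_norm M (\<lambda>x. Dn n \<psi> g x - h x)"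
        by (intro L2_norm_dist_triangle D_L2 hL)
      moreover have "L2_norm M (\<lambda>x. Dn n \<psi> g x - h x) \<le> L2_norm M (\<lambda>x. Dn n \<psi> g x - k x) + L2_norm M (\<lambda>x. k x - h x)"
        by (intro L2_norm_dist_triangle D_L2 hL kL)
      ultimately show "L2_norm M (\<lambda>x. Dn n \<phi> g x - h x) < e" using b c kh by linarith
    qed
  qed
  then show "\<exists>h. has \<phi> g h \<and> (\<lambda>n. L2_norm M (\<lambda>x. Dn n \<phi> g x - h x)) \<longlonglongrightarrow> 0" using h by blast
qed

end

section \<open>The Cayley transform and the unit circle\<close>

definition cayley :: "real \<Rightarrow> complex" where
  "cayley \<omega> = 2 * resolvent \<omega> - 1"

lemma cayley_eq: "cayley \<omega> = (1 + \<i> * of_real \<omega>) / (1 - \<i> * of_real \<omega>)"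
  using one_minus_ii_nonzero[of \<omega>] by (simp add: cayley_def resolvent_def field_simps)

lemma norm_cayley [simp]: "cmod (cayley \<omega>) = 1"
proof -
  have "cmod (1 + \<i> * of_real \<omega>) = cmod (1 - \<i> * of_real \<omega>)" by (simp add: cmod_def)
  then show ?thesis using one_minus_ii_nonzero[of \<omega>] by (simp add: cayley_eq norm_divide)
qed

lemma cayley_measurable [measurable]: "cayley \<in> borel_measurable borel"
  unfolding cayley_def by measurable

lemma cnj_cayley_mult: "cnj (cayley \<omega>) * cayley \<omega> = 1"
  by (metis complex_norm_square mult.commute norm_cayley of_real_1 one_power2)

text \<open>\<open>cayley \<omega> + 1\<close> is twice the resolvent, so the quotient collapses to
  \<open>1 - 1 / resolvent \<omega>\<close>, which is \<open>\<i> \<omega>\<close>.\<close>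

lemma cayley_inverse: "Im ((cayley \<omega> - 1) / (cayley \<omega> + 1)) = \<omega>"
proof -
  have r: "resolvent \<omega> \<noteq> 0" using one_minus_ii_nonzero[of \<omega>] by (simp add: resolvent_def)
  have "(cayley \<omega> - 1) / (cayley \<omega> + 1) = 1 - 1 / resolvent \<omega>"
    using r by (simp add: cayley_def field_simps)
  also have "\<dots> = \<i> * of_real \<omega>" by (simp add: resolvent_def)
  finally show ?thesis by simp
qed

text \<open>On the circle \<open>z * cnj z = 1\<close>, which makes \<open>(z - 1) / (z + 1)\<close>
  purely imaginary; its imaginary part is the frequency.\<close>

lemma cayley_surj:
  assumes "cmod z = 1" "z \<noteq> - 1"
  obtains \<omega> where "z = cayley \<omega>"
proof -
  define w where "w = (z - 1) / (z + 1)"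
  have z1: "z + 1 \<noteq> 0" using assms(2) by (simp add: eq_neg_iff_add_eq_0)
  have zz: "z * cnj z = 1" using assms(1) by (simp flip: complex_norm_square)
  have "w + cnj w = ((z - 1) * (cnj z + 1) + (cnj z - 1) * (z + 1)) / ((z + 1) * (cnj z + 1))"
  proof -
    have "cnj z + 1 \<noteq> 0" using z1 by (metis complex_cnj_add complex_cnj_one complex_cnj_zero_iff)
    then show ?thesis using z1 by (simp add: w_def add_frac_eq)
  qed
  also have "(z - 1) * (cnj z + 1) + (cnj z - 1) * (z + 1) = 2 * (z * cnj z) - 2" by (simp add: algebra_simps)
  finally have "w + cnj w = 0" by (simp add: zz)
  then have "Re w = 0" by (simp add: complex_add_cnj)
  then have w: "w = \<i> * of_real (Im w)" by (simp add: complex_eq_iff)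
  have ne: "1 - w \<noteq> 0" using one_minus_ii_nonzero[of "Im w"] w by simp
  have "1 + w = 2 * z / (z + 1)" "1 - w = 2 / (z + 1)" using z1 by (simp_all add: w_def field_simps)
  then have "z = (1 + w) / (1 - w)" using z1 by simp
  also have "\<dots> = cayley (Im w)" unfolding cayley_eq using w by simp
  finally show thesis by (rule that)
qed

text \<open>The Cayley transform compactifies the line by the point \<open>-1\<close> of the unit circle.\<close>

lemma continuous_on_circle_extension:
  fixes \<phi> :: "real \<Rightarrow> complex"
  assumes cont: "continuous_on UNIV \<phi>" and vanish: "(\<phi> \<longlongrightarrow> 0) at_infinity"
  shows "continuous_on (sphere 0 1) (\<lambda>z. if z = - 1 then 0 else \<phi> (Im ((z - 1) / (z + 1))))"
    (is "continuous_on _ ?f")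
  unfolding continuous_on_eq_continuous_within
proof
  fix z :: complex assume z: "z \<in> sphere 0 1"
  show "continuous (at z within sphere 0 1) ?f"
  proof (cases "z = - 1")
    case True
    have "(?f \<longlongrightarrow> 0) (at (- 1) within sphere 0 1)"
    proof (rule tendstoI)
      fix \<epsilon> :: real assume "0 < \<epsilon>"
      from tendstoD[OF vanish this] obtain b where b: "\<And>\<omega>. b \<le> \<bar>\<omega>\<bar> \<Longrightarrow> cmod (\<phi> \<omega>) < \<epsilon>"
        unfolding eventually_at_infinity by auto
      \<comment> \<open>The distance of \<open>cayley \<omega>\<close> from \<open>- 1\<close> is 2
        divided by the modulus of \<open>1 - \<i> \<omega>\<close>, which is at most
        \<open>1 + \<bar>\<omega>\<bar>\<close>; a distance below \<open>d\<close> therefore forces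
        \<open>\<bar>\<omega>\<bar> > \<bar>b\<bar>\<close>.\<close>
      define d where "d = 2 / (1 + \<bar>b\<bar>)"
      have d: "0 < d" by (simp add: d_def add_pos_nonneg)
      have "dist (?f x) 0 < \<epsilon>" if x: "x \<in> sphere 0 1" "x \<noteq> - 1" "dist x (- 1) < d" for x
      proof -
        obtain \<omega> where \<omega>: "x = cayley \<omega>" using cayley_surj[of x] x by auto
        have n0: "0 < cmod (1 - \<i> * of_real \<omega>)" using one_minus_ii_nonzero[of \<omega>] by simp
        have "dist x (- 1) = 2 / cmod (1 - \<i> * of_real \<omega>)"
          by (simp add: dist_norm \<omega> cayley_def resolvent_def norm_divide)
        then have "2 / cmod (1 - \<i> * of_real \<omega>) < 2 / (1 + \<bar>b\<bar>)" using x(3) by (simp add: d_def)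
        then have "1 + \<bar>b\<bar> < cmod (1 - \<i> * of_real \<omega>)" using n0 by (simp add: divide_simps split: if_splits)
        also have "\<dots> \<le> 1 + \<bar>\<omega>\<bar>" using norm_triangle_ineq4[of 1 "\<i> * of_real \<omega>"] by (simp add: norm_mult)
        finally have "b \<le> \<bar>\<omega>\<bar>" by linarith
        then have "cmod (\<phi> \<omega>) < \<epsilon>" by (rule b)
        moreover have "?f x = \<phi> \<omega>" using x(2) unfolding \<omega> cayley_inverse by simp
        ultimately show ?thesis by simp
      qed
      then show "\<forall>\<^sub>F x in at (- 1) within sphere 0 1. dist (?f x) 0 < \<epsilon>"
        unfolding eventually_at using d by blast
    qed
    then show ?thesis unfolding True continuous_within by simp
  next
    case False
    have ne: "z + 1 \<noteq> 0" using False by (simp add: eq_neg_iff_add_eq_0)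
    have c: "isCont \<phi> y" for y using cont by (simp add: continuous_on_eq_continuous_at)
    have "isCont (\<lambda>z. (z - 1) / (z + 1)) z" using ne by (intro continuous_intros) auto
    then have "isCont (\<lambda>z. Im ((z - 1) / (z + 1))) z" unfolding isCont_def by (rule tendsto_Im)
    then have "isCont (\<lambda>z. \<phi> (Im ((z - 1) / (z + 1)))) z" by (rule isCont_o2[OF _ c])
    then have "continuous (at z within sphere 0 1) (\<lambda>z. \<phi> (Im ((z - 1) / (z + 1))))"
      by (rule continuous_at_imp_continuous_at_within)
    then show ?thesis
    proof (rule continuous_transform_within[where \<delta>="dist z (- 1)"])
      show "0 < dist z (- 1)" using False by simp
      show "\<phi> (Im ((x - 1) / (x + 1))) = ?f x" if "x \<in> sphere 0 1" "dist x z < dist z (- 1)" for x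
        using that by (auto simp: dist_commute)
    qed (rule z)
  qed
qed

lemma schwartz_continuous:
  assumes "schwartz \<phi>"
  shows "continuous_on UNIV \<phi>"
proof -
  obtain D where D': "D 0 = \<phi> \<and> (\<forall>k x. (D k has_vector_derivative D (Suc k) x) (at x)) \<and>
      (\<forall>j k. bounded (range (\<lambda>x. x ^ j *\<^sub>R D k x)))"
    using assms unfolding schwartz_def by (rule exE)
  note D = D'[THEN conjunct1] and Dd = D'[THEN conjunct2, THEN conjunct1]
  have "isCont \<phi> x" for x using has_vector_derivative_continuous[OF Dd[rule_format, of 0 x]] D by simp
  then show ?thesis by (simp add: continuous_on_eq_continuous_at)
qed

text \<open>The Schwartz bound for \<open>j = 1\<close> and \<open>k = 0\<close> keeps
  \<open>\<bar>x\<bar> * cmod (\<phi> x)\<close> below a constant, which gives decay of order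
  \<open>1 / \<bar>x\<bar>\<close>.\<close>

lemma schwartz_vanishes_at_infinity:
  assumes "schwartz \<phi>"
  shows "(\<phi> \<longlongrightarrow> 0) at_infinity"
proof (rule tendstoI)
  fix \<epsilon> :: real assume e: "0 < \<epsilon>"
  obtain D where D': "D 0 = \<phi> \<and> (\<forall>k x. (D k has_vector_derivative D (Suc k) x) (at x)) \<and>
      (\<forall>j k. bounded (range (\<lambda>x. x ^ j *\<^sub>R D k x)))"
    using assms unfolding schwartz_def by (rule exE)
  note D = D'[THEN conjunct1]
  from D'[THEN conjunct2, THEN conjunct2] have "bounded (range (\<lambda>x. x ^ 1 *\<^sub>R D 0 x))" by (elim allE)
  then obtain C where C: "\<And>x. \<bar>x\<bar> * cmod (\<phi> x) \<le> C" by (auto simp: bounded_iff D)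
  have C0: "0 \<le> C" using C[of 0] by simp
  have "cmod (\<phi> x) < \<epsilon>" if "C / \<epsilon> + 1 \<le> \<bar>x\<bar>" for x
  proof (rule ccontr)
    assume "\<not> ?thesis"
    then have "(C / \<epsilon> + 1) * \<epsilon> \<le> \<bar>x\<bar> * cmod (\<phi> x)" using that e C0 by (intro mult_mono) auto
    also have "\<dots> \<le> C" by (rule C)
    finally show False using e by (simp add: distrib_right)
  qed
  then show "\<forall>\<^sub>F x in at_infinity. dist (\<phi> x) 0 < \<epsilon>"
    unfolding eventually_at_infinity by (auto intro!: exI[of _ "C / \<epsilon> + 1"])
qed

section \<open>Strong convergence for the Cayley transform and for functions vanishing at
  infinity\<close>

context spectral_approximation
begin

text \<open>Since \<open>cayley\<close> is unimodular, weak convergence together with the preservation of norms in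
  the limit gives strong convergence.\<close>

lemma spectrally_convergent_cayley: "spectrally_convergent cayley"
  unfolding spectrally_convergent_def
proof (intro conjI ballI)
  show cm: "cayley \<in> borel_measurable borel" by measurable
  show cb: "bounded (range cayley)" by (auto simp: bounded_iff intro!: exI[of _ 1])
  have ccm: "(\<lambda>\<omega>. cnj (cayley \<omega>)) \<in> borel_measurable borel" by measurable
  have ccb: "bounded (range (\<lambda>\<omega>. cnj (cayley \<omega>)))" by (auto simp: bounded_iff intro!: exI[of _ 1])
  fix g assume g: "g \<in> L2 M"
  let ?R = "\<Phi> resolvent g"
  define h where "h = (\<lambda>x. 2 * ?R x + (-1) * (1 * g x))"
  have R: "has resolvent g ?R" by (intro has_\<Phi> resolvent_bounded g) measurable
  note RL = has_L2[OF R]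
  have "has (\<lambda>\<omega>. 2 * resolvent \<omega> + (-1) * 1) g h"
    unfolding h_def by (rule has_linear[OF _ resolvent_bounded _ _ R has_const[OF g] g]) auto
  moreover have "(\<lambda>\<omega>. 2 * resolvent \<omega> + (-1) * 1) = cayley" by (auto simp: cayley_def)
  ultimately have h: "has cayley g h" by simp
  note hL = has_L2[OF h]
  \<comment> \<open>The calculus sends the product of \<open>cayley\<close> with its conjugate to
    the identity, so the limit operator is isometric: the bound 1 for each factor gives one of the
    two inequalities.\<close>
  have hg: "L2_norm M h = L2_norm M g"
  proof (rule antisym)
    show "L2_norm M h \<le> L2_norm M g" using has_norm_le[OF cm h g, of 1] by simp
    obtain y where y: "has (\<lambda>\<omega>. cnj (cayley \<omega>)) h y" using has_exists[OF ccm ccb hL] by blast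
    have "has (\<lambda>\<omega>. cnj (cayley \<omega>) * cayley \<omega>) g y" by (rule has_mult[OF ccm ccb cm cb h y g])
    then have "has (\<lambda>\<omega>. 1) g y" unfolding cnj_cayley_mult .
    then have "L2_norm M (\<lambda>x. 1 * g x - y x) = 0"
      by (intro has_unique[OF _ _ has_const[OF g] _ g]) (auto simp: bounded_iff)
    then have "L2_norm M g \<le> L2_norm M y"
      using L2_norm_triangle[OF L2_diff[OF g has_L2[OF y]] has_L2[OF y]] by simp
    also have "\<dots> \<le> L2_norm M h" using has_norm_le[OF ccm y hL, of 1] by simp
    finally show "L2_norm M g \<le> L2_norm M h" .
  qed
  have Wlim: "(\<lambda>n. L2_inner M h (Wn n g)) \<longlonglongrightarrow> L2_inner M h g"
  proof (rule LIM_zero_cancel, rule tendsto_norm_zero_cancel, rule null_sequenceI)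
    have "(\<lambda>n. L2_norm M h * L2_norm M (\<lambda>x. Wn n g x - g x)) \<longlonglongrightarrow> L2_norm M h * 0"
      by (intro tendsto_intros averaging_tendsto g)
    then show "(\<lambda>n. L2_norm M h * L2_norm M (\<lambda>x. Wn n g x - g x)) \<longlonglongrightarrow> 0" by simp
    fix n :: nat assume n: "1 \<le> n"
    interpret cell_spectrum M "P n" "F n" "q n" "v n" "\<theta> n" "\<tau> n" using n by (rule cell_spectrum)
    show "cmod (L2_inner M h (Wn n g) - L2_inner M h g) \<le> L2_norm M h * L2_norm M (\<lambda>x. Wn n g x - g x)"
      unfolding L2_inner_diff_right[OF hL averaging_L2 g, symmetric]
      by (intro L2_Cauchy_Schwarz hL L2_diff averaging_L2 g)
  qed simp
  \<comment> \<open>The left side is \<open>L2_inner M h h\<close>, expanded so that its terms are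
    the limits supplied by \<open>resolvent_weak\<close> and \<open>Wlim\<close>.\<close>
  have hh: "2 * L2_inner M h ?R - L2_inner M h g = of_real ((L2_norm M g)\<^sup>2)"
  proof -
    have "L2_inner M h h = 2 * L2_inner M h ?R + (-1) * (1 * L2_inner M h g)"
      by (subst (2) h_def) (simp only: L2_inner_add_right[OF hL L2_scale[OF RL] L2_scale[OF L2_scale[OF g]]] L2_inner_scale_right)
    then show ?thesis by (simp add: L2_inner_self hg)
  qed
  have "(\<lambda>n. 2 * L2_inner M h (Dn n resolvent g) - L2_inner M h (Wn n g)) \<longlonglongrightarrow> of_real ((L2_norm M g)\<^sup>2)"
    unfolding hh[symmetric] by (intro tendsto_intros resolvent_weak hL g Wlim)
  then have Relim: "(\<lambda>n. Re (2 * L2_inner M h (Dn n resolvent g) - L2_inner M h (Wn n g))) \<longlonglongrightarrow> (L2_norm M g)\<^sup>2"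
    using tendsto_Re by fastforce
  \<comment> \<open>In the expanded square each of the two squared norms is at most that of
    \<open>g\<close>, and the real part of the inner product tends to the squared norm of
    \<open>g\<close>; so the upper bound tends to 0.\<close>
  have "(\<lambda>n. (L2_norm M (\<lambda>x. Dn n cayley g x - h x))\<^sup>2) \<longlonglongrightarrow> 0"
  proof (rule null_sequenceI)
    have "(\<lambda>n. 2 * (L2_norm M g)\<^sup>2 - 2 * Re (2 * L2_inner M h (Dn n resolvent g) - L2_inner M h (Wn n g)))
        \<longlonglongrightarrow> 2 * (L2_norm M g)\<^sup>2 - 2 * (L2_norm M g)\<^sup>2"
      by (intro tendsto_intros Relim)
    then show "(\<lambda>n. 2 * (L2_norm M g)\<^sup>2 - 2 * Re (2 * L2_inner M h (Dn n resolvent g) - L2_inner M h (Wn n g))) \<longlonglongrightarrow> 0"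
      by (simp only: diff_self)
    fix n :: nat assume n: "1 \<le> n"
    interpret cell_spectrum M "P n" "F n" "q n" "v n" "\<theta> n" "\<tau> n" using n by (rule cell_spectrum)
    have "AE x in M. Dn n cayley g x = 2 * Dn n resolvent g x - Wn n g x"
    proof -
      have c: "cayley = (\<lambda>\<omega>. 2 * resolvent \<omega> + (-1) * 1)" by (auto simp: cayley_def)
      have "Dn n cayley g = (\<lambda>x. 2 * Dn n resolvent g x + (-1) * Dn n (\<lambda>\<omega>. 1) g x)"
        unfolding c by (rule D_linear[of 2 resolvent "-1" "\<lambda>\<omega>. 1" g])
      then show ?thesis using D_one_averaging[OF g] by (auto elim: eventually_mono)
    qed
    then have "L2_inner M h (Dn n cayley g) = L2_inner M h (\<lambda>x. 2 * Dn n resolvent g x - Wn n g x)"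
      by (intro L2_inner_cong_AE[OF _ _ AE_I2[OF refl]] L2_measurable hL D_L2 L2_diff L2_scale averaging_L2)
    also have "\<dots> = 2 * L2_inner M h (Dn n resolvent g) - L2_inner M h (Wn n g)"
      by (simp only: L2_inner_diff_right[OF hL L2_scale[OF D_L2] averaging_L2] L2_inner_scale_right)
    finally have i: "L2_inner M h (Dn n cayley g) = 2 * L2_inner M h (Dn n resolvent g) - L2_inner M h (Wn n g)" .
    have "L2_norm M (Dn n cayley g) \<le> L2_norm M g" using D_norm_le_L2[OF g, of cayley 1] by simp
    then have "(L2_norm M (Dn n cayley g))\<^sup>2 \<le> (L2_norm M g)\<^sup>2" by (intro power_mono) auto
    moreover have "(L2_norm M (\<lambda>x. Dn n cayley g x - h x))\<^sup>2 =
        (L2_norm M h)\<^sup>2 + (L2_norm M (Dn n cayley g))\<^sup>2 - 2 * Re (L2_inner M h (Dn n cayley g))"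
      using L2_norm_diff_square[OF hL D_L2] by (simp add: L2_norm_minus_commute[of M h])
    ultimately show "(L2_norm M (\<lambda>x. Dn n cayley g x - h x))\<^sup>2 \<le>
        2 * (L2_norm M g)\<^sup>2 - 2 * Re (2 * L2_inner M h (Dn n resolvent g) - L2_inner M h (Wn n g))"
      unfolding i hg by linarith
  qed simp
  then have "(\<lambda>n. sqrt ((L2_norm M (\<lambda>x. Dn n cayley g x - h x))\<^sup>2)) \<longlonglongrightarrow> sqrt 0"
    by (rule tendsto_real_sqrt)
  then have "(\<lambda>n. L2_norm M (\<lambda>x. Dn n cayley g x - h x)) \<longlonglongrightarrow> 0" by simp
  then show "\<exists>h. has cayley g h \<and> (\<lambda>n. L2_norm M (\<lambda>x. Dn n cayley g x - h x)) \<longlonglongrightarrow> 0"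
    using h by blast
qed

text \<open>Strong convergence does not pass to adjoints in general; here the adjoints act as
  inverses. If \<open>h\<close> is the expected limit, then \<open>cayley\<close> sends
  \<open>h\<close> back to \<open>g\<close>, so \<open>Dn n cayley h\<close> is close to
  \<open>g\<close>, and the conjugate multiplier takes it to the average of
  \<open>h\<close>.\<close>

lemma spectrally_convergent_cnj_cayley: "spectrally_convergent (\<lambda>\<omega>. cnj (cayley \<omega>))"
  unfolding spectrally_convergent_def
proof (intro conjI ballI)
  have cm: "cayley \<in> borel_measurable borel" by measurable
  have cb: "bounded (range cayley)" by (auto simp: bounded_iff intro!: exI[of _ 1])
  show ccm: "(\<lambda>\<omega>. cnj (cayley \<omega>)) \<in> borel_measurable borel" by measurable
  show ccb: "bounded (range (\<lambda>\<omega>. cnj (cayley \<omega>)))" by (auto simp: bounded_iff intro!: exI[of _ 1])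
  fix g assume g: "g \<in> L2 M"
  obtain h where h: "has (\<lambda>\<omega>. cnj (cayley \<omega>)) g h" using has_exists[OF ccm ccb g] by blast
  note hL = has_L2[OF h]
  obtain y where y: "has cayley h y" "(\<lambda>n. L2_norm M (\<lambda>x. Dn n cayley h x - y x)) \<longlonglongrightarrow> 0"
    using spectrally_convergent_cayley hL unfolding spectrally_convergent_def by blast
  note yL = has_L2[OF y(1)]
  have "has (\<lambda>\<omega>. cayley \<omega> * cnj (cayley \<omega>)) g y" by (rule has_mult[OF cm cb ccm ccb h y(1) g])
  then have "has (\<lambda>\<omega>. 1) g y" unfolding mult.commute[of "cayley _"] cnj_cayley_mult .
  then have "L2_norm M (\<lambda>x. 1 * g x - y x) = 0"
    by (intro has_unique[OF _ _ has_const[OF g] _ g]) (auto simp: bounded_iff)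
  then have gy: "L2_norm M (\<lambda>x. g x - y x) = 0" by simp
  have "(\<lambda>n. L2_norm M (\<lambda>x. Dn n (\<lambda>\<omega>. cnj (cayley \<omega>)) g x - h x)) \<longlonglongrightarrow> 0"
  proof (rule null_sequenceI)
    have "(\<lambda>n. L2_norm M (\<lambda>x. Dn n cayley h x - y x) + L2_norm M (\<lambda>x. Wn n h x - h x)) \<longlonglongrightarrow> 0 + 0"
      by (intro tendsto_intros y averaging_tendsto hL)
    then show "(\<lambda>n. L2_norm M (\<lambda>x. Dn n cayley h x - y x) + L2_norm M (\<lambda>x. Wn n h x - h x)) \<longlonglongrightarrow> 0" by simp
    fix n :: nat assume n: "1 \<le> n"
    interpret cell_spectrum M "P n" "F n" "q n" "v n" "\<theta> n" "\<tau> n" using n by (rule cell_spectrum)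
    let ?c = "\<lambda>\<omega>. cnj (cayley \<omega>)"
    have "Dn n ?c (Dn n cayley h) = Dn n (\<lambda>\<omega>. 1) h" unfolding D_mult cnj_cayley_mult ..
    then have inv: "AE x in M. Dn n ?c (Dn n cayley h) x = Wn n h x" using D_one_averaging[OF hL] by simp
    have "L2_norm M (\<lambda>x. Dn n ?c g x - h x) \<le>
        L2_norm M (\<lambda>x. Dn n ?c g x - Dn n ?c (Dn n cayley h) x) + L2_norm M (\<lambda>x. Dn n ?c (Dn n cayley h) x - h x)"
      by (intro L2_norm_dist_triangle D_L2 hL)
    also have "L2_norm M (\<lambda>x. Dn n ?c (Dn n cayley h) x - h x) = L2_norm M (\<lambda>x. Wn n h x - h x)"
      using inv by (intro L2_norm_cong_AE L2_measurable L2_diff D_L2 averaging_L2 hL) (auto elim: eventually_mono)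
    also have "L2_norm M (\<lambda>x. Dn n ?c g x - Dn n ?c (Dn n cayley h) x) \<le> 1 * L2_norm M (\<lambda>x. g x - Dn n cayley h x)"
      unfolding D_diff_arg[OF g D_L2, symmetric] by (intro D_norm_le_L2 L2_diff g D_L2) simp
    also have "L2_norm M (\<lambda>x. g x - Dn n cayley h x) \<le> L2_norm M (\<lambda>x. g x - y x) + L2_norm M (\<lambda>x. y x - Dn n cayley h x)"
      by (intro L2_norm_dist_triangle g yL D_L2)
    finally show "L2_norm M (\<lambda>x. Dn n ?c g x - h x) \<le>
        L2_norm M (\<lambda>x. Dn n cayley h x - y x) + L2_norm M (\<lambda>x. Wn n h x - h x)"
      using gy by (simp add: L2_norm_minus_commute[of M y])
  qed simp
  then show "\<exists>h. has (\<lambda>\<omega>. cnj (cayley \<omega>)) g h \<and>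
      (\<lambda>n. L2_norm M (\<lambda>x. Dn n (\<lambda>\<omega>. cnj (cayley \<omega>)) g x - h x)) \<longlonglongrightarrow> 0" using h by blast
qed

text \<open>Polynomials in the two real coordinates of the plane are generated by \<open>z\<close>
  and its conjugate, which is why both multipliers had to be treated.\<close>

lemma spectrally_convergent_real_polynomial:
  fixes p :: "complex \<Rightarrow> real"
  assumes "real_polynomial_function p"
  shows "spectrally_convergent (\<lambda>\<omega>. of_real (p (cayley \<omega>)))"
  using assms
proof (induction rule: real_polynomial_function.induct)
  case (linear p)
  then interpret p: bounded_linear p .
  \<comment> \<open>A real-linear functional on the plane has the form
    \<open>\<alpha> * z + \<beta> * cnj z\<close>; the coefficients are read off from its values at
    1 and \<open>\<i>\<close>.\<close>
  define \<alpha> where "\<alpha> = (complex_of_real (p 1) - \<i> * of_real (p \<i>)) / 2"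
  define \<beta> where "\<beta> = (complex_of_real (p 1) + \<i> * of_real (p \<i>)) / 2"
  have "of_real (p z) = \<alpha> * z + \<beta> * cnj z" for z
  proof -
    have "z = Re z *\<^sub>R 1 + Im z *\<^sub>R \<i>" by (simp add: complex_eq_iff)
    then have "p z = p (Re z *\<^sub>R 1 + Im z *\<^sub>R \<i>)" by (rule arg_cong)
    also have "\<dots> = Re z * p 1 + Im z * p \<i>" by (simp add: p.add p.scaleR)
    finally show ?thesis by (simp add: \<alpha>_def \<beta>_def complex_eq_iff field_simps)
  qed
  then show ?case
    using spectrally_convergent_linear[OF spectrally_convergent_cayley spectrally_convergent_cnj_cayley, of \<alpha> \<beta>] by simp
next
  case (const c)
  then show ?case by (rule spectrally_convergent_const)
next
  case (add f g)
  then show ?case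
    using spectrally_convergent_linear[of "\<lambda>\<omega>. of_real (f (cayley \<omega>))" "\<lambda>\<omega>. of_real (g (cayley \<omega>))" 1 1] by simp
next
  case (mult f g)
  then show ?case
    using spectrally_convergent_mult[of "\<lambda>\<omega>. of_real (f (cayley \<omega>))" "\<lambda>\<omega>. of_real (g (cayley \<omega>))"] by simp
qed

text \<open>\<open>\<phi>\<close> is the pullback by \<open>cayley\<close> of a continuous function
  on the compact circle, where uniform approximation by polynomials is available; the point
  \<open>- 1\<close>, missed by \<open>cayley\<close>, receives the limit 0 at infinity.\<close>

lemma spectrally_convergent_vanishing:
  fixes \<phi> :: "real \<Rightarrow> complex"
  assumes cont: "continuous_on UNIV \<phi>" and vanish: "(\<phi> \<longlongrightarrow> 0) at_infinity"
  shows "spectrally_convergent \<phi>"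
proof -
  define f where "f = (\<lambda>z. if z = - 1 then 0 else \<phi> (Im ((z - 1) / (z + 1))))"
  have fc: "continuous_on (sphere 0 1) f"
    unfolding f_def by (rule continuous_on_circle_extension[OF cont vanish])
  have c: "cayley \<omega> \<in> sphere 0 1" for \<omega> by simp
  have f: "f (cayley \<omega>) = \<phi> \<omega>" for \<omega>
  proof -
    have "cayley \<omega> \<noteq> - 1" using one_minus_ii_nonzero[of \<omega>] by (simp add: cayley_def resolvent_def)
    then show ?thesis unfolding f_def cayley_inverse by simp
  qed
  show ?thesis
  proof (rule spectrally_convergent_uniform_limit)
    show "\<phi> \<in> borel_measurable borel" using cont by (rule borel_measurable_continuous_onI)
    have "range \<phi> \<subseteq> f ` sphere 0 1"
    proof (rule image_subsetI)
      fix \<omega> show "\<phi> \<omega> \<in> f ` sphere 0 1" using f[of \<omega>] c[of \<omega>] by (intro image_eqI[of _ _ "cayley \<omega>"]) auto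
    qed
    with compact_imp_bounded[OF compact_continuous_image[OF fc compact_sphere]]
    show "bounded (range \<phi>)" by (rule bounded_subset)
    fix \<epsilon> :: real assume "0 < \<epsilon>"
    from Stone_Weierstrass_polynomial_function[OF compact_sphere fc this]
    obtain p where p: "polynomial_function p \<and> (\<forall>z\<in>sphere 0 1. cmod (f z - p z) < \<epsilon>)" by (rule exE)
    have "real_polynomial_function (Re \<circ> p)" "real_polynomial_function (Im \<circ> p)"
      using p[THEN conjunct1, unfolded polynomial_function_def, rule_format, OF bounded_linear_Re]
        p[THEN conjunct1, unfolded polynomial_function_def, rule_format, OF bounded_linear_Im] .
    from this[THEN spectrally_convergent_real_polynomial]
    have "spectrally_convergent (\<lambda>\<omega>. 1 * of_real (Re (p (cayley \<omega>))) + \<i> * of_real (Im (p (cayley \<omega>))))"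
      unfolding comp_def by (rule spectrally_convergent_linear)
    then have "spectrally_convergent (\<lambda>\<omega>. p (cayley \<omega>))" unfolding mult_1 complex_eq[symmetric] .
    moreover have "cmod (\<phi> \<omega> - p (cayley \<omega>)) \<le> \<epsilon>" for \<omega>
      using p[THEN conjunct2, THEN bspec, OF c[of \<omega>]] unfolding f by (rule less_imp_le)
    ultimately show "\<exists>\<psi>. spectrally_convergent \<psi> \<and> (\<forall>\<omega>. cmod (\<phi> \<omega> - \<psi> \<omega>) \<le> \<epsilon>)" by blast
  qed
qed

text \<open>\<open>pvm_integral\<close> is a chosen representative. Uniqueness up to null functions
  identifies it with the limit \<open>h\<close>, and \<open>D_averaging\<close> reinstates the
  averaged observable.\<close>

lemma spectral_approximation_limit:
  assumes conv: "spectrally_convergent \<phi>" and g: "g \<in> L2 M"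
  shows "(\<lambda>n. L2_norm M (\<lambda>x. \<Phi> \<phi> g x - Dn n \<phi> (Wn n g) x)) \<longlonglongrightarrow> 0"
proof -
  have m: "\<phi> \<in> borel_measurable borel" "bounded (range \<phi>)" using conv by (auto simp: spectrally_convergent_def)
  obtain h where h: "has \<phi> g h" "(\<lambda>n. L2_norm M (\<lambda>x. Dn n \<phi> g x - h x)) \<longlonglongrightarrow> 0"
    using conv g unfolding spectrally_convergent_def by blast
  note P = has_\<Phi>[OF m g]
  have z: "L2_norm M (\<lambda>x. \<Phi> \<phi> g x - h x) = 0" by (rule has_unique[OF m P h(1) g])
  show ?thesis
  proof (rule null_sequenceI[OF _ h(2)])
    fix n :: nat assume n: "1 \<le> n"
    interpret cell_spectrum M "P n" "F n" "q n" "v n" "\<theta> n" "\<tau> n" using n by (rule cell_spectrum)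
    show "L2_norm M (\<lambda>x. \<Phi> \<phi> g x - Dn n \<phi> (Wn n g) x) \<le> L2_norm M (\<lambda>x. Dn n \<phi> g x - h x)"
      using L2_norm_dist_triangle[OF has_L2[OF P] has_L2[OF h(1)] D_L2, of \<phi> g] z
      by (simp add: D_averaging[OF g] L2_norm_minus_commute[of M h])
  qed simp
qed

end

theorem theorem5p1:
  fixes X :: "(real ^ 'n) set"
    and \<nu> :: "real ^ 'n \<Rightarrow> real"
    and S :: "real \<Rightarrow> real ^ 'n \<Rightarrow> real ^ 'n"
    and M :: "(real ^ 'n) measure"
    and E :: "real set \<Rightarrow> (real ^ 'n \<Rightarrow> complex) \<Rightarrow> (real ^ 'n \<Rightarrow> complex)"
    and \<tau> l :: "nat \<Rightarrow> real"
    and q :: "nat \<Rightarrow> nat"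
    and P :: "nat \<Rightarrow> (real ^ 'n) set set"
    and F :: "nat \<Rightarrow> (real ^ 'n) set \<Rightarrow> (real ^ 'n) set"
    and v :: "nat \<Rightarrow> nat \<Rightarrow> real ^ 'n \<Rightarrow> complex"
    and \<theta> :: "nat \<Rightarrow> nat \<Rightarrow> real"
    and \<phi> :: "real \<Rightarrow> complex"
    and g :: "real ^ 'n \<Rightarrow> complex"
  assumes "compact X" and "is_norm \<nu>"
    and "lipschitz_flow_on \<nu> X S"
    and "space M = X" and "sets M = sets (restrict_space borel X)"
    and "finite_measure M" and "emeasure M X \<noteq> 0"
    and "absolutely_continuous (restrict_space lborel X) M"
    and "measure_support M = X"
    and "flow_invariant M S"
    and "koopman_spectral_measure M S E"
    and "\<And>n. n \<ge> 1 \<Longrightarrow> \<tau> n > 0" and "antimono_on {1..} \<tau>" and "\<tau> \<longlonglongrightarrow> 0"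
    and "partition_seq \<nu> M q l P"
    and "\<And>n. n \<ge> 1 \<Longrightarrow> bij_betw (F n) (P n) (P n)"
    and "\<And>n. n \<ge> 1 \<Longrightarrow> koopman_eigenbasis M (P n) (F n) (q n) (v n) (\<theta> n)"
    and "periodically_approximates \<nu> X S \<tau> P F"
    and "schwartz \<phi>"
    and "g \<in> L2 M"
  shows "(\<lambda>n. L2_norm M (\<lambda>x. pvm_integral M E \<phi> g x -
            discrete_spectral_op M (q n) (v n) (\<lambda>k. \<theta> n k / \<tau> n) \<phi> (averaging M (P n) g) x))
         \<longlonglongrightarrow> 0"
proof -
  interpret finite_measure M by fact
  have "compact_flow_axioms M X \<nu> S" using assms by (intro compact_flow_axioms.intro)
  moreover have "projection_valued_measure M E"
    and "\<And>t g. g \<in> L2 M \<Longrightarrow> has_pvm_integral M E (\<lambda>\<omega>. exp (\<i> * of_real (\<omega> * t))) g (koopman S t g)"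
    using assms(11) unfolding koopman_spectral_measure_def by auto
  ultimately interpret spectral_approximation M X \<nu> S E \<tau> l q P F v \<theta>
    using assms by unfold_locales (auto simp: compact_flow_axioms_def)
  show ?thesis
    by (intro spectral_approximation_limit spectrally_convergent_vanishing schwartz_continuous
        schwartz_vanishes_at_infinity assms)
qed

end
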